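(* For every $d\ge0$, the maps given on the generators of $\tilde{\mathcal S}$ by $$\Phi(\Delta,(x_1,\dots,x_d))=\big((\pi_1\Delta(x_1),\dots,\pi_1\Delta(x_d)),(\pi_2\Delta(x_1),\dots,\pi_2\Delta(x_d))\big),$$ $$\Phi(\varepsilon,(x_1,\dots,x_d))=(\varepsilon(x_1),\dots,\varepsilon(x_d)),$$ $$\Phi(\mu_s,(x_1,\dots,x_d),(y_1,\dots,y_d))=(\psi_s(x_1,y_1),\dots,\psi_s(x_d,y_d)),$$ $$\Phi(h_s,(x_1,\dots,x_d))=(\phi_s(x_1),\dots,\phi_s(x_d))$$ for $s\in[0,1]$ define an $\tilde{\mathcal S}$-bialgebra structure on the simplex $\mathbf\Delta^d$.
   Context: Work in the symmetric monoidal category $(\mathrm{CW},\times,\mathbf 1)$ of CW-complexes and CW-maps (cellular maps), $\mathbf 1$ being a single $0$-cell; $\mathrm I=[0,1]$ with its usual CW-structure. Props. A prop $\mathcal P$ is a strict symmetric monoidal category enriched in CW generated by a single object $p$. Put $\mathcal P(n,m)=\mathrm{Hom}(p^{\odot n},p^{\odot m})$ ($n$ inputs, $m$ outputs), with commuting right $\Sigma_n$- and left $\Sigma_m$-actions, horizontal compositions $\odot$, vertical compositions $\circ$, and units. A $\mathcal P$-bialgebra structure on a CW-complex $X$ is a collection of CW-maps $\mathcal P(n,m)\times X^n\to X^m$, $n,m\ge0$, satisfying the associativity, equivariance and unitality relations. Presentations. The free prop on a $\Sigma$-bimodule $\mathcal B$ consists of isomorphism classes of finite directed graphs without directed loops,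 with labeled external incoming and outgoing half-edges and labeled half-edges at each vertex, vertices being decorated by elements of $\mathcal B$, modulo compatibility of decorations with relabeling. A prop presented by generating cells (copies of $\mathrm I^d$ in given biarities), attaching maps and relations is obtained from the free prop on the generating $0$-cells by successively attaching the generating $d$-cells via pushouts of props along the attaching maps, then taking the quotient by the smallest identification containing the relations and closed under symmetric group actions and compositions. The prop $\tilde{\mathcal S}$ has generating cells: a $0$-cell $\varepsilon\in\tilde{\mathcal S}(1,0)$; a $0$-cell $\Delta\in\tilde{\mathcal S}(1,2)$; a $1$-cell $\{\mu_s\}_{s\in\mathrm I}$ in $\tilde{\mathcal S}(2,1)$; a $1$-cell $\{h_s\}_{s\in \mathrm I}$ in $\tilde{\mathcal S}(1,1)$. Attaching maps: $\mu_0=\mathrm{id}\odot\varepsilon$, $\mu_1=\varepsilon\odot\mathrm{id}$, $h_0=\mathrm{id}$, $h_1=(\varepsilon\odot\mathrm{id})\circ\Delta$. Relations (for all $s\in\mathrm I$): $(\varepsilon\odot\varepsilon)\circ\Delta=\varepsilon$, $\varepsilon\circ\mu_s=\varepsilon\odot\varepsilon$, $\varepsilon\circ h_s=\varepsilon$. Simplices. $\mathbf\Delta^0=\{0\}$, $\mathbf\Delta^1=[0,1]$, and for $d\ge1$, $\mathbf\Delta^d=\{(x_1,\dots,x_d)\in\mathrm I^d : x_1\le\cdots\le x_d\}$, with the CW-structure in which $(x_1,\dots,x_d)$ lies in the $k$-skeleton iff $\{x_i : x_i\ne0,1\}$ has cardinality at most $k$. Maps on the interval, for $x,y\in\mathbf\Delta^1$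 and $s\in\mathrm I$: $\Delta:\mathbf\Delta^1\to\mathbf\Delta^1\times\mathbf\Delta^1$, $\Delta(x)=(0,2x)$ if $x\le1/2$ and $(2x-1,1)$ if $x\ge1/2$, with components $\pi_1\Delta,\pi_2\Delta$; $\psi:\mathrm I\times\mathbf\Delta^1\times\mathbf\Delta^1\to\mathbf\Delta^1$, $\psi_s(x,y)=(1-s)x+sy$; $\phi:\mathrm I\times\mathbf\Delta^1\to\mathbf\Delta^1$, $\phi_s(x)=\frac{2x}{2-s}$ if $x\le\frac{2-s}2$ and $\phi_s(x)=1$ if $x\ge\frac{2-s}2$; $\varepsilon:\mathbf\Delta^1\to\{0\}$ the terminal map. The target of $\Phi(\varepsilon,-)$ is the single point $\{(0,\dots,0)\}$, identified with $(\mathbf\Delta^d)^0=\mathbf 1$. *)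

theory Defs
  imports "HOL-Analysis.Analysis"
begin

section \<open>CW-structures and CW-maps\<close>

text \<open>A CW-structure is recorded by the data on which the notion of a CW-map (cellular map) depends:
  the topology and the filtration by skeleta.\<close>

record 'a cw_space =
  cw_top :: "'a topology"
  cw_skel :: "nat \<Rightarrow> 'a set"

abbreviation cw_points :: "'a cw_space \<Rightarrow> 'a set" where
  "cw_points X \<equiv> topspace (cw_top X)"

definition cw_map :: "'a cw_space \<Rightarrow> 'b cw_space \<Rightarrow> ('a \<Rightarrow> 'b) \<Rightarrow> bool" where
  "cw_map X Y f \<longleftrightarrow>
     continuous_map (cw_top X) (cw_top Y) f \<and> (\<forall>k. f ` cw_skel X k \<subseteq> cw_skel Y k)"

text \<open>The product topology is the topology of the product CW-complex as soon as one of the factors is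
  locally compact; below, the second factor is always a power of a compact space.\<close>

definition cw_prod :: "'a cw_space \<Rightarrow> 'b cw_space \<Rightarrow> ('a \<times> 'b) cw_space" where
  "cw_prod X Y =
     \<lparr>cw_top = prod_topology (cw_top X) (cw_top Y),
      cw_skel = (\<lambda>k. \<Union>i\<le>k. cw_skel X i \<times> cw_skel Y (k - i))\<rparr>"

text \<open>The points of the \<open>n\<close>-th power are the functions on \<open>{..<n}\<close> (undefined elsewhere); for \<open>n = 0\<close>
  this is a single point.\<close>

definition cw_power :: "'a cw_space \<Rightarrow> nat \<Rightarrow> (nat \<Rightarrow> 'a) cw_space" where
  "cw_power X n =
     \<lparr>cw_top = product_topology (\<lambda>_. cw_top X) {..<n},
      cw_skel = (\<lambda>k. {x \<in> {..<n} \<rightarrow>\<^sub>E cw_points X.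
                       \<exists>e. (\<forall>i<n. x i \<in> cw_skel X (e i)) \<and> (\<Sum>i<n. e i) \<le> k})\<rparr>"

definition tuple :: "'a list \<Rightarrow> nat \<Rightarrow> 'a" where
  "tuple xs = (\<lambda>i\<in>{..<length xs}. xs ! i)"

definition tuple_append :: "nat \<Rightarrow> nat \<Rightarrow> (nat \<Rightarrow> 'a) \<Rightarrow> (nat \<Rightarrow> 'a) \<Rightarrow> nat \<Rightarrow> 'a" where
  "tuple_append n n' x y = (\<lambda>i\<in>{..<n + n'}. if i < n then x i else y (i - n))"

definition tuple_perm :: "nat \<Rightarrow> (nat \<Rightarrow> nat) \<Rightarrow> (nat \<Rightarrow> 'a) \<Rightarrow> nat \<Rightarrow> 'a" where
  "tuple_perm n \<sigma> x = (\<lambda>i\<in>{..<n}. x (inv \<sigma> i))"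


section \<open>Props and bialgebras over props\<close>

record 'a prop_data =
  Hom :: "nat \<Rightarrow> nat \<Rightarrow> 'a cw_space"
  ident :: "nat \<Rightarrow> 'a"
  hcomp :: "'a \<Rightarrow> 'a \<Rightarrow> 'a"
  vcomp :: "'a \<Rightarrow> 'a \<Rightarrow> 'a"
  lact :: "(nat \<Rightarrow> nat) \<Rightarrow> 'a \<Rightarrow> 'a"
  ract :: "'a \<Rightarrow> (nat \<Rightarrow> nat) \<Rightarrow> 'a"

text \<open>Conventions: \<open>Hom P n m\<close> has \<open>n\<close> inputs and \<open>m\<close> outputs, \<open>vcomp P q p\<close> is \<open>q\<close> after \<open>p\<close>, and a
  permutation \<open>\<sigma>\<close> of \<open>{..<n}\<close> moves the \<open>i\<close>-th component of an \<open>n\<close>-tuple to position \<open>\<sigma> i\<close>.\<close>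

definition is_bialgebra ::
  "'a prop_data \<Rightarrow> 'x cw_space \<Rightarrow> (nat \<Rightarrow> nat \<Rightarrow> 'a \<times> (nat \<Rightarrow> 'x) \<Rightarrow> (nat \<Rightarrow> 'x)) \<Rightarrow> bool" where
  "is_bialgebra P X \<Phi> \<longleftrightarrow>
     (\<forall>n m. \<Phi> n m \<in> extensional (cw_points (Hom P n m) \<times> cw_points (cw_power X n)) \<and>
            cw_map (cw_prod (Hom P n m) (cw_power X n)) (cw_power X m) (\<Phi> n m)) \<and>
     (\<forall>n. \<forall>x \<in> cw_points (cw_power X n). \<Phi> n n (ident P n, x) = x) \<and>
     (\<forall>n m l. \<forall>p \<in> cw_points (Hom P n m). \<forall>q \<in> cw_points (Hom P m l).
        \<forall>x \<in> cw_points (cw_power X n).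
          \<Phi> n l (vcomp P q p, x) = \<Phi> m l (q, \<Phi> n m (p, x))) \<and>
     (\<forall>n m n' m'. \<forall>p \<in> cw_points (Hom P n m). \<forall>q \<in> cw_points (Hom P n' m').
        \<forall>x \<in> cw_points (cw_power X n). \<forall>y \<in> cw_points (cw_power X n').
          \<Phi> (n + n') (m + m') (hcomp P p q, tuple_append n n' x y) =
            tuple_append m m' (\<Phi> n m (p, x)) (\<Phi> n' m' (q, y))) \<and>
     (\<forall>n m \<sigma>. \<forall>p \<in> cw_points (Hom P n m). \<forall>x \<in> cw_points (cw_power X n).
        \<sigma> permutes {..<m} \<longrightarrow> \<Phi> n m (lact P \<sigma> p, x) = tuple_perm m \<sigma> (\<Phi> n m (p, x))) \<and>
     (\<forall>n m \<tau>. \<forall>p \<in> cw_points (Hom P n m). \<forall>x \<in> cw_points (cw_power X n).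
        \<tau> permutes {..<n} \<longrightarrow> \<Phi> n m (ract P p \<tau>, x) = \<Phi> n m (p, tuple_perm n \<tau> x))"


section \<open>Graphs decorated by generating cells\<close>

record 'c cells =
  cdim :: "'c \<Rightarrow> nat"
  cin :: "'c \<Rightarrow> nat"
  cout :: "'c \<Rightarrow> nat"

definition cube :: "nat \<Rightarrow> (nat \<Rightarrow> real) topology" where
  "cube d = subtopology (powertop_real {..<d}) ({..<d} \<rightarrow>\<^sub>E {0..1})"

text \<open>The space of generators: the disjoint union of a cube for every generating cell.\<close>

type_synonym 'c dec = "'c \<times> (nat \<Rightarrow> real)"

definition gen_top :: "'c cells \<Rightarrow> 'c dec topology" where
  "gen_top C = sum_topology (\<lambda>c. cube (cdim C c)) UNIV"

definition dec_dim :: "'c cells \<Rightarrow> 'c dec \<Rightarrow> nat" where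
  "dec_dim C = (\<lambda>(c, s). card {i. i < cdim C c \<and> 0 < s i \<and> s i < 1})"

text \<open>A graph with \<open>gin\<close> external incoming and \<open>gout\<close> external outgoing half-edges has the vertices
  \<open>{..<nvert}\<close>. Edges are directed from sources (external incoming half-edges and outputs of
  vertices) to targets (external outgoing half-edges and inputs of vertices), and \<open>wire\<close> gives the
  source of the edge that arrives at a given target; its values elsewhere are irrelevant.

  The \<open>\<Sigma>\<close>-bimodule spanned by the generating cells is free, so modulo the compatibility of
  decorations with relabelings of half-edges every vertex is decorated by a point of a generating
  cell, its half-edges carrying the labels of the inputs and outputs of that cell.\<close>

datatype source = ExtIn nat | VertOut nat nat
datatype target = ExtOut nat | VertIn nat nat

record shape =
  gin :: nat
  gout :: nat
  nvert :: nat
  wire :: "target \<Rightarrow> source"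

type_synonym 'c graph = "shape \<times> (nat \<Rightarrow> 'c dec)"

abbreviation inputs :: "'c graph \<Rightarrow> nat" where "inputs g \<equiv> gin (fst g)"
abbreviation outputs :: "'c graph \<Rightarrow> nat" where "outputs g \<equiv> gout (fst g)"
abbreviation verts :: "'c graph \<Rightarrow> nat" where "verts g \<equiv> nvert (fst g)"
abbreviation wiring :: "'c graph \<Rightarrow> target \<Rightarrow> source" where "wiring g \<equiv> wire (fst g)"
abbreviation deco :: "'c graph \<Rightarrow> nat \<Rightarrow> 'c dec" where "deco g \<equiv> snd g"

definition sources :: "'c cells \<Rightarrow> 'c graph \<Rightarrow> source set" where
  "sources C g = {ExtIn i |i. i < inputs g} \<union>
     {VertOut v j |v j. v < verts g \<and> j < cout C (fst (deco g v))}"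

definition targets :: "'c cells \<Rightarrow> 'c graph \<Rightarrow> target set" where
  "targets C g = {ExtOut j |j. j < outputs g} \<union>
     {VertIn v i |v i. v < verts g \<and> i < cin C (fst (deco g v))}"

definition vertex_edges :: "'c cells \<Rightarrow> 'c graph \<Rightarrow> (nat \<times> nat) set" where
  "vertex_edges C g = {(u, v). \<exists>i j. VertIn v i \<in> targets C g \<and> wiring g (VertIn v i) = VertOut u j}"

definition graphs :: "'c cells \<Rightarrow> nat \<Rightarrow> nat \<Rightarrow> 'c graph set" where
  "graphs C n m = {g. inputs g = n \<and> outputs g = m \<and>
     deco g \<in> {..<verts g} \<rightarrow>\<^sub>E topspace (gen_top C) \<and>
     bij_betw (wiring g) (targets C g) (sources C g) \<and>
     acyclic (vertex_edges C g)}"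

fun map_source :: "(nat \<Rightarrow> nat) \<Rightarrow> (nat \<Rightarrow> nat) \<Rightarrow> source \<Rightarrow> source" where
  "map_source f \<pi> (ExtIn i) = ExtIn (f i)"
| "map_source f \<pi> (VertOut v j) = VertOut (\<pi> v) j"

fun map_target :: "(nat \<Rightarrow> nat) \<Rightarrow> (nat \<Rightarrow> nat) \<Rightarrow> target \<Rightarrow> target" where
  "map_target f \<pi> (ExtOut j) = ExtOut (f j)"
| "map_target f \<pi> (VertIn v i) = VertIn (\<pi> v) i"

definition graph_iso :: "'c cells \<Rightarrow> 'c graph \<Rightarrow> 'c graph \<Rightarrow> bool" where
  "graph_iso C g h \<longleftrightarrow> inputs h = inputs g \<and> outputs h = outputs g \<and>
     (\<exists>\<pi>. bij_betw \<pi> {..<verts g} {..<verts h} \<and>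
        (\<forall>v<verts g. deco h (\<pi> v) = deco g v) \<and>
        (\<forall>t \<in> targets C g. wiring h (map_target id \<pi> t) = map_source id \<pi> (wiring g t)))"

definition g_ident :: "nat \<Rightarrow> 'c graph" where
  "g_ident n = (\<lparr>gin = n, gout = n, nvert = 0,
     wire = (\<lambda>t. case t of ExtOut j \<Rightarrow> ExtIn j | VertIn v i \<Rightarrow> undefined)\<rparr>, \<lambda>_. undefined)"

definition g_corolla :: "'c cells \<Rightarrow> 'c dec \<Rightarrow> 'c graph" where
  "g_corolla C b = (\<lparr>gin = cin C (fst b), gout = cout C (fst b), nvert = 1,
     wire = (\<lambda>t. case t of ExtOut j \<Rightarrow> VertOut 0 j | VertIn v i \<Rightarrow> ExtIn i)\<rparr>, tuple [b])"

definition g_hcomp :: "'c graph \<Rightarrow> 'c graph \<Rightarrow> 'c graph" where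
  "g_hcomp g h =
     (let shift = map_source ((+) (inputs g)) ((+) (verts g)) in
      (\<lparr>gin = inputs g + inputs h, gout = outputs g + outputs h, nvert = verts g + verts h,
        wire = (\<lambda>t. case t of
            ExtOut j \<Rightarrow> if j < outputs g then wiring g (ExtOut j)
                        else shift (wiring h (ExtOut (j - outputs g)))
          | VertIn v i \<Rightarrow> if v < verts g then wiring g (VertIn v i)
                        else shift (wiring h (VertIn (v - verts g) i)))\<rparr>,
       tuple_append (verts g) (verts h) (deco g) (deco h)))"

definition g_vcomp :: "'c graph \<Rightarrow> 'c graph \<Rightarrow> 'c graph" where
  "g_vcomp h g =
     (let glue = (\<lambda>s. case s of
            ExtIn i \<Rightarrow> wiring g (ExtOut i)
          | VertOut v j \<Rightarrow> VertOut (verts g + v) j) in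
      (\<lparr>gin = inputs g, gout = outputs h, nvert = verts g + verts h,
        wire = (\<lambda>t. case t of
            ExtOut j \<Rightarrow> glue (wiring h (ExtOut j))
          | VertIn v i \<Rightarrow> if v < verts g then wiring g (VertIn v i)
                        else glue (wiring h (VertIn (v - verts g) i)))\<rparr>,
       tuple_append (verts g) (verts h) (deco g) (deco h)))"

definition g_lact :: "(nat \<Rightarrow> nat) \<Rightarrow> 'c graph \<Rightarrow> 'c graph" where
  "g_lact \<sigma> g = ((fst g)\<lparr>wire := \<lambda>t. wiring g (map_target (inv \<sigma>) id t)\<rparr>, deco g)"

definition g_ract :: "'c graph \<Rightarrow> (nat \<Rightarrow> nat) \<Rightarrow> 'c graph" where
  "g_ract g \<tau> = ((fst g)\<lparr>wire := \<lambda>t. map_source (inv \<tau>) id (wiring g t)\<rparr>, deco g)"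


section \<open>Props presented by generating cells, attaching maps and relations\<close>

text \<open>Graphs of a given shape are topologized by the product of the spaces of decorations, and
  graphs of different shapes lie in different summands.\<close>

definition graph_space :: "'c cells \<Rightarrow> nat \<Rightarrow> nat \<Rightarrow> 'c graph cw_space" where
  "graph_space C n m =
     \<lparr>cw_top = subtopology
        (sum_topology (\<lambda>S. product_topology (\<lambda>_. gen_top C) {..<nvert S}) UNIV) (graphs C n m),
      cw_skel = (\<lambda>k. {g \<in> graphs C n m. (\<Sum>v<verts g. dec_dim C (deco g v)) \<le> k})\<rparr>"

text \<open>The smallest identification of graphs that contains isomorphism and the relation \<open>R\<close> and is
  closed under the symmetric group actions and the compositions.\<close>

inductive identified :: "'c cells \<Rightarrow> ('c graph \<Rightarrow> 'c graph \<Rightarrow> bool) \<Rightarrow> 'c graph \<Rightarrow> 'c graph \<Rightarrow> bool"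
  for C R where
  iso: "\<lbrakk>g \<in> graphs C n m; h \<in> graphs C n m; graph_iso C g h\<rbrakk> \<Longrightarrow> identified C R g h"
| rel: "\<lbrakk>g \<in> graphs C n m; h \<in> graphs C n m; R g h\<rbrakk> \<Longrightarrow> identified C R g h"
| sym: "identified C R g h \<Longrightarrow> identified C R h g"
| trans: "\<lbrakk>identified C R g h; identified C R h k\<rbrakk> \<Longrightarrow> identified C R g k"
| lact: "\<lbrakk>identified C R g h; \<sigma> permutes {..<outputs g}\<rbrakk>
           \<Longrightarrow> identified C R (g_lact \<sigma> g) (g_lact \<sigma> h)"
| ract: "\<lbrakk>identified C R g h; \<tau> permutes {..<inputs g}\<rbrakk>
           \<Longrightarrow> identified C R (g_ract g \<tau>) (g_ract h \<tau>)"
| hcomp: "\<lbrakk>identified C R g h; identified C R g' h'\<rbrakk>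
           \<Longrightarrow> identified C R (g_hcomp g g') (g_hcomp h h')"
| vcomp: "\<lbrakk>identified C R g h; identified C R g' h'; inputs g' = outputs g\<rbrakk>
           \<Longrightarrow> identified C R (g_vcomp g' g) (g_vcomp h' h)"

definition quotient_cw :: "'a cw_space \<Rightarrow> ('a \<times> 'a) set \<Rightarrow> 'a set cw_space" where
  "quotient_cw X r =
     \<lparr>cw_top = topology (\<lambda>U. U \<subseteq> cw_points X // r \<and> openin (cw_top X) {x \<in> cw_points X. r `` {x} \<in> U}),
      cw_skel = (\<lambda>k. (\<lambda>x. r `` {x}) ` cw_skel X k)\<rparr>"

text \<open>Gluing a cell along its attaching map is the pushout of free props that identifies a boundary
  point of the cell with its image. Hence the successive attachment of the cells and the final
  quotient by the relations amount to one quotient of the free prop on all generating cells, where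
  \<open>R\<close> comprises the attaching maps and the relations.\<close>

abbreviation gclass :: "'c cells \<Rightarrow> ('c graph \<Rightarrow> 'c graph \<Rightarrow> bool) \<Rightarrow> 'c graph \<Rightarrow> 'c graph set" where
  "gclass C R g \<equiv> Collect (identified C R g)"

definition presented_prop ::
  "'c cells \<Rightarrow> ('c graph \<Rightarrow> 'c graph \<Rightarrow> bool) \<Rightarrow> 'c graph set prop_data" where
  "presented_prop C R =
     \<lparr>Hom = (\<lambda>n m. quotient_cw (graph_space C n m) {(g, h). identified C R g h}),
      ident = (\<lambda>n. gclass C R (g_ident n)),
      hcomp = (\<lambda>p q. \<Union>g\<in>p. \<Union>h\<in>q. gclass C R (g_hcomp g h)),
      vcomp = (\<lambda>q p. \<Union>g\<in>p. \<Union>h\<in>q. gclass C R (g_vcomp h g)),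
      lact = (\<lambda>\<sigma> p. \<Union>g\<in>p. gclass C R (g_lact \<sigma> g)),
      ract = (\<lambda>p \<tau>. \<Union>g\<in>p. gclass C R (g_ract g \<tau>))\<rparr>"


section \<open>The prop \<open>\<S>~\<close>\<close>

datatype st_cell = Eps_cell | Delta_cell | Mu_cell | H_cell

definition st_cells :: "st_cell cells" where
  "st_cells =
     \<lparr>cdim = (\<lambda>c. case c of Eps_cell \<Rightarrow> 0 | Delta_cell \<Rightarrow> 0 | Mu_cell \<Rightarrow> 1 | H_cell \<Rightarrow> 1),
      cin = (\<lambda>c. case c of Eps_cell \<Rightarrow> 1 | Delta_cell \<Rightarrow> 1 | Mu_cell \<Rightarrow> 2 | H_cell \<Rightarrow> 1),
      cout = (\<lambda>c. case c of Eps_cell \<Rightarrow> 0 | Delta_cell \<Rightarrow> 2 | Mu_cell \<Rightarrow> 1 | H_cell \<Rightarrow> 1)\<rparr>"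

definition g_eps :: "st_cell graph" where "g_eps = g_corolla st_cells (Eps_cell, tuple [])"
definition g_Delta :: "st_cell graph" where "g_Delta = g_corolla st_cells (Delta_cell, tuple [])"
definition g_mu :: "real \<Rightarrow> st_cell graph" where "g_mu s = g_corolla st_cells (Mu_cell, tuple [s])"
definition g_h :: "real \<Rightarrow> st_cell graph" where "g_h s = g_corolla st_cells (H_cell, tuple [s])"

inductive st_attach :: "st_cell graph \<Rightarrow> st_cell graph \<Rightarrow> bool" where
  "st_attach (g_mu 0) (g_hcomp (g_ident 1) g_eps)"
| "st_attach (g_mu 1) (g_hcomp g_eps (g_ident 1))"
| "st_attach (g_h 0) (g_ident 1)"
| "st_attach (g_h 1) (g_vcomp (g_hcomp g_eps (g_ident 1)) g_Delta)"

inductive st_rel :: "st_cell graph \<Rightarrow> st_cell graph \<Rightarrow> bool" where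
  "st_rel (g_vcomp (g_hcomp g_eps g_eps) g_Delta) g_eps"
| "s \<in> {0..1} \<Longrightarrow> st_rel (g_vcomp g_eps (g_mu s)) (g_hcomp g_eps g_eps)"
| "s \<in> {0..1} \<Longrightarrow> st_rel (g_vcomp g_eps (g_h s)) g_eps"

definition S_tilde :: "st_cell graph set prop_data" where
  "S_tilde = presented_prop st_cells (sup st_attach st_rel)"

definition S_gen :: "st_cell graph \<Rightarrow> st_cell graph set" where
  "S_gen g = gclass st_cells (sup st_attach st_rel) g"


section \<open>Simplices and maps on the interval\<close>

definition simplex_points :: "nat \<Rightarrow> (nat \<Rightarrow> real) set" where
  "simplex_points d = {x \<in> {1..d} \<rightarrow>\<^sub>E {0..1}. \<forall>i\<in>{1..d}. \<forall>j\<in>{1..d}. i \<le> j \<longrightarrow> x i \<le> x j}"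

definition std_simplex :: "nat \<Rightarrow> (nat \<Rightarrow> real) cw_space" where
  "std_simplex d =
     \<lparr>cw_top = subtopology (powertop_real {1..d}) (simplex_points d),
      cw_skel = (\<lambda>k. {x \<in> simplex_points d. card (x ` {1..d} - {0, 1}) \<le> k})\<rparr>"

definition Delta_I :: "real \<Rightarrow> real \<times> real" where
  "Delta_I x = (if x \<le> 1/2 then (0, 2 * x) else (2 * x - 1, 1))"

definition psi_I :: "real \<Rightarrow> real \<Rightarrow> real \<Rightarrow> real" where
  "psi_I s x y = (1 - s) * x + s * y"

definition phi_I :: "real \<Rightarrow> real \<Rightarrow> real" where
  "phi_I s x = (if x \<le> (2 - s) / 2 then 2 * x / (2 - s) else 1)"

text \<open>\<open>tuple []\<close> is the unique point of the zeroth power of the simplex, i.e. the target of \<open>\<epsilon>\<close>.\<close>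

definition generator_values ::
  "nat \<Rightarrow> (nat \<Rightarrow> nat \<Rightarrow> st_cell graph set \<times> (nat \<Rightarrow> nat \<Rightarrow> real) \<Rightarrow> (nat \<Rightarrow> nat \<Rightarrow> real)) \<Rightarrow> bool" where
  "generator_values d \<Phi> \<longleftrightarrow>
     (\<forall>x \<in> simplex_points d.
        \<Phi> 1 2 (S_gen g_Delta, tuple [x]) =
          tuple [\<lambda>i\<in>{1..d}. fst (Delta_I (x i)), \<lambda>i\<in>{1..d}. snd (Delta_I (x i))]) \<and>
     (\<forall>x \<in> simplex_points d. \<Phi> 1 0 (S_gen g_eps, tuple [x]) = tuple []) \<and>
     (\<forall>s\<in>{0..1}. \<forall>x \<in> simplex_points d. \<forall>y \<in> simplex_points d.
        \<Phi> 2 1 (S_gen (g_mu s), tuple [x, y]) = tuple [\<lambda>i\<in>{1..d}. psi_I s (x i) (y i)]) \<and>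
     (\<forall>s\<in>{0..1}. \<forall>x \<in> simplex_points d.
        \<Phi> 1 1 (S_gen (g_h s), tuple [x]) = tuple [\<lambda>i\<in>{1..d}. phi_I s (x i)])"

end

theory Submission
  imports Defs
begin

text \<open>A graph decorated by generating cells is a recipe for a computation. Once every cell acts on a space \<open>X\<close>,
  points of \<open>X\<close> at the external inputs propagate along the edges, and since there are no directed loops, they
  determine the values on all edges (\<open>valuation\<close>, \<open>eval_graph\<close>). Evaluation is invariant under isomorphism of
  graphs and turns compositions and permutations of graphs into those of maps. Hence it descends to a prop that is
  presented by cells as soon as it respects the attaching maps and relations (\<open>eval_graph_identified\<close>).

  Evaluation is continuous because, for a fixed shape and fixed cells, it is a finite composite of the actions of
  the cells (\<open>continuous_eval_graph\<close>); this passes to the quotient when \<open>X\<close> is compact Hausdorff. It is cellular by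
  a balance of dimensions: if no vertex raises the total dimension of its inputs by more than the dimension of its
  decoration, then summing over all vertices shows the same for the graph, as inner edges cancel
  (\<open>cellular_eval_graph\<close>). Altogether, an algebra over the cells extends to a bialgebra over the prop
  (\<open>is_bialgebra_action\<close>). The extension is unique because splitting off a last vertex again and again writes every
  graph as a composite of permutations, identities and single cells (\<open>graph_generation\<close>, \<open>bialgebra_eqI\<close>).

  On the simplex the cells act on every coordinate separately, by maps of the interval that are monotone in every
  argument and take constant tuples \<open>0\<close> and \<open>1\<close> to \<open>0\<close> and \<open>1\<close>. Monotonicity keeps the coordinates
  ordered. The attaching maps become identities between maps of the interval, and the relations hold since their
  target is a point. The dimension of a point of the simplex is the number of interior values of its coordinates,
  and it is for \<open>\<mu>\<close> that bounding this number takes an argument: the pairs of coordinates form a chain in a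
  finite grid (\<open>card_interior_values_psi\<close>).\<close>

section \<open>Graphs and their wirings\<close>

lemma mem_sources [simp]:
  "ExtIn i \<in> sources C g \<longleftrightarrow> i < inputs g"
  "VertOut v j \<in> sources C g \<longleftrightarrow> v < verts g \<and> j < cout C (fst (deco g v))"
  by (auto simp: sources_def)

lemma mem_targets [simp]:
  "ExtOut j \<in> targets C g \<longleftrightarrow> j < outputs g"
  "VertIn v i \<in> targets C g \<longleftrightarrow> v < verts g \<and> i < cin C (fst (deco g v))"
  by (auto simp: targets_def)

text \<open>Absence of directed loops is used in the form of a rank function on the vertices that increases along
  every edge: such functions are easy to combine when graphs are composed, whereas transitive closures
  of the edge relations of composites are not.\<close>
lemma acyclic_if_rank:
  fixes rank :: "'a \<Rightarrow> nat"
  assumes "\<And>u v. (u, v) \<in> r \<Longrightarrow> rank u < rank v"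
  shows "acyclic r"
proof -
  have "r \<subseteq> inv_image less_than rank"
    using assms by auto
  then show ?thesis
    by (meson acyclic_subset wf_acyclic wf_inv_image wf_less_than)
qed

lemma rank_if_finite_acyclic:
  assumes "finite r" "acyclic r"
  obtains rank :: "'a \<Rightarrow> nat" where "\<And>u v. (u, v) \<in> r \<Longrightarrow> rank u < rank v"
proof
  fix u v assume uv: "(u, v) \<in> r"
  have "{w. (w, v) \<in> r\<^sup>+} \<subseteq> Domain r"
    by (auto dest: tranclD)
  then have "finite {w. (w, v) \<in> r\<^sup>+}"
    using assms(1) finite_subset finite_Domain by metis
  moreover have "{w. (w, u) \<in> r\<^sup>+} \<subset> {w. (w, v) \<in> r\<^sup>+}"
    using uv assms(2) by (auto simp: acyclic_def intro: trancl_into_trancl)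
  ultimately show "card {w. (w, u) \<in> r\<^sup>+} < card {w. (w, v) \<in> r\<^sup>+}"
    by (simp add: psubset_card_mono)
qed

lemma graphsI:
  fixes rank :: "nat \<Rightarrow> nat"
  assumes "inputs g = n" "outputs g = m"
    and "deco g \<in> {..<verts g} \<rightarrow>\<^sub>E topspace (gen_top C)"
    and "bij_betw (wiring g) (targets C g) (sources C g)"
    and "\<And>v i u j. \<lbrakk>VertIn v i \<in> targets C g; wiring g (VertIn v i) = VertOut u j\<rbrakk> \<Longrightarrow> rank u < rank v"
  shows "g \<in> graphs C n m"
proof -
  have "acyclic (vertex_edges C g)"
    using assms(5) by (intro acyclic_if_rank[of _ rank]) (auto simp: vertex_edges_def)
  then show ?thesis
    using assms(1-4) by (simp add: graphs_def)
qed

lemma graphsD: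
  assumes "g \<in> graphs C n m"
  shows "inputs g = n" "outputs g = m" "deco g \<in> {..<verts g} \<rightarrow>\<^sub>E topspace (gen_top C)"
    and "bij_betw (wiring g) (targets C g) (sources C g)"
  using assms by (auto simp: graphs_def)

lemma wiring_mem_sources:
  "\<lbrakk>g \<in> graphs C n m; t \<in> targets C g\<rbrakk> \<Longrightarrow> wiring g t \<in> sources C g"
  using graphsD(4) bij_betwE by blast

lemma finite_vertex_edges:
  assumes "g \<in> graphs C n m"
  shows "finite (vertex_edges C g)"
proof (rule finite_subset)
  show "vertex_edges C g \<subseteq> {..<verts g} \<times> {..<verts g}"
  proof (clarify, unfold vertex_edges_def, clarify)
    fix u v i j assume t: "VertIn v i \<in> targets C g" "wiring g (VertIn v i) = VertOut u j"
    then show "u \<in> {..<verts g} \<and> v \<in> {..<verts g}"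
      using wiring_mem_sources[OF assms t(1)] by simp
  qed
qed simp

lemma graphs_rank:
  assumes "g \<in> graphs C n m"
  obtains rank :: "nat \<Rightarrow> nat" where
    "\<And>v i u j. \<lbrakk>VertIn v i \<in> targets C g; wiring g (VertIn v i) = VertOut u j\<rbrakk> \<Longrightarrow> rank u < rank v"
proof -
  have "acyclic (vertex_edges C g)"
    using assms by (simp add: graphs_def)
  then obtain rank :: "nat \<Rightarrow> nat" where "\<And>u v. (u, v) \<in> vertex_edges C g \<Longrightarrow> rank u < rank v"
    using rank_if_finite_acyclic finite_vertex_edges[OF assms] by metis
  then show thesis
    by (intro that[of rank]) (auto simp: vertex_edges_def)
qed

text \<open>Induction along the edges, from the external inputs through the vertices to the external outputs.\<close>
lemma source_induct [consumes 2, case_names ext vert]: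
  assumes g: "g \<in> graphs C n m" and s: "s \<in> sources C g"
    and ext: "\<And>i. i < n \<Longrightarrow> P (ExtIn i)"
    and vert: "\<And>v j. \<lbrakk>v < verts g; j < cout C (fst (deco g v));
      \<And>i. i < cin C (fst (deco g v)) \<Longrightarrow> P (wiring g (VertIn v i))\<rbrakk> \<Longrightarrow> P (VertOut v j)"
  shows "P s"
proof -
  obtain rank :: "nat \<Rightarrow> nat" where rank:
    "\<And>v i u j. \<lbrakk>VertIn v i \<in> targets C g; wiring g (VertIn v i) = VertOut u j\<rbrakk> \<Longrightarrow> rank u < rank v"
    using graphs_rank[OF g] by blast
  have *: "\<forall>j < cout C (fst (deco g v)). P (VertOut v j)" if "v < verts g" for v
    using that
  proof (induction "rank v" arbitrary: v rule: less_induct)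
    case less
    have "P (wiring g (VertIn v i))" if i: "i < cin C (fst (deco g v))" for i
    proof (cases "wiring g (VertIn v i)")
      case (ExtIn k)
      then show ?thesis
        using wiring_mem_sources[OF g, of "VertIn v i"] i less.prems ext graphsD(1)[OF g] by simp
    next
      case (VertOut u j)
      then have "VertOut u j \<in> sources C g" "rank u < rank v"
        using wiring_mem_sources[OF g, of "VertIn v i"] rank[of v i u j] i less.prems by simp_all
      then show ?thesis
        using less.hyps[of u] VertOut by simp
    qed
    then show ?case
      using vert less.prems by blast
  qed
  show ?thesis
    using s * ext graphsD(1)[OF g] by (cases s) auto
qed

text \<open>The wirings of composites and of relabelled graphs are, on suitable parts of their targets, conjugates of
  given wirings by injective shifts of indices. This is how they inherit bijectivity.\<close>
lemma bij_betw_transport: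
  assumes "bij_betw f A B" "inj_on a A" "inj_on b B" "\<And>t. t \<in> A \<Longrightarrow> f' (a t) = b (f t)"
  shows "bij_betw f' (a ` A) (b ` B)"
proof -
  have "inj_on f' (a ` A)"
  proof (rule inj_onI, clarify)
    fix s t assume st: "s \<in> A" "t \<in> A" "f' (a s) = f' (a t)"
    then have "b (f s) = b (f t)"
      using assms(4) by simp
    moreover have "f s \<in> B" "f t \<in> B"
      using st assms(1) bij_betwE by blast+
    ultimately have "f s = f t"
      using assms(3) by (meson inj_onD)
    then show "a s = a t"
      using st assms(1) by (metis bij_betw_imp_inj_on inj_onD)
  qed
  moreover have "f' ` a ` A = b ` B"
    using assms(1,4) by (auto simp: bij_betw_def image_image intro!: image_cong)
  ultimately show ?thesis
    by (simp add: bij_betw_def)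
qed

lemma inj_map_source: "inj f \<Longrightarrow> inj \<pi> \<Longrightarrow> inj (map_source f \<pi>)"
proof (rule injI)
  fix s t assume "inj f" "inj \<pi>" "map_source f \<pi> s = map_source f \<pi> t"
  then show "s = t" by (cases s; cases t) (auto dest: injD)
qed

lemma inj_map_target: "inj f \<Longrightarrow> inj \<pi> \<Longrightarrow> inj (map_target f \<pi>)"
proof (rule injI)
  fix s t assume "inj f" "inj \<pi>" "map_target f \<pi> s = map_target f \<pi> t"
  then show "s = t" by (cases s; cases t) (auto dest: injD)
qed

lemma map_source_id [simp]: "map_source id id = id"
  and map_target_id [simp]: "map_target id id = id"
proof -
  show "map_source id id = id"
    by (rule ext, rename_tac s, case_tac s) auto
  show "map_target id id = id"
    by (rule ext, rename_tac s, case_tac s) auto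
qed

lemma map_source_comp: "map_source f \<pi> (map_source f' \<pi>' s) = map_source (f \<circ> f') (\<pi> \<circ> \<pi>') s"
  by (cases s) auto

lemma map_target_comp: "map_target f \<pi> (map_target f' \<pi>' t) = map_target (f \<circ> f') (\<pi> \<circ> \<pi>') t"
  by (cases t) auto


section \<open>Operations on graphs\<close>

lemma g_ident_graphs: "g_ident n \<in> graphs C n n"
proof (rule graphsI[where rank = id])
  show "bij_betw (wiring (g_ident n :: 'a graph)) (targets C (g_ident n)) (sources C (g_ident n))"
    by (intro bij_betwI[where g = "\<lambda>s. case s of ExtIn i \<Rightarrow> ExtOut i | VertOut v j \<Rightarrow> undefined"])
       (auto simp: g_ident_def targets_def sources_def)
qed (auto simp: g_ident_def)

lemma g_corolla_graphs:
  assumes "b \<in> topspace (gen_top C)"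
  shows "g_corolla C b \<in> graphs C (cin C (fst b)) (cout C (fst b))"
proof (rule graphsI[where rank = id])
  show "bij_betw (wiring (g_corolla C b)) (targets C (g_corolla C b)) (sources C (g_corolla C b))"
    by (intro bij_betwI[where g = "\<lambda>s. case s of ExtIn i \<Rightarrow> VertIn 0 i | VertOut v j \<Rightarrow> ExtOut j"])
       (auto simp: g_corolla_def targets_def sources_def tuple_def)
qed (use assms in \<open>auto simp: g_corolla_def tuple_def\<close>)

lemma g_hcomp_simps [simp]:
  "inputs (g_hcomp g h) = inputs g + inputs h"
  "outputs (g_hcomp g h) = outputs g + outputs h"
  "verts (g_hcomp g h) = verts g + verts h"
  "deco (g_hcomp g h) = tuple_append (verts g) (verts h) (deco g) (deco h)"
  by (simp_all add: g_hcomp_def Let_def)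

lemma g_vcomp_simps [simp]:
  "inputs (g_vcomp h g) = inputs g"
  "outputs (g_vcomp h g) = outputs h"
  "verts (g_vcomp h g) = verts g + verts h"
  "deco (g_vcomp h g) = tuple_append (verts g) (verts h) (deco g) (deco h)"
  by (simp_all add: g_vcomp_def Let_def)

lemma tuple_append_eq:
  "i < n \<Longrightarrow> tuple_append n n' x y i = x i"
  "i < n' \<Longrightarrow> tuple_append n n' x y (n + i) = y i"
  by (auto simp: tuple_append_def)

lemma tuple_append_PiE:
  assumes "x \<in> {..<n} \<rightarrow>\<^sub>E A" "y \<in> {..<n'} \<rightarrow>\<^sub>E A"
  shows "tuple_append n n' x y \<in> {..<n + n'} \<rightarrow>\<^sub>E A"
  using assms by (auto simp: tuple_append_def PiE_iff)

abbreviation hcomp_source :: "'c graph \<Rightarrow> source \<Rightarrow> source" where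
  "hcomp_source g \<equiv> map_source ((+) (inputs g)) ((+) (verts g))"

abbreviation hcomp_target :: "'c graph \<Rightarrow> target \<Rightarrow> target" where
  "hcomp_target g \<equiv> map_target ((+) (outputs g)) ((+) (verts g))"

lemma wiring_g_hcomp:
  "t \<in> targets C g \<Longrightarrow> wiring (g_hcomp g h) t = wiring g t"
  "wiring (g_hcomp g h) (hcomp_target g t) = hcomp_source g (wiring h t)"
proof -
  show "t \<in> targets C g \<Longrightarrow> wiring (g_hcomp g h) t = wiring g t"
    by (cases t) (auto simp: g_hcomp_def Let_def)
  show "wiring (g_hcomp g h) (hcomp_target g t) = hcomp_source g (wiring h t)"
    by (cases t) (auto simp: g_hcomp_def Let_def)
qed

lemma mem_map_target_image [simp]:
  "ExtOut j \<in> map_target f \<pi> ` A \<longleftrightarrow> (\<exists>i. j = f i \<and> ExtOut i \<in> A)"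
  "VertIn v i \<in> map_target f \<pi> ` A \<longleftrightarrow> (\<exists>u. v = \<pi> u \<and> VertIn u i \<in> A)"
proof -
  have "map_target f \<pi> t = ExtOut j \<longleftrightarrow> (\<exists>i. t = ExtOut i \<and> j = f i)"
    "map_target f \<pi> t = VertIn v i \<longleftrightarrow> (\<exists>u. t = VertIn u i \<and> v = \<pi> u)" for t
    by (cases t; auto)+
  then show "ExtOut j \<in> map_target f \<pi> ` A \<longleftrightarrow> (\<exists>i. j = f i \<and> ExtOut i \<in> A)"
    "VertIn v i \<in> map_target f \<pi> ` A \<longleftrightarrow> (\<exists>u. v = \<pi> u \<and> VertIn u i \<in> A)"
    by (auto simp: image_iff eq_commute[of _ "map_target f \<pi> _"])
qed

lemma mem_map_source_image [simp]:
  "ExtIn j \<in> map_source f \<pi> ` A \<longleftrightarrow> (\<exists>i. j = f i \<and> ExtIn i \<in> A)"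
  "VertOut v i \<in> map_source f \<pi> ` A \<longleftrightarrow> (\<exists>u. v = \<pi> u \<and> VertOut u i \<in> A)"
proof -
  have "map_source f \<pi> t = ExtIn j \<longleftrightarrow> (\<exists>i. t = ExtIn i \<and> j = f i)"
    "map_source f \<pi> t = VertOut v i \<longleftrightarrow> (\<exists>u. t = VertOut u i \<and> v = \<pi> u)" for t
    by (cases t; auto)+
  then show "ExtIn j \<in> map_source f \<pi> ` A \<longleftrightarrow> (\<exists>i. j = f i \<and> ExtIn i \<in> A)"
    "VertOut v i \<in> map_source f \<pi> ` A \<longleftrightarrow> (\<exists>u. v = \<pi> u \<and> VertOut u i \<in> A)"
    by (auto simp: image_iff eq_commute[of _ "map_source f \<pi> _"])
qed

lemma target_set_eqI:
  assumes "\<And>j. ExtOut j \<in> A \<longleftrightarrow> ExtOut j \<in> B" "\<And>v i. VertIn v i \<in> A \<longleftrightarrow> VertIn v i \<in> B"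
  shows "A = B"
  using assms by (metis set_eqI target.exhaust)

lemma source_set_eqI:
  assumes "\<And>j. ExtIn j \<in> A \<longleftrightarrow> ExtIn j \<in> B" "\<And>v i. VertOut v i \<in> A \<longleftrightarrow> VertOut v i \<in> B"
  shows "A = B"
  using assms by (metis set_eqI source.exhaust)

lemma targets_g_hcomp: "targets C (g_hcomp g h) = targets C g \<union> hcomp_target g ` targets C h"
proof (rule target_set_eqI)
  show "ExtOut j \<in> targets C (g_hcomp g h) \<longleftrightarrow> ExtOut j \<in> targets C g \<union> hcomp_target g ` targets C h" for j
    by (cases "j < outputs g") (auto simp: not_less le_iff_add)
  show "VertIn v i \<in> targets C (g_hcomp g h) \<longleftrightarrow> VertIn v i \<in> targets C g \<union> hcomp_target g ` targets C h" for v i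
    by (cases "v < verts g") (auto simp: tuple_append_def not_less le_iff_add)
qed

lemma sources_g_hcomp: "sources C (g_hcomp g h) = sources C g \<union> hcomp_source g ` sources C h"
proof (rule source_set_eqI)
  show "ExtIn j \<in> sources C (g_hcomp g h) \<longleftrightarrow> ExtIn j \<in> sources C g \<union> hcomp_source g ` sources C h" for j
    by (cases "j < inputs g") (auto simp: not_less le_iff_add)
  show "VertOut v i \<in> sources C (g_hcomp g h) \<longleftrightarrow> VertOut v i \<in> sources C g \<union> hcomp_source g ` sources C h" for v i
    by (cases "v < verts g") (auto simp: tuple_append_def not_less le_iff_add)
qed

text \<open>The two graphs occupy disjoint blocks of indices, on which the wiring, and a rank function,
  come from one of them.\<close>
lemma g_hcomp_graphs:
  assumes g: "g \<in> graphs C n m" and h: "h \<in> graphs C n' m'"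
  shows "g_hcomp g h \<in> graphs C (n + n') (m + m')"
proof -
  obtain rg :: "nat \<Rightarrow> nat" where rg:
    "\<And>v i u j. \<lbrakk>VertIn v i \<in> targets C g; wiring g (VertIn v i) = VertOut u j\<rbrakk> \<Longrightarrow> rg u < rg v"
    using graphs_rank[OF g] by blast
  obtain rh :: "nat \<Rightarrow> nat" where rh:
    "\<And>v i u j. \<lbrakk>VertIn v i \<in> targets C h; wiring h (VertIn v i) = VertOut u j\<rbrakk> \<Longrightarrow> rh u < rh v"
    using graphs_rank[OF h] by blast
  show ?thesis
  proof (rule graphsI[where rank = "\<lambda>v. if v < verts g then rg v else rh (v - verts g)"])
    show "deco (g_hcomp g h) \<in> {..<verts (g_hcomp g h)} \<rightarrow>\<^sub>E topspace (gen_top C)"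
      using graphsD(3)[OF g] graphsD(3)[OF h] by (simp add: tuple_append_PiE)
    have "bij_betw (wiring (g_hcomp g h)) (targets C g) (sources C g) \<longleftrightarrow> bij_betw (wiring g) (targets C g) (sources C g)"
      by (rule bij_betw_cong) (rule wiring_g_hcomp(1))
    then have "bij_betw (wiring (g_hcomp g h)) (targets C g) (sources C g)"
      using graphsD(4)[OF g] by simp
    moreover have "bij_betw (wiring (g_hcomp g h)) (hcomp_target g ` targets C h) (hcomp_source g ` sources C h)"
      by (rule bij_betw_transport[OF graphsD(4)[OF h]])
         (rule inj_on_subset[OF inj_map_target] inj_on_subset[OF inj_map_source] wiring_g_hcomp(2); simp)+
    moreover have "sources C g \<inter> hcomp_source g ` sources C h = {}"
    proof -
      have False if "s \<in> sources C g" "hcomp_source g t = s" for s t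
        using that by (cases t) auto
      then show ?thesis by blast
    qed
    ultimately show "bij_betw (wiring (g_hcomp g h)) (targets C (g_hcomp g h)) (sources C (g_hcomp g h))"
      by (simp add: targets_g_hcomp sources_g_hcomp bij_betw_combine)
  next
    fix v i u j
    assume t: "VertIn v i \<in> targets C (g_hcomp g h)" and w: "wiring (g_hcomp g h) (VertIn v i) = VertOut u j"
    show "(if u < verts g then rg u else rh (u - verts g)) < (if v < verts g then rg v else rh (v - verts g))"
    proof (cases "v < verts g")
      case True
      then have t': "VertIn v i \<in> targets C g"
        using t by (simp add: tuple_append_eq)
      then have "wiring g (VertIn v i) = VertOut u j"
        using w wiring_g_hcomp(1) by metis
      then show ?thesis
        using rg[OF t'] True wiring_mem_sources[OF g t'] by auto
    next
      case False
      define v' where "v' = v - verts g"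
      have v: "VertIn v i = hcomp_target g (VertIn v' i)"
        using False by (simp add: v'_def)
      have t': "VertIn v' i \<in> targets C h"
        using t False by (auto simp: v'_def tuple_append_def)
      have w': "hcomp_source g (wiring h (VertIn v' i)) = VertOut u j"
        using w v wiring_g_hcomp(2) by metis
      then obtain u' where "wiring h (VertIn v' i) = VertOut u' j" "u = verts g + u'"
        by (cases "wiring h (VertIn v' i)") auto
      then show ?thesis
        using rh[OF t'] False by (simp add: v'_def)
    qed
  qed (use graphsD[OF g] graphsD[OF h] in auto)
qed

abbreviation vcomp_target :: "'c graph \<Rightarrow> target \<Rightarrow> target" where
  "vcomp_target g \<equiv> map_target id ((+) (verts g))"

text \<open>In a vertical composite, an edge of the upper graph \<open>h\<close> that starts at its \<open>i\<close>-th external input is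
  prolonged backwards by the edge of the lower graph \<open>g\<close> that ends at its \<open>i\<close>-th external output.\<close>
definition vcomp_glue :: "'c graph \<Rightarrow> source \<Rightarrow> source" where
  "vcomp_glue g s = (case s of ExtIn i \<Rightarrow> wiring g (ExtOut i) | VertOut v j \<Rightarrow> VertOut (verts g + v) j)"

lemma vcomp_glue_simps [simp]:
  "vcomp_glue g (ExtIn i) = wiring g (ExtOut i)"
  "vcomp_glue g (VertOut v j) = VertOut (verts g + v) j"
  by (simp_all add: vcomp_glue_def)

lemma wiring_g_vcomp:
  "v < verts g \<Longrightarrow> wiring (g_vcomp h g) (VertIn v i) = wiring g (VertIn v i)"
  "wiring (g_vcomp h g) (vcomp_target g t) = vcomp_glue g (wiring h t)"
proof -
  show "v < verts g \<Longrightarrow> wiring (g_vcomp h g) (VertIn v i) = wiring g (VertIn v i)"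
    by (auto simp: g_vcomp_def Let_def)
  show "wiring (g_vcomp h g) (vcomp_target g t) = vcomp_glue g (wiring h t)"
    by (cases t) (auto simp: g_vcomp_def Let_def vcomp_glue_def)
qed

lemma targets_g_vcomp:
  "targets C (g_vcomp h g) = {VertIn v i |v i. VertIn v i \<in> targets C g} \<union> vcomp_target g ` targets C h"
  (is "_ = ?R")
proof (rule target_set_eqI)
  show "ExtOut j \<in> targets C (g_vcomp h g) \<longleftrightarrow> ExtOut j \<in> ?R" for j
    by simp
  show "VertIn v i \<in> targets C (g_vcomp h g) \<longleftrightarrow> VertIn v i \<in> ?R" for v i
    by (cases "v < verts g") (auto simp: tuple_append_def not_less le_iff_add)
qed

text \<open>The wiring of \<open>g\<close> restricted to the inputs of vertices misses exactly the sources of the edges that leave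
  \<open>g\<close>, and gluing supplies these, together with the sources at vertices of \<open>h\<close>. All edges between
  the two blocks of vertices lead from \<open>g\<close> to \<open>h\<close>, so it suffices to rank the vertices of \<open>h\<close> above all those of \<open>g\<close>.\<close>
lemma g_vcomp_graphs:
  assumes g: "g \<in> graphs C n m" and h: "h \<in> graphs C m l"
  shows "g_vcomp h g \<in> graphs C n l"
proof -
  obtain rg :: "nat \<Rightarrow> nat" where rg:
    "\<And>v i u j. \<lbrakk>VertIn v i \<in> targets C g; wiring g (VertIn v i) = VertOut u j\<rbrakk> \<Longrightarrow> rg u < rg v"
    using graphs_rank[OF g] by blast
  obtain rh :: "nat \<Rightarrow> nat" where rh:
    "\<And>v i u j. \<lbrakk>VertIn v i \<in> targets C h; wiring h (VertIn v i) = VertOut u j\<rbrakk> \<Longrightarrow> rh u < rh v"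
    using graphs_rank[OF h] by blast
  \<comment> \<open>an offset that exceeds every rank in the lower graph\<close>
  define M where "M = Suc (\<Sum>v<verts g. rg v)"
  have M: "rg v < M" if "v < verts g" for v
    using that member_le_sum[of v "{..<verts g}" rg] by (simp add: M_def less_Suc_eq_le)
  let ?A = "{VertIn v i |v i. VertIn v i \<in> targets C g}"
  have ext: "wiring g (ExtOut i) \<in> sources C g" if "i < m" for i
    using that wiring_mem_sources[OF g, of "ExtOut i"] graphsD(2)[OF g] by simp
  have injg: "inj_on (wiring g) (targets C g)"
    using graphsD(4)[OF g] bij_betw_def by blast
  show ?thesis
  proof (rule graphsI[where rank = "\<lambda>v. if v < verts g then rg v else M + rh (v - verts g)"])
    show "deco (g_vcomp h g) \<in> {..<verts (g_vcomp h g)} \<rightarrow>\<^sub>E topspace (gen_top C)"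
      using graphsD(3)[OF g] graphsD(3)[OF h] by (simp add: tuple_append_PiE)
    have "bij_betw (wiring g) ?A (wiring g ` ?A)"
      by (intro inj_on_imp_bij_betw inj_on_subset[OF injg]) auto
    moreover have "bij_betw (wiring (g_vcomp h g)) ?A (wiring g ` ?A) \<longleftrightarrow> bij_betw (wiring g) ?A (wiring g ` ?A)"
      by (rule bij_betw_cong) (auto simp: wiring_g_vcomp(1))
    ultimately have 1: "bij_betw (wiring (g_vcomp h g)) ?A (wiring g ` ?A)"
      by simp
    have inj: "inj_on (vcomp_glue g) (sources C h)"
    proof (rule inj_onI)
      fix s t assume st: "s \<in> sources C h" "t \<in> sources C h" "vcomp_glue g s = vcomp_glue g t"
      have ee: "i = k" if "wiring g (ExtOut i) = wiring g (ExtOut k)" "i < m" "k < m" for i k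
        using inj_onD[OF injg that(1)] that graphsD(2)[OF g] by simp
      have ev: "wiring g (ExtOut i) \<noteq> VertOut (verts g + v) k" if "i < m" for i v k
        using ext[OF that] by (cases "wiring g (ExtOut i)") auto
      show "s = t"
        using st ee ev ev[symmetric] graphsD(1)[OF h] by (cases s; cases t) auto
    qed
    have 2: "bij_betw (wiring (g_vcomp h g)) (vcomp_target g ` targets C h) (vcomp_glue g ` sources C h)"
      by (rule bij_betw_transport[OF graphsD(4)[OF h]])
         (rule inj_on_subset[OF inj_map_target] inj wiring_g_vcomp(2); simp)+
    have disj: "wiring g ` ?A \<inter> vcomp_glue g ` sources C h = {}"
    proof -
      have False if "VertIn v i \<in> targets C g" "wiring g (VertIn v i) = vcomp_glue g s" "s \<in> sources C h" for v i s
      proof (cases s)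
        case (ExtIn k)
        then show False
          using that inj_onD[OF injg, of "VertIn v i" "ExtOut k"] graphsD(2)[OF g] graphsD(1)[OF h] by simp
      next
        case (VertOut u k)
        then show False
          using wiring_mem_sources[OF g that(1)] that(2) by simp
      qed
      then show ?thesis by blast
    qed
    have "wiring g ` ?A \<union> vcomp_glue g ` sources C h = sources C (g_vcomp h g)" (is "?L = ?R")
    proof (rule set_eqI)
      fix s
      have mono: "s \<in> ?R" if "s \<in> sources C g" for s
        using that by (cases s) (auto simp: tuple_append_eq)
      have "?L \<subseteq> ?R"
      proof -
        have "vcomp_glue g s \<in> ?R" if "s \<in> sources C h" for s
          using that mono[OF ext] graphsD(1)[OF h] by (cases s) (auto simp: tuple_append_eq)
        moreover have "wiring g t \<in> ?R" if "t \<in> ?A" for t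
          using that mono wiring_mem_sources[OF g] by blast
        ultimately show ?thesis by blast
      qed
      moreover have "s \<in> ?L" if "s \<in> ?R"
      proof (cases "s \<in> sources C g")
        case True
        then obtain t where t: "t \<in> targets C g" "s = wiring g t"
          using graphsD(4)[OF g] by (auto simp: bij_betw_def)
        show ?thesis
        proof (cases t)
          case (ExtOut j)
          then show ?thesis
            using t graphsD(1)[OF h] graphsD(2)[OF g] by (intro UnI2 image_eqI[of _ _ "ExtIn j"]) auto
        next
          case (VertIn v i)
          then show ?thesis using t by auto
        qed
      next
        case False
        show ?thesis
        proof (cases s)
          case (ExtIn i)
          then show ?thesis using False that by simp
        next
          case (VertOut v j)
          then show ?thesis
            using False that by (intro UnI2 image_eqI[of _ _ "VertOut (v - verts g) j"])
              (auto simp: tuple_append_def split: if_splits)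
        qed
      qed
      ultimately show "s \<in> ?L \<longleftrightarrow> s \<in> ?R" by blast
    qed
    then show "bij_betw (wiring (g_vcomp h g)) (targets C (g_vcomp h g)) (sources C (g_vcomp h g))"
      using bij_betw_combine[OF 1 2 disj] by (simp add: targets_g_vcomp)
  next
    fix v i u j
    assume t: "VertIn v i \<in> targets C (g_vcomp h g)" and w: "wiring (g_vcomp h g) (VertIn v i) = VertOut u j"
    show "(if u < verts g then rg u else M + rh (u - verts g)) < (if v < verts g then rg v else M + rh (v - verts g))"
    proof (cases "v < verts g")
      case True
      then have t': "VertIn v i \<in> targets C g"
        using t by (simp add: tuple_append_eq)
      then have "wiring g (VertIn v i) = VertOut u j"
        using w wiring_g_vcomp(1) True by metis
      then show ?thesis
        using rg[OF t'] True wiring_mem_sources[OF g t'] by auto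
    next
      case False
      define v' where "v' = v - verts g"
      have v: "VertIn v i = vcomp_target g (VertIn v' i)"
        using False by (simp add: v'_def)
      have t': "VertIn v' i \<in> targets C h"
        using t False by (auto simp: v'_def tuple_append_def)
      have w': "vcomp_glue g (wiring h (VertIn v' i)) = VertOut u j"
        using w v wiring_g_vcomp(2) by metis
      show ?thesis
      proof (cases "wiring h (VertIn v' i)")
        case (ExtIn k)
        then have "VertOut u j \<in> sources C g"
          using ext[of k] w' wiring_mem_sources[OF h t'] graphsD(1)[OF h] by simp
        then show ?thesis
          using M[of u] False by simp
      next
        case (VertOut u' j')
        then show ?thesis
          using w' rh[OF t'] False by (auto simp: v'_def)
      qed
    qed
  qed (use graphsD[OF g] graphsD[OF h] in auto)
qed


section \<open>Relabelling\<close>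

text \<open>Permuting external inputs, external outputs and vertices at once covers both symmetric group actions and
  the renumbering of vertices.\<close>
definition relabel :: "(nat \<Rightarrow> nat) \<Rightarrow> (nat \<Rightarrow> nat) \<Rightarrow> (nat \<Rightarrow> nat) \<Rightarrow> 'c graph \<Rightarrow> 'c graph" where
  "relabel fi fo \<pi> g = (\<lparr>gin = inputs g, gout = outputs g, nvert = verts g,
     wire = (\<lambda>t. map_source fi \<pi> (wiring g (map_target (inv fo) (inv \<pi>) t)))\<rparr>,
     \<lambda>v\<in>{..<verts g}. deco g (inv \<pi> v))"

lemma relabel_simps [simp]:
  "inputs (relabel fi fo \<pi> g) = inputs g"
  "outputs (relabel fi fo \<pi> g) = outputs g"
  "verts (relabel fi fo \<pi> g) = verts g"
  "deco (relabel fi fo \<pi> g) = (\<lambda>v\<in>{..<verts g}. deco g (inv \<pi> v))"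
  "wiring (relabel fi fo \<pi> g) t = map_source fi \<pi> (wiring g (map_target (inv fo) (inv \<pi>) t))"
  by (simp_all add: relabel_def)

lemma graph_eqI:
  fixes g h :: "'c graph"
  assumes "inputs g = inputs h" "outputs g = outputs h" "verts g = verts h"
    and "wiring g = wiring h" "deco g = deco h"
  shows "g = h"
  using assms by (simp add: prod_eq_iff shape.equality)

lemma g_lact_relabel: "g \<in> graphs C n m \<Longrightarrow> g_lact \<sigma> g = relabel id \<sigma> id g"
proof (rule graph_eqI)
  assume g: "g \<in> graphs C n m"
  show "wiring (g_lact \<sigma> g) = wiring (relabel id \<sigma> id g)"
    by (rule ext) (simp add: g_lact_def)
  show "deco (g_lact \<sigma> g) = deco (relabel id \<sigma> id g)"
    using graphsD(3)[OF g] by (auto simp: g_lact_def PiE_iff extensional_def fun_eq_iff)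
qed (simp_all add: g_lact_def)

lemma g_ract_relabel: "g \<in> graphs C n m \<Longrightarrow> g_ract g \<tau> = relabel (inv \<tau>) id id g"
proof (rule graph_eqI)
  assume g: "g \<in> graphs C n m"
  show "wiring (g_ract g \<tau>) = wiring (relabel (inv \<tau>) id id g)"
    by (rule ext) (simp add: g_ract_def)
  show "deco (g_ract g \<tau>) = deco (relabel (inv \<tau>) id id g)"
    using graphsD(3)[OF g] by (auto simp: g_ract_def PiE_iff extensional_def fun_eq_iff)
qed (simp_all add: g_ract_def)

lemma permutes_inv_less:
  "p permutes {..<n} \<Longrightarrow> inv p i < n \<longleftrightarrow> i < n"
  by (metis lessThan_iff permutes_in_image permutes_inv)

lemma permutes_less:
  "p permutes {..<n} \<Longrightarrow> p i < n \<longleftrightarrow> i < n"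
  by (metis lessThan_iff permutes_in_image)

lemma relabel_graphs:
  assumes g: "g \<in> graphs C n m"
    and fi: "fi permutes {..<n}" and fo: "fo permutes {..<m}" and \<pi>: "\<pi> permutes {..<verts g}"
  shows "relabel fi fo \<pi> g \<in> graphs C n m"
proof -
  let ?h = "relabel fi fo \<pi> g"
  note n = graphsD(1)[OF g] and m = graphsD(2)[OF g]
  obtain rg :: "nat \<Rightarrow> nat" where rg:
    "\<And>v i u j. \<lbrakk>VertIn v i \<in> targets C g; wiring g (VertIn v i) = VertOut u j\<rbrakk> \<Longrightarrow> rg u < rg v"
    using graphs_rank[OF g] by blast
  have T: "targets C ?h = map_target fo \<pi> ` targets C g"
  proof (rule target_set_eqI)
    show "ExtOut j \<in> targets C ?h \<longleftrightarrow> ExtOut j \<in> map_target fo \<pi> ` targets C g" for j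
      using permutes_less[OF fo] permutes_inverses(1)[OF fo] by (simp add: m) metis
    show "VertIn v i \<in> targets C ?h \<longleftrightarrow> VertIn v i \<in> map_target fo \<pi> ` targets C g" for v i
      using permutes_less[OF \<pi>] permutes_inverses[OF \<pi>] by simp metis
  qed
  have S: "sources C ?h = map_source fi \<pi> ` sources C g"
  proof (rule source_set_eqI)
    show "ExtIn j \<in> sources C ?h \<longleftrightarrow> ExtIn j \<in> map_source fi \<pi> ` sources C g" for j
      using permutes_less[OF fi] permutes_inverses(1)[OF fi] by (simp add: n) metis
    show "VertOut v i \<in> sources C ?h \<longleftrightarrow> VertOut v i \<in> map_source fi \<pi> ` sources C g" for v i
      using permutes_less[OF \<pi>] permutes_inverses[OF \<pi>] by simp metis
  qed
  show ?thesis
  proof (rule graphsI[where rank = "\<lambda>v. rg (inv \<pi> v)"])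
    show "deco ?h \<in> {..<verts ?h} \<rightarrow>\<^sub>E topspace (gen_top C)"
      using graphsD(3)[OF g] permutes_inv_less[OF \<pi>] by (simp add: PiE_iff)
    show "bij_betw (wiring ?h) (targets C ?h) (sources C ?h)"
      unfolding T S
    proof (rule bij_betw_transport[OF graphsD(4)[OF g]])
      show "inj_on (map_target fo \<pi>) (targets C g)"
        using inj_map_target[OF permutes_inj[OF fo] permutes_inj[OF \<pi>]] inj_on_subset by blast
      show "inj_on (map_source fi \<pi>) (sources C g)"
        using inj_map_source[OF permutes_inj[OF fi] permutes_inj[OF \<pi>]] inj_on_subset by blast
      show "wiring ?h (map_target fo \<pi> t) = map_source fi \<pi> (wiring g t)" for t
        using permutes_inj[OF fo] permutes_inj[OF \<pi>] by (simp add: map_target_comp)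
    qed
  next
    fix v i u j
    assume t: "VertIn v i \<in> targets C ?h" and w: "wiring ?h (VertIn v i) = VertOut u j"
    have t': "VertIn (inv \<pi> v) i \<in> targets C g"
    proof -
      have "v < verts g"
        using t by simp
      then show ?thesis
        using t permutes_inv_less[OF \<pi>, of v] by simp
    qed
    obtain u' where "wiring g (VertIn (inv \<pi> v) i) = VertOut u' j" "u = \<pi> u'"
      using w by (cases "wiring g (VertIn (inv \<pi> v) i)") auto
    then show "rg (inv \<pi> u) < rg (inv \<pi> v)"
      using rg[OF t'] permutes_inverses(2)[OF \<pi>] by simp
  qed (simp_all add: n m)
qed

lemma g_lact_graphs: "\<lbrakk>g \<in> graphs C n m; \<sigma> permutes {..<m}\<rbrakk> \<Longrightarrow> g_lact \<sigma> g \<in> graphs C n m"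
  using g_lact_relabel relabel_graphs permutes_id by metis

lemma g_ract_graphs: "\<lbrakk>g \<in> graphs C n m; \<tau> permutes {..<n}\<rbrakk> \<Longrightarrow> g_ract g \<tau> \<in> graphs C n m"
  using g_ract_relabel relabel_graphs permutes_id permutes_inv by metis

lemma graph_iso_refl: "graph_iso C g g"
  unfolding graph_iso_def by (intro conjI exI[of _ id]) auto


section \<open>Evaluating graphs\<close>

text \<open>If every cell \<open>b\<close> acts as a map \<open>F b\<close> of tuples, a graph becomes a system of equations for values on its
  edges, each edge being represented by its source. The type of the values is arbitrary: besides points of a
  space, points together with a dimension are used below.\<close>
definition valuation ::
  "'c cells \<Rightarrow> ('c dec \<Rightarrow> (nat \<Rightarrow> 'x) \<Rightarrow> nat \<Rightarrow> 'x) \<Rightarrow> 'c graph \<Rightarrow> (nat \<Rightarrow> 'x) \<Rightarrow> (source \<Rightarrow> 'x) \<Rightarrow> bool" where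
  "valuation C F g x w \<longleftrightarrow> (\<forall>i<inputs g. w (ExtIn i) = x i) \<and>
     (\<forall>v<verts g. \<forall>j<cout C (fst (deco g v)).
        w (VertOut v j) = F (deco g v) (\<lambda>i\<in>{..<cin C (fst (deco g v))}. w (wiring g (VertIn v i))) j)"

lemma valuationI:
  assumes "\<And>i. i < inputs g \<Longrightarrow> w (ExtIn i) = x i"
    and "\<And>v j. \<lbrakk>v < verts g; j < cout C (fst (deco g v))\<rbrakk> \<Longrightarrow>
      w (VertOut v j) = F (deco g v) (\<lambda>i\<in>{..<cin C (fst (deco g v))}. w (wiring g (VertIn v i))) j"
  shows "valuation C F g x w"
  using assms by (simp add: valuation_def)

lemma valuationD:
  assumes "valuation C F g x w"
  shows "i < inputs g \<Longrightarrow> w (ExtIn i) = x i"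
    and "\<lbrakk>v < verts g; j < cout C (fst (deco g v))\<rbrakk> \<Longrightarrow>
      w (VertOut v j) = F (deco g v) (\<lambda>i\<in>{..<cin C (fst (deco g v))}. w (wiring g (VertIn v i))) j"
  using assms by (simp_all add: valuation_def)

text \<open>The equations can be solved by recursion along the edges since there are no directed loops.\<close>
lemma valuation_exists:
  assumes g: "g \<in> graphs C n m"
  shows "\<exists>w. valuation C F g x w"
proof -
  let ?r = "vertex_edges C g"
  have wf: "wf ?r"
    using g by (intro finite_acyclic_wf finite_vertex_edges[OF g]) (simp add: graphs_def)
  \<comment> \<open>the outputs of a vertex in terms of the outputs \<open>f\<close> of its predecessors\<close>
  define H where "H f v = F (deco g v) (\<lambda>i\<in>{..<cin C (fst (deco g v))}.
    case wiring g (VertIn v i) of ExtIn k \<Rightarrow> x k | VertOut u j \<Rightarrow> f u j)" for f v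
  define val where "val = wfrec ?r H"
  have val: "val v = H val v" if "v < verts g" for v
  proof -
    have "val v = H (cut val ?r v) v"
      unfolding val_def by (rule wfrec[OF wf])
    also have "\<dots> = H val v"
    proof -
      have "(u, v) \<in> ?r" if "i < cin C (fst (deco g v))" "wiring g (VertIn v i) = VertOut u j" for i u j
        using that \<open>v < verts g\<close> by (auto simp: vertex_edges_def)
      then have "(\<lambda>i\<in>{..<cin C (fst (deco g v))}.
          case wiring g (VertIn v i) of ExtIn k \<Rightarrow> x k | VertOut u j \<Rightarrow> cut val ?r v u j) =
        (\<lambda>i\<in>{..<cin C (fst (deco g v))}.
          case wiring g (VertIn v i) of ExtIn k \<Rightarrow> x k | VertOut u j \<Rightarrow> val u j)"
        by (intro restrict_ext) (simp add: cut_apply split: source.split)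
      then show ?thesis
        by (simp add: H_def)
    qed
    finally show ?thesis .
  qed
  have "valuation C F g x (\<lambda>s. case s of ExtIn i \<Rightarrow> x i | VertOut v j \<Rightarrow> val v j)"
    by (rule valuationI) (simp_all add: val H_def)
  then show ?thesis
    by blast
qed

lemma valuation_unique:
  assumes g: "g \<in> graphs C n m" and w: "valuation C F g x w" and w': "valuation C F g x w'"
    and s: "s \<in> sources C g"
  shows "w s = w' s"
  using g s
proof (induction rule: source_induct)
  case (ext i)
  then show ?case
    using valuationD(1)[OF w] valuationD(1)[OF w'] graphsD(1)[OF g] by simp
next
  case (vert v j)
  then have "(\<lambda>i\<in>{..<cin C (fst (deco g v))}. w (wiring g (VertIn v i))) =
    (\<lambda>i\<in>{..<cin C (fst (deco g v))}. w' (wiring g (VertIn v i)))"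
    by (intro restrict_ext) simp
  then show ?case
    using valuationD(2)[OF w] valuationD(2)[OF w'] vert by simp
qed

definition valuation_of ::
  "'c cells \<Rightarrow> ('c dec \<Rightarrow> (nat \<Rightarrow> 'x) \<Rightarrow> nat \<Rightarrow> 'x) \<Rightarrow> 'c graph \<Rightarrow> (nat \<Rightarrow> 'x) \<Rightarrow> source \<Rightarrow> 'x" where
  "valuation_of C F g x = (SOME w. valuation C F g x w)"

definition eval_graph ::
  "'c cells \<Rightarrow> ('c dec \<Rightarrow> (nat \<Rightarrow> 'x) \<Rightarrow> nat \<Rightarrow> 'x) \<Rightarrow> 'c graph \<Rightarrow> (nat \<Rightarrow> 'x) \<Rightarrow> nat \<Rightarrow> 'x" where
  "eval_graph C F g x = (\<lambda>j\<in>{..<outputs g}. valuation_of C F g x (wiring g (ExtOut j)))"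

lemma valuation_valuation_of: "g \<in> graphs C n m \<Longrightarrow> valuation C F g x (valuation_of C F g x)"
  unfolding valuation_of_def using valuation_exists by (metis someI_ex)

text \<open>By uniqueness, any valuation may be used to compute the value of a graph. The compatibility of evaluation
  with an operation on graphs is therefore proved by exhibiting one valuation of the resulting graph.\<close>
lemma eval_graph_eq:
  assumes g: "g \<in> graphs C n m" and w: "valuation C F g x w"
  shows "eval_graph C F g x = (\<lambda>j\<in>{..<m}. w (wiring g (ExtOut j)))"
  unfolding eval_graph_def graphsD(2)[OF g]
proof (rule restrict_ext)
  fix j assume "j \<in> {..<m}"
  then have "wiring g (ExtOut j) \<in> sources C g"
    using wiring_mem_sources[OF g] graphsD(2)[OF g] by simp
  then show "valuation_of C F g x (wiring g (ExtOut j)) = w (wiring g (ExtOut j))"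
    using valuation_unique[OF g valuation_valuation_of[OF g] w] by simp
qed

lemma valuation_cong:
  assumes "valuation C F g x w" "\<And>i. i < inputs g \<Longrightarrow> x i = y i"
  shows "valuation C F g y w"
  using assms by (simp add: valuation_def)

lemma eval_graph_cong:
  assumes g: "g \<in> graphs C n m" and "\<And>i. i < n \<Longrightarrow> x i = y i"
  shows "eval_graph C F g x = eval_graph C F g y"
  using eval_graph_eq[OF g valuation_valuation_of[OF g, of F x]]
    eval_graph_eq[OF g valuation_cong[OF valuation_valuation_of[OF g, of F x], of y]]
    graphsD(1)[OF g] assms(2) by simp

lemma eval_g_ident:
  assumes "x \<in> extensional {..<n}"
  shows "eval_graph C F (g_ident n) x = x"
proof -
  have "valuation C F (g_ident n) x (\<lambda>s. case s of ExtIn i \<Rightarrow> x i | VertOut v j \<Rightarrow> undefined)"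
    by (rule valuationI) (simp_all add: g_ident_def)
  from eval_graph_eq[OF g_ident_graphs this] show ?thesis
    using assms by (auto simp: g_ident_def extensional_def fun_eq_iff)
qed

lemma eval_g_corolla:
  assumes "b \<in> topspace (gen_top C)" "x \<in> extensional {..<cin C (fst b)}"
    and "F b x \<in> extensional {..<cout C (fst b)}"
  shows "eval_graph C F (g_corolla C b) x = F b x"
proof -
  have x: "(\<lambda>i\<in>{..<cin C (fst b)}. x i) = x"
    using assms(2) by (simp add: extensional_restrict)
  have "valuation C F (g_corolla C b) x (\<lambda>s. case s of ExtIn i \<Rightarrow> x i | VertOut v j \<Rightarrow> F b x j)"
    by (rule valuationI) (simp_all add: g_corolla_def tuple_def x)
  from eval_graph_eq[OF g_corolla_graphs[OF assms(1)] this] show ?thesis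
    using assms(3) by (auto simp: g_corolla_def extensional_def fun_eq_iff)
qed

text \<open>The valuation of the composite is the disjoint union of the given valuations.\<close>
lemma eval_g_hcomp:
  assumes g: "g \<in> graphs C n m" and h: "h \<in> graphs C n' m'"
  shows "eval_graph C F (g_hcomp g h) (tuple_append n n' x y) =
    tuple_append m m' (eval_graph C F g x) (eval_graph C F h y)"
proof -
  note gs = graphsD[OF g] and hs = graphsD[OF h]
  define wg where "wg = valuation_of C F g x"
  define wh where "wh = valuation_of C F h y"
  have wg: "valuation C F g x wg" and wh: "valuation C F h y wh"
    unfolding wg_def wh_def using valuation_valuation_of g h by blast+
  define w where "w s = (case s of
      ExtIn i \<Rightarrow> if i < n then wg (ExtIn i) else wh (ExtIn (i - n))
    | VertOut v j \<Rightarrow> if v < verts g then wg (VertOut v j) else wh (VertOut (v - verts g) j))" for s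
  have w1: "w s = wg s" if "s \<in> sources C g" for s
    using that gs by (cases s) (auto simp: w_def)
  have w2: "w (hcomp_source g s) = wh s" for s
    using gs by (cases s) (auto simp: w_def)
  have val: "valuation C F (g_hcomp g h) (tuple_append n n' x y) w"
  proof (rule valuationI)
    fix i assume "i < inputs (g_hcomp g h)"
    then show "w (ExtIn i) = tuple_append n n' x y i"
      using valuationD(1)[OF wg, of i] valuationD(1)[OF wh, of "i - n"] gs hs
      by (auto simp: w_def tuple_append_def)
  next
    fix v j
    assume v: "v < verts (g_hcomp g h)" and j: "j < cout C (fst (deco (g_hcomp g h) v))"
    show "w (VertOut v j) = F (deco (g_hcomp g h) v)
      (\<lambda>i\<in>{..<cin C (fst (deco (g_hcomp g h) v))}. w (wiring (g_hcomp g h) (VertIn v i))) j"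
    proof (cases "v < verts g")
      case True
      have d: "deco (g_hcomp g h) v = deco g v"
        using True by (simp add: tuple_append_eq)
      have "w (wiring (g_hcomp g h) (VertIn v i)) = wg (wiring g (VertIn v i))"
        if "i < cin C (fst (deco g v))" for i
        using that True wiring_g_hcomp(1)[of "VertIn v i" C g h] w1 wiring_mem_sources[OF g, of "VertIn v i"]
        by simp
      then show ?thesis
        unfolding d using valuationD(2)[OF wg, of v j] True j[unfolded d]
        by (simp add: w_def cong: restrict_cong)
    next
      case False
      define u where "u = v - verts g"
      have vu: "v = verts g + u" "u < verts h"
        using False v by (auto simp: u_def)
      have d: "deco (g_hcomp g h) v = deco h u"
        using vu by (simp add: tuple_append_eq)
      have "w (wiring (g_hcomp g h) (VertIn v i)) = wh (wiring h (VertIn u i))" for i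
        using wiring_g_hcomp(2)[of g h "VertIn u i"] w2 vu by simp
      then show ?thesis
        unfolding d using valuationD(2)[OF wh, of u j] vu j[unfolded d]
        by (simp add: w_def)
    qed
  qed
  show ?thesis
  proof (rule ext)
    fix j
    show "eval_graph C F (g_hcomp g h) (tuple_append n n' x y) j =
      tuple_append m m' (eval_graph C F g x) (eval_graph C F h y) j"
    proof (cases "j < m")
      case True
      then have t: "ExtOut j \<in> targets C g"
        using gs by simp
      show ?thesis
        unfolding eval_graph_eq[OF g_hcomp_graphs[OF g h] val] eval_graph_eq[OF g wg]
        using True w1[OF wiring_mem_sources[OF g t]] wiring_g_hcomp(1)[OF t]
        by (simp add: tuple_append_def)
    next
      case False
      then have "w (wiring (g_hcomp g h) (ExtOut j)) = wh (wiring h (ExtOut (j - m)))"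
        using wiring_g_hcomp(2)[of g h "ExtOut (j - m)"] w2 gs by simp
      then show ?thesis
        unfolding eval_graph_eq[OF g_hcomp_graphs[OF g h] val] eval_graph_eq[OF h wh]
        using False by (auto simp: tuple_append_def)
    qed
  qed
qed

text \<open>The values on the edges of \<open>h\<close> are computed from the values that leave \<open>g\<close>; an edge that arises by gluing
  carries the same value in both graphs.\<close>
lemma eval_g_vcomp:
  assumes g: "g \<in> graphs C n m" and h: "h \<in> graphs C m l"
  shows "eval_graph C F (g_vcomp h g) x = eval_graph C F h (eval_graph C F g x)"
proof -
  note gs = graphsD[OF g] and hs = graphsD[OF h]
  define wg where "wg = valuation_of C F g x"
  have wg: "valuation C F g x wg"
    unfolding wg_def using valuation_valuation_of g by blast
  define y where "y = eval_graph C F g x"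
  have y: "y j = wg (wiring g (ExtOut j))" if "j < m" for j
    using that by (simp add: y_def eval_graph_eq[OF g wg])
  define wh where "wh = valuation_of C F h y"
  have wh: "valuation C F h y wh"
    unfolding wh_def using valuation_valuation_of h by blast
  define w where "w s = (case s of
      ExtIn i \<Rightarrow> wg (ExtIn i)
    | VertOut v j \<Rightarrow> if v < verts g then wg (VertOut v j) else wh (VertOut (v - verts g) j))" for s
  have w1: "w s = wg s" if "s \<in> sources C g" for s
    using that by (cases s) (auto simp: w_def)
  have w2: "w (vcomp_glue g s) = wh s" if "s \<in> sources C h" for s
  proof (cases s)
    case (ExtIn i)
    then show ?thesis
      using that hs gs w1 wiring_mem_sources[OF g, of "ExtOut i"] valuationD(1)[OF wh, of i] y by simp
  next
    case (VertOut v j)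
    then show ?thesis by (simp add: w_def)
  qed
  have val: "valuation C F (g_vcomp h g) x w"
  proof (rule valuationI)
    fix i assume "i < inputs (g_vcomp h g)"
    then show "w (ExtIn i) = x i"
      using valuationD(1)[OF wg, of i] by (simp add: w_def)
  next
    fix v j
    assume v: "v < verts (g_vcomp h g)" and j: "j < cout C (fst (deco (g_vcomp h g) v))"
    show "w (VertOut v j) = F (deco (g_vcomp h g) v)
      (\<lambda>i\<in>{..<cin C (fst (deco (g_vcomp h g) v))}. w (wiring (g_vcomp h g) (VertIn v i))) j"
    proof (cases "v < verts g")
      case True
      have d: "deco (g_vcomp h g) v = deco g v"
        using True by (simp add: tuple_append_eq)
      have "w (wiring (g_vcomp h g) (VertIn v i)) = wg (wiring g (VertIn v i))"
        if "i < cin C (fst (deco g v))" for i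
        using that True wiring_g_vcomp(1)[of v g h i] w1 wiring_mem_sources[OF g, of "VertIn v i"]
        by simp
      then show ?thesis
        unfolding d using valuationD(2)[OF wg, of v j] True j[unfolded d]
        by (simp add: w_def cong: restrict_cong)
    next
      case False
      define u where "u = v - verts g"
      have vu: "v = verts g + u" "u < verts h"
        using False v by (auto simp: u_def)
      have d: "deco (g_vcomp h g) v = deco h u"
        using vu by (simp add: tuple_append_eq)
      have "w (wiring (g_vcomp h g) (VertIn v i)) = wh (wiring h (VertIn u i))"
        if "i < cin C (fst (deco h u))" for i
        using that wiring_g_vcomp(2)[of h g "VertIn u i"] w2 vu wiring_mem_sources[OF h, of "VertIn u i"]
        by simp
      then show ?thesis
        unfolding d using valuationD(2)[OF wh, of u j] vu j[unfolded d]
        by (simp add: w_def cong: restrict_cong)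
    qed
  qed
  have "w (wiring (g_vcomp h g) (ExtOut j)) = wh (wiring h (ExtOut j))" if "j < l" for j
    using that wiring_g_vcomp(2)[of h g "ExtOut j"] w2 wiring_mem_sources[OF h, of "ExtOut j"] hs by simp
  then show ?thesis
    unfolding eval_graph_eq[OF g_vcomp_graphs[OF g h] val] y_def[symmetric] eval_graph_eq[OF h wh]
    by (intro restrict_ext) simp
qed

text \<open>The valuation is transported along the bijection of sources; the outputs get permuted by \<open>fo\<close> while the
  inputs are read off through \<open>fi\<close>.\<close>
lemma eval_relabel:
  assumes g: "g \<in> graphs C n m"
    and fi: "fi permutes {..<n}" and fo: "fo permutes {..<m}" and \<pi>: "\<pi> permutes {..<verts g}"
  shows "eval_graph C F (relabel fi fo \<pi> g) x =
    tuple_perm m fo (eval_graph C F g (tuple_perm n (inv fi) x))"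
proof -
  let ?y = "tuple_perm n (inv fi) x"
  note gs = graphsD[OF g]
  define w where "w = valuation_of C F g ?y"
  have w: "valuation C F g ?y w"
    unfolding w_def using valuation_valuation_of g by blast
  define w' where "w' s = w (map_source (inv fi) (inv \<pi>) s)" for s
  have w': "w' (map_source fi \<pi> s) = w s" for s
    using permutes_inj[OF fi] permutes_inj[OF \<pi>] by (simp add: w'_def map_source_comp)
  have val: "valuation C F (relabel fi fo \<pi> g) x w'"
  proof (rule valuationI)
    fix i assume "i < inputs (relabel fi fo \<pi> g)"
    then have "w (ExtIn (inv fi i)) = x (inv (inv fi) (inv fi i))"
      using valuationD(1)[OF w, of "inv fi i"] gs permutes_inv_less[OF fi] by (simp add: tuple_perm_def)
    then show "w' (ExtIn i) = x i"
      using permutes_inverses[OF fi] by (simp add: w'_def permutes_inv_inv[OF fi])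
  next
    fix v j
    assume "v < verts (relabel fi fo \<pi> g)" "j < cout C (fst (deco (relabel fi fo \<pi> g) v))"
    then show "w' (VertOut v j) = F (deco (relabel fi fo \<pi> g) v)
      (\<lambda>i\<in>{..<cin C (fst (deco (relabel fi fo \<pi> g) v))}. w' (wiring (relabel fi fo \<pi> g) (VertIn v i))) j"
      using valuationD(2)[OF w, of "inv \<pi> v" j] permutes_inv_less[OF \<pi>] by (simp add: w') (simp add: w'_def)
  qed
  show ?thesis
    unfolding eval_graph_eq[OF relabel_graphs[OF assms] val] tuple_perm_def
    using permutes_inv_less[OF fo]
    by (intro restrict_ext) (simp add: w' eval_graph_eq[OF g w, unfolded tuple_perm_def])
qed

lemma tuple_perm_id: "x \<in> extensional {..<n} \<Longrightarrow> tuple_perm n id x = x"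
  by (auto simp: tuple_perm_def extensional_def fun_eq_iff)

lemma eval_graph_extensional: "g \<in> graphs C n m \<Longrightarrow> eval_graph C F g x \<in> extensional {..<m}"
  using graphsD(2) by (fastforce simp: eval_graph_def)

lemma eval_g_lact:
  assumes g: "g \<in> graphs C n m" and "\<sigma> permutes {..<m}"
  shows "eval_graph C F (g_lact \<sigma> g) x = tuple_perm m \<sigma> (eval_graph C F g x)"
proof -
  have "eval_graph C F g (tuple_perm n (inv id) x) = eval_graph C F g x"
    by (rule eval_graph_cong[OF g]) (simp add: tuple_perm_def)
  then show ?thesis
    using eval_relabel[OF g permutes_id assms(2) permutes_id] g_lact_relabel[OF g] by metis
qed

lemma eval_g_ract:
  assumes g: "g \<in> graphs C n m" and "\<tau> permutes {..<n}"
  shows "eval_graph C F (g_ract g \<tau>) x = eval_graph C F g (tuple_perm n \<tau> x)"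
  using eval_relabel[OF g permutes_inv[OF assms(2)] permutes_id permutes_id] g_ract_relabel[OF g]
    tuple_perm_id[OF eval_graph_extensional[OF g]] permutes_inv_inv[OF assms(2)] by metis

lemma eval_graph_iso:
  assumes g: "g \<in> graphs C n m" and h: "h \<in> graphs C n m" and iso: "graph_iso C g h"
  shows "eval_graph C F g x = eval_graph C F h x"
proof -
  obtain \<pi> where \<pi>: "bij_betw \<pi> {..<verts g} {..<verts h}"
    and d: "\<And>v. v < verts g \<Longrightarrow> deco h (\<pi> v) = deco g v"
    and wi: "\<And>t. t \<in> targets C g \<Longrightarrow> wiring h (map_target id \<pi> t) = map_source id \<pi> (wiring g t)"
    using iso by (auto simp: graph_iso_def)
  define w where "w = valuation_of C F h x"
  have w: "valuation C F h x w"
    unfolding w_def using valuation_valuation_of h by blast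
  have val: "valuation C F g x (\<lambda>s. w (map_source id \<pi> s))"
  proof (rule valuationI)
    fix v j
    assume v: "v < verts g" and j: "j < cout C (fst (deco g v))"
    have "\<pi> v < verts h"
      using \<pi> v bij_betwE by blast
    moreover have "w (wiring h (VertIn (\<pi> v) i)) = w (map_source id \<pi> (wiring g (VertIn v i)))"
      if "i < cin C (fst (deco g v))" for i
      using wi[of "VertIn v i"] that v by simp
    ultimately show "w (map_source id \<pi> (VertOut v j)) = F (deco g v)
      (\<lambda>i\<in>{..<cin C (fst (deco g v))}. w (map_source id \<pi> (wiring g (VertIn v i)))) j"
      using valuationD(2)[OF w, of "\<pi> v" j] j d[OF v] by (simp cong: restrict_cong)
  qed (use valuationD(1)[OF w] graphsD(1)[OF g] graphsD(1)[OF h] in simp)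
  show ?thesis
    unfolding eval_graph_eq[OF g val] eval_graph_eq[OF h w]
    using wi[of "ExtOut _"] graphsD(2)[OF g] by (intro restrict_ext) simp
qed

lemma eval_graph_PiE:
  assumes g: "g \<in> graphs C n m"
    and F: "\<And>b y. \<lbrakk>b \<in> topspace (gen_top C); y \<in> {..<cin C (fst b)} \<rightarrow>\<^sub>E A\<rbrakk> \<Longrightarrow> F b y \<in> {..<cout C (fst b)} \<rightarrow>\<^sub>E A"
    and x: "x \<in> {..<n} \<rightarrow>\<^sub>E A"
  shows "s \<in> sources C g \<Longrightarrow> valuation_of C F g x s \<in> A" and "eval_graph C F g x \<in> {..<m} \<rightarrow>\<^sub>E A"
proof -
  let ?w = "valuation_of C F g x"
  have w: "valuation C F g x ?w"
    using valuation_valuation_of[OF g] .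
  show *: "?w s \<in> A" if "s \<in> sources C g" for s
    using g that
  proof (induction rule: source_induct)
    case (ext i)
    then show ?case
      using valuationD(1)[OF w] graphsD(1)[OF g] x by auto
  next
    case (vert v j)
    have "deco g v \<in> topspace (gen_top C)"
      using graphsD(3)[OF g] vert(1) by (auto simp: PiE_iff)
    then have "F (deco g v) (\<lambda>i\<in>{..<cin C (fst (deco g v))}. ?w (wiring g (VertIn v i)))
      \<in> {..<cout C (fst (deco g v))} \<rightarrow>\<^sub>E A"
      using vert(3) by (intro F) auto
    then show ?case
      using valuationD(2)[OF w vert(1,2)] vert(2) by (simp add: PiE_iff)
  qed
  show "eval_graph C F g x \<in> {..<m} \<rightarrow>\<^sub>E A"
    unfolding eval_graph_eq[OF g w] using * wiring_mem_sources[OF g] graphsD(2)[OF g] by simp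
qed


section \<open>Evaluation and identifications\<close>

text \<open>Identifications respect biarities, which is needed to speak about the values of identified graphs on a
  common tuple of inputs.\<close>
lemma identified_graphs:
  assumes "identified C R g h"
  shows "g \<in> graphs C (inputs g) (outputs g) \<and> h \<in> graphs C (inputs g) (outputs g)"
  using assms
proof induction
  case (iso g n m h)
  then show ?case using graphsD by blast
next
  case (rel g n m h)
  then show ?case using graphsD by blast
next
  case (sym g h)
  then show ?case using graphsD by metis
next
  case (trans g h k)
  then show ?case using graphsD by metis
next
  case (lact g h \<sigma>)
  then have "g_lact \<sigma> g \<in> graphs C (inputs g) (outputs g)" "g_lact \<sigma> h \<in> graphs C (inputs g) (outputs g)"
    using lact.IH lact(2) by (auto intro: g_lact_graphs)
  then show ?case using graphsD(1,2) by metis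
next
  case (ract g h \<tau>)
  then have "g_ract g \<tau> \<in> graphs C (inputs g) (outputs g)" "g_ract h \<tau> \<in> graphs C (inputs g) (outputs g)"
    using ract.IH ract(2) by (auto intro: g_ract_graphs)
  then show ?case using graphsD(1,2) by metis
next
  case (hcomp g h g' h')
  then show ?case using g_hcomp_graphs by (metis g_hcomp_simps(1,2))
next
  case (vcomp g h g' h')
  then show ?case using g_vcomp_graphs by (metis g_vcomp_simps(1,2))
qed

lemma identified_refl: "g \<in> graphs C n m \<Longrightarrow> identified C R g g"
  using identified.iso graph_iso_refl by metis

text \<open>Evaluation is invariant under isomorphism and compatible with all operations on graphs, so the relation of
  having equal values is an identification of the kind described by \<open>identified\<close>. It contains the smallest
  one as soon as it contains \<open>R\<close>.\<close>
lemma eval_graph_identified: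
  assumes F: "\<And>b y. \<lbrakk>b \<in> topspace (gen_top C); y \<in> {..<cin C (fst b)} \<rightarrow>\<^sub>E A\<rbrakk> \<Longrightarrow> F b y \<in> {..<cout C (fst b)} \<rightarrow>\<^sub>E A"
    and R: "\<And>g h n m x. \<lbrakk>g \<in> graphs C n m; h \<in> graphs C n m; R g h; x \<in> {..<n} \<rightarrow>\<^sub>E A\<rbrakk> \<Longrightarrow>
      eval_graph C F g x = eval_graph C F h x"
    and "identified C R g h" "x \<in> {..<inputs g} \<rightarrow>\<^sub>E A"
  shows "eval_graph C F g x = eval_graph C F h x"
  using assms(3,4)
proof (induction arbitrary: x)
  case (iso g n m h)
  then show ?case using eval_graph_iso by blast
next
  case (rel g n m h)
  then show ?case using R graphsD(1) by metis
next
  case (sym g h)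
  then show ?case using identified_graphs graphsD(1) by metis
next
  case (trans g h k)
  then show ?case using identified_graphs graphsD(1) by metis
next
  case (lact g h \<sigma>)
  have "g_lact \<sigma> g \<in> graphs C (inputs g) (outputs g)"
    using g_lact_graphs identified_graphs lact by blast
  then have "x \<in> {..<inputs g} \<rightarrow>\<^sub>E A"
    using lact.prems graphsD(1) by metis
  then show ?case
    using eval_g_lact[of _ C _ "outputs g" \<sigma> F x] identified_graphs[OF lact(1)] lact by metis
next
  case (ract g h \<tau>)
  have "g_ract g \<tau> \<in> graphs C (inputs g) (outputs g)"
    using g_ract_graphs identified_graphs ract by blast
  then have x: "x \<in> {..<inputs g} \<rightarrow>\<^sub>E A"
    using ract.prems graphsD(1) by metis
  have "tuple_perm (inputs g) \<tau> x \<in> {..<inputs g} \<rightarrow>\<^sub>E A"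
    using x permutes_inv_less[OF ract(2)] by (auto simp: tuple_perm_def PiE_iff)
  then show ?case
    using eval_g_ract[of _ C "inputs g" _ \<tau> F x] identified_graphs[OF ract(1)] ract by metis
next
  case (hcomp g h g' h')
  define y where "y = (\<lambda>i\<in>{..<inputs g}. x i)"
  define y' where "y' = (\<lambda>i\<in>{..<inputs g'}. x (inputs g + i))"
  have y: "y \<in> {..<inputs g} \<rightarrow>\<^sub>E A" "y' \<in> {..<inputs g'} \<rightarrow>\<^sub>E A"
    using hcomp.prems by (auto simp: y_def y'_def PiE_iff)
  have x: "x = tuple_append (inputs g) (inputs g') y y'"
    using hcomp.prems by (auto simp: tuple_append_def y_def y'_def PiE_iff extensional_def fun_eq_iff)
  note G = identified_graphs[OF hcomp(1)] identified_graphs[OF hcomp(2)]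
  show ?case
    unfolding x eval_g_hcomp[OF conjunct1[OF G(1)] conjunct1[OF G(2)]]
      eval_g_hcomp[OF conjunct2[OF G(1)] conjunct2[OF G(2)]]
    using hcomp.IH y by simp
next
  case (vcomp g h g' h')
  note G = identified_graphs[OF vcomp(1)] identified_graphs[OF vcomp(2), unfolded vcomp(3)]
  have x: "x \<in> {..<inputs g} \<rightarrow>\<^sub>E A"
    using vcomp.prems by simp
  have y: "eval_graph C F g x \<in> {..<inputs g'} \<rightarrow>\<^sub>E A"
    unfolding vcomp(3) by (rule eval_graph_PiE(2)[OF conjunct1[OF G(1)] F x])
  show ?case
    unfolding eval_g_vcomp[OF conjunct1[OF G(1)] conjunct1[OF G(2)]]
      eval_g_vcomp[OF conjunct2[OF G(1)] conjunct2[OF G(2)]]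
    unfolding vcomp.IH(2)[OF y] by (simp only: vcomp.IH(1)[OF x])
qed


section \<open>Generation of graphs by corollas\<close>

lemma inj_on_extends_to_permutation:
  assumes S: "finite S" and A: "A \<subseteq> S" and f: "inj_on f A" "f ` A \<subseteq> S"
  obtains p where "p permutes S" "\<And>a. a \<in> A \<Longrightarrow> p a = f a"
proof -
  have fin: "finite A" "finite (f ` A)"
    using S A f(2) finite_subset by blast+
  have "card (S - A) = card (S - f ` A)"
    using card_Diff_subset[OF fin(1) A] card_Diff_subset[OF fin(2) f(2)] card_image[OF f(1)] by simp
  then obtain h where h: "bij_betw h (S - A) (S - f ` A)"
    using finite_same_card_bij[OF finite_Diff[OF S] finite_Diff[OF S]] by blast
  define p where "p x = (if x \<in> A then f x else if x \<in> S then h x else x)" for x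
  have "bij_betw p A (f ` A) \<longleftrightarrow> bij_betw f A (f ` A)"
    by (rule bij_betw_cong) (simp add: p_def)
  then have 1: "bij_betw p A (f ` A)"
    using f(1) by (simp add: inj_on_imp_bij_betw)
  have "bij_betw p (S - A) (S - f ` A) \<longleftrightarrow> bij_betw h (S - A) (S - f ` A)"
    by (rule bij_betw_cong) (simp add: p_def)
  then have "bij_betw p (A \<union> (S - A)) (f ` A \<union> (S - f ` A))"
    using bij_betw_combine[OF 1, of "S - A" "S - f ` A"] h by simp
  moreover have "A \<union> (S - A) = S" "f ` A \<union> (S - f ` A) = S"
    using A f(2) by auto
  ultimately have "bij_betw p S S"
    by simp
  then have "p permutes S"
    by (rule bij_imp_permutes) (use A in \<open>auto simp: p_def\<close>)
  then show thesis
    by (rule that) (simp add: p_def)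
qed

lemma graph_iso_if_same_wiring:
  assumes "inputs h = inputs g" "outputs h = outputs g" "verts h = verts g"
    and "\<And>v. v < verts g \<Longrightarrow> deco h v = deco g v"
    and "\<And>t. t \<in> targets C g \<Longrightarrow> wiring h t = wiring g t"
  shows "graph_iso C g h"
  unfolding graph_iso_def using assms by (intro conjI exI[of _ id]) auto

text \<open>The graph below the last vertex: that vertex is removed, and the edges that entered it become the last
  external outputs, in place of the edges that left it.\<close>
definition unplug_last :: "'c cells \<Rightarrow> 'c graph \<Rightarrow> 'c graph" where
  "unplug_last C g =
     (let k = verts g - 1; c = fst (deco g k); r = outputs g - cout C c in
      (\<lparr>gin = inputs g, gout = r + cin C c, nvert = k,
        wire = (\<lambda>t. wiring g (case t of
            ExtOut j \<Rightarrow> if j < r then ExtOut j else VertIn k (j - r)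
          | VertIn v i \<Rightarrow> VertIn v i))\<rparr>, \<lambda>v\<in>{..<k}. deco g v))"

text \<open>If the edges that leave the last vertex are the last external outputs, in order, then the graph is a
  vertical composite whose upper factor is a layer consisting of that vertex and \<open>r\<close> parallel strands.\<close>
lemma unplug_last:
  assumes g: "g \<in> graphs C n m" and k: "verts g = Suc k"
    and c: "c = fst (deco g k)" and m: "m = r + cout C c"
    and sink: "\<And>j. j < cout C c \<Longrightarrow> wiring g (ExtOut (r + j)) = VertOut k j"
  shows unplug_last_graphs: "unplug_last C g \<in> graphs C n (r + cin C c)"
    and graph_iso_unplug_last: "graph_iso C g
      (g_vcomp (g_hcomp (g_ident r) (g_corolla C (deco g k))) (unplug_last C g))"
proof -
  note gs = graphsD[OF g]
  let ?h = "unplug_last C g"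
  \<comment> \<open>\<open>\<iota>\<close> sends a target of the smaller graph to the target of \<open>g\<close> at which the same edge ends\<close>
  define \<iota> where "\<iota> t = (case t of
      ExtOut j \<Rightarrow> if j < r then ExtOut j else VertIn k (j - r)
    | VertIn v i \<Rightarrow> VertIn v i)" for t
  have r: "outputs g - cout C (fst (deco g k)) = r"
    using gs(2) m c by simp
  have h [simp]: "inputs ?h = n" "outputs ?h = r + cin C c" "verts ?h = k"
    "deco ?h = (\<lambda>v\<in>{..<k}. deco g v)" "wiring ?h t = wiring g (\<iota> t)" for t
    by (simp_all add: unplug_last_def Let_def k r gs(1) \<iota>_def c split: target.split)
  obtain rg :: "nat \<Rightarrow> nat" where rg:
    "\<And>v i u j. \<lbrakk>VertIn v i \<in> targets C g; wiring g (VertIn v i) = VertOut u j\<rbrakk> \<Longrightarrow> rg u < rg v"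
    using graphs_rank[OF g] by blast
  let ?T = "(\<lambda>j. ExtOut (r + j)) ` {..<cout C c}" and ?S = "VertOut k ` {..<cout C c}"
  have sub: "?T \<subseteq> targets C g" "?S \<subseteq> sources C g"
    using gs(2) m c k by auto
  have "bij_betw (wiring g) ?T ?S"
  proof -
    have "wiring g ` ?T = ?S"
      using sink by (force simp: image_image)
    then show ?thesis
      by (rule bij_betw_subset[OF gs(4) sub(1)])
  qed
  then have 1: "bij_betw (wiring g) (targets C g - ?T) (sources C g - ?S)"
    using bij_betw_DiffI[OF gs(4)] sub by blast
  have S: "sources C g - ?S = sources C ?h"
    by (rule source_set_eqI) (use gs(1) k c in \<open>auto simp: less_Suc_eq\<close>)
  have low: "j < r" if "ExtOut j \<in> targets C g - ?T" for j
  proof (rule ccontr)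
    assume "\<not> j < r"
    then have "ExtOut j \<in> ?T"
      using that gs(2) m by (intro image_eqI[of _ _ "j - r"]) auto
    then show False
      using that by blast
  qed
  have 2: "bij_betw \<iota> (targets C ?h) (targets C g - ?T)"
  proof (rule bij_betw_byWitness[where f' = "\<lambda>t. case t of
        ExtOut j \<Rightarrow> ExtOut j | VertIn v i \<Rightarrow> if v = k then ExtOut (r + i) else VertIn v i"])
    show "\<forall>t\<in>targets C ?h. (case \<iota> t of
        ExtOut j \<Rightarrow> ExtOut j | VertIn v i \<Rightarrow> if v = k then ExtOut (r + i) else VertIn v i) = t"
      by (auto simp: targets_def \<iota>_def)
    show "\<forall>t\<in>targets C g - ?T. \<iota> (case t of
        ExtOut j \<Rightarrow> ExtOut j | VertIn v i \<Rightarrow> if v = k then ExtOut (r + i) else VertIn v i) = t"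
    proof
      fix t assume t: "t \<in> targets C g - ?T"
      show "\<iota> (case t of
          ExtOut j \<Rightarrow> ExtOut j | VertIn v i \<Rightarrow> if v = k then ExtOut (r + i) else VertIn v i) = t"
      proof (cases t)
        case (ExtOut j)
        have "j < r"
          using low t ExtOut by blast
        then show ?thesis
          using ExtOut by (simp add: \<iota>_def)
      qed (simp add: \<iota>_def)
    qed
    show "\<iota> ` targets C ?h \<subseteq> targets C g - ?T"
    proof (rule image_subsetI)
      fix t assume "t \<in> targets C ?h"
      then show "\<iota> t \<in> targets C g - ?T"
        using gs(2) m c k by (cases t) (auto simp: \<iota>_def)
    qed
    show "(\<lambda>t. case t of ExtOut j \<Rightarrow> ExtOut j | VertIn v i \<Rightarrow> if v = k then ExtOut (r + i) else VertIn v i)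
      ` (targets C g - ?T) \<subseteq> targets C ?h"
    proof (rule image_subsetI)
      fix t assume t: "t \<in> targets C g - ?T"
      show "(case t of ExtOut j \<Rightarrow> ExtOut j | VertIn v i \<Rightarrow> if v = k then ExtOut (r + i) else VertIn v i)
        \<in> targets C ?h"
      proof (cases t)
        case (ExtOut j)
        have "j < r"
          using low t ExtOut by blast
        then show ?thesis
          using ExtOut by simp
      next
        case (VertIn v i)
        then show ?thesis
          using t k c by (auto simp: less_Suc_eq)
      qed
    qed
  qed
  show hg: "?h \<in> graphs C n (r + cin C c)"
  proof (rule graphsI[where rank = rg])
    show "deco ?h \<in> {..<verts ?h} \<rightarrow>\<^sub>E topspace (gen_top C)"
      using gs(3) k by (simp add: PiE_iff)
    have "wiring ?h = wiring g \<circ> \<iota>"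
      by (rule ext) simp
    then show "bij_betw (wiring ?h) (targets C ?h) (sources C ?h)"
      using bij_betw_trans[OF 2 1] S by simp
    show "rg u < rg v" if "VertIn v i \<in> targets C ?h" "wiring ?h (VertIn v i) = VertOut u j" for v i u j
    proof -
      have "v < k"
        using that(1) by simp
      then show ?thesis
        using that rg[of v i u j] k by (simp add: \<iota>_def)
    qed
  qed simp_all
  let ?k = "g_vcomp (g_hcomp (g_ident r) (g_corolla C (deco g k))) ?h"
  show "graph_iso C g ?k"
  proof (rule graph_iso_if_same_wiring)
    show "inputs ?k = inputs g" "outputs ?k = outputs g" "verts ?k = verts g"
      using gs(1,2) m c k by (simp_all add: g_corolla_def g_ident_def)
    show "deco ?k v = deco g v" if "v < verts g" for v
      using that k by (auto simp: tuple_append_def g_corolla_def g_ident_def tuple_def less_Suc_eq)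
  next
    fix t assume t: "t \<in> targets C g"
    show "wiring ?k t = wiring g t"
    proof (cases t)
      case (ExtOut j)
      show ?thesis
      proof (cases "j < r")
        case True
        then show ?thesis
          using ExtOut by (simp add: g_vcomp_def g_hcomp_def g_ident_def Let_def \<iota>_def)
      next
        case False
        then have "wiring g (ExtOut j) = VertOut k (j - r)"
          using sink[of "j - r"] t ExtOut gs(2) m by simp
        then show ?thesis
          using ExtOut False by (simp add: g_vcomp_def g_hcomp_def g_ident_def g_corolla_def Let_def)
      qed
    next
      case (VertIn v i)
      then show ?thesis
        using t k by (auto simp: g_vcomp_def g_hcomp_def g_ident_def g_corolla_def Let_def \<iota>_def less_Suc_eq)
    qed
  qed
qed

text \<open>Without vertices, the wiring is nothing but a bijection from external outputs to external inputs.\<close>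
lemma graph_iso_without_vertices:
  assumes g: "g \<in> graphs C n m" and "verts g = 0"
  obtains \<sigma> where "m = n" "\<sigma> permutes {..<n}" "graph_iso C g (g_lact \<sigma> (g_ident n))"
proof -
  note gs = graphsD[OF g]
  define the_in where "the_in s = (case s of ExtIn i \<Rightarrow> i | VertOut v j \<Rightarrow> 0)" for s
  have T: "bij_betw ExtOut {..<m} (targets C g)"
    using assms(2) gs(2) by (intro bij_betw_imageI inj_onI) (auto simp: targets_def)
  have S: "bij_betw the_in (sources C g) {..<n}"
    using assms(2) gs(1) by (intro bij_betwI[where g = ExtIn]) (auto simp: sources_def the_in_def)
  define p where "p j = the_in (wiring g (ExtOut j))" for j
  have p: "bij_betw p {..<m} {..<n}"
    using bij_betw_trans[OF bij_betw_trans[OF T gs(4)] S] by (simp add: o_def p_def[abs_def])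
  then have mn: "m = n"
    using bij_betw_same_card by fastforce
  define q where "q j = (if j < n then p j else j)" for j
  have q: "q permutes {..<n}"
  proof (rule bij_imp_permutes)
    have "bij_betw q {..<n} {..<n} \<longleftrightarrow> bij_betw p {..<n} {..<n}"
      by (rule bij_betw_cong) (simp add: q_def)
    then show "bij_betw q {..<n} {..<n}"
      using p mn by simp
  qed (simp add: q_def)
  have w: "wiring g (ExtOut j) = ExtIn (q j)" if "j < n" for j
    using wiring_mem_sources[OF g, of "ExtOut j"] that gs(2) mn assms(2)
    by (cases "wiring g (ExtOut j)") (auto simp: q_def p_def the_in_def)
  have "graph_iso C g (g_lact (inv q) (g_ident n))"
  proof (rule graph_iso_if_same_wiring)
    fix t assume "t \<in> targets C g"
    then show "wiring (g_lact (inv q) (g_ident n)) t = wiring g t"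
      using assms(2) gs(2) mn w by (cases t) (auto simp: g_lact_def g_ident_def permutes_inv_inv[OF q])
  qed (use gs mn assms(2) in \<open>auto simp: g_lact_def g_ident_def\<close>)
  then show thesis
    using that mn permutes_inv[OF q] by blast
qed

text \<open>The prop is generated by its cells: a vertex of maximal rank feeds only external outputs. Renumbering
  vertices and outputs turns it into the last vertex with its outputs at the end, so that it can be split off,
  and induction on the number of vertices applies.\<close>
lemma graph_generation [consumes 1, case_names iso ident corolla hcomp vcomp lact]:
  assumes g: "g \<in> graphs C n m"
    and iso: "\<And>g h n m. \<lbrakk>g \<in> graphs C n m; h \<in> graphs C n m; graph_iso C g h; P h\<rbrakk> \<Longrightarrow> P g"
    and ident: "\<And>n. P (g_ident n)"
    and corolla: "\<And>b. b \<in> topspace (gen_top C) \<Longrightarrow> P (g_corolla C b)"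
    and hcomp: "\<And>g h n m n' m'. \<lbrakk>g \<in> graphs C n m; h \<in> graphs C n' m'; P g; P h\<rbrakk> \<Longrightarrow> P (g_hcomp g h)"
    and vcomp: "\<And>g h n m l. \<lbrakk>g \<in> graphs C n m; h \<in> graphs C m l; P g; P h\<rbrakk> \<Longrightarrow> P (g_vcomp h g)"
    and lact: "\<And>g n m \<sigma>. \<lbrakk>g \<in> graphs C n m; \<sigma> permutes {..<m}; P g\<rbrakk> \<Longrightarrow> P (g_lact \<sigma> g)"
  shows "P g"
  using g
proof (induction "verts g" arbitrary: g m)
  case 0
  then obtain \<sigma> where \<sigma>: "m = n" "\<sigma> permutes {..<n}" "graph_iso C g (g_lact \<sigma> (g_ident n))"
    using graph_iso_without_vertices by metis
  have "P (g_lact \<sigma> (g_ident n))"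
    using lact[OF g_ident_graphs \<sigma>(2) ident] .
  moreover have "g_lact \<sigma> (g_ident n) \<in> graphs C n m"
    using g_lact_graphs[OF g_ident_graphs] \<sigma> by metis
  ultimately show ?case
    using iso 0(2) \<sigma>(3) by blast
next
  case (Suc k)
  note g = Suc.prems and gs = graphsD[OF Suc.prems]
  obtain rg :: "nat \<Rightarrow> nat" where rg:
    "\<And>v i u j. \<lbrakk>VertIn v i \<in> targets C g; wiring g (VertIn v i) = VertOut u j\<rbrakk> \<Longrightarrow> rg u < rg v"
    using graphs_rank[OF g] by blast
  obtain v where v: "v < verts g" "\<And>u. u < verts g \<Longrightarrow> rg u \<le> rg v"
  proof -
    have "rg ` {..<verts g} \<noteq> {}" "finite (rg ` {..<verts g})"
      using Suc.hyps(2)[symmetric] by (simp_all add: lessThan_empty_iff)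
    then have "Max (rg ` {..<verts g}) \<in> rg ` {..<verts g}"
      using Max_in by blast
    then obtain v where "v < verts g" "rg v = Max (rg ` {..<verts g})"
      by auto
    then show thesis
      using that[of v] by simp
  qed
  define b where "b = cout C (fst (deco g v))"
  have "\<exists>i<m. wiring g (ExtOut i) = VertOut v j" if "j < b" for j
  proof -
    have "VertOut v j \<in> sources C g"
      using that v(1) by (simp add: b_def)
    then obtain t where t: "t \<in> targets C g" "wiring g t = VertOut v j"
      using gs(4) by (metis bij_betw_def imageE)
    show ?thesis
    proof (cases t)
      case (ExtOut i)
      then show ?thesis using t gs(2) by auto
    next
      case (VertIn u i)
      then have "rg v < rg u" "u < verts g"
        using rg t by auto
      then show ?thesis
        using v(2)[of u] by simp
    qed
  qed
  then obtain out where out: "\<And>j. j < b \<Longrightarrow> out j < m \<and> wiring g (ExtOut (out j)) = VertOut v j"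
    by metis
  have inj: "inj_on out {..<b}"
    by (rule inj_onI) (metis out lessThan_iff source.inject(2))
  have "card {..<b} \<le> card {..<m}"
    by (rule card_inj_on_le[OF inj]) (use out in auto)
  then have bm: "b \<le> m"
    by simp
  define r where "r = m - b"
  have m: "m = r + b"
    using bm by (simp add: r_def)
  \<comment> \<open>a permutation of the outputs that puts those of the maximal vertex at the end, in order\<close>
  obtain p where p: "p permutes {..<m}" and p': "\<And>i. i \<in> {r..<m} \<Longrightarrow> p i = out (i - r)"
  proof (rule inj_on_extends_to_permutation[of "{..<m}" "{r..<m}" "\<lambda>i. out (i - r)"])
    show "inj_on (\<lambda>i. out (i - r)) {r..<m}"
      using inj_onD[OF inj] m by (intro inj_onI) (metis add_diff_inverse_nat add_less_cancel_left atLeastLessThan_iff lessThan_iff not_less)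
    show "(\<lambda>i. out (i - r)) ` {r..<m} \<subseteq> {..<m}"
      using out m by auto
  qed auto
  define \<pi> where "\<pi> = Transposition.transpose v k"
  have \<pi>: "\<pi> permutes {..<verts g}"
    unfolding \<pi>_def using v(1) Suc.hyps(2)[symmetric] by (intro permutes_swap_id) auto
  have inv_p: "inv p permutes {..<m}"
    using permutes_inv[OF p] .
  define g2 where "g2 = relabel id (inv p) \<pi> g"
  have g2: "g2 \<in> graphs C n m"
    unfolding g2_def by (rule relabel_graphs[OF g permutes_id inv_p \<pi>])
  have d2: "deco g2 k = deco g v"
    using Suc.hyps(2)[symmetric] by (simp add: g2_def \<pi>_def)
  have "wiring g2 (ExtOut (r + j)) = VertOut k j" if "j < b" for j
    using out[OF that] p'[of "r + j"] that m by (simp add: g2_def permutes_inv_inv[OF p] \<pi>_def)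
  then have sink: "\<And>j. j < cout C (fst (deco g2 k)) \<Longrightarrow> wiring g2 (ExtOut (r + j)) = VertOut k j"
    by (simp add: d2 b_def)
  have m2: "m = r + cout C (fst (deco g2 k))"
    using m by (simp add: d2 b_def)
  have k2: "verts g2 = Suc k"
    using Suc.hyps(2) by (simp add: g2_def)
  note u = unplug_last[OF g2 k2 refl m2 sink]
  have dk: "deco g2 k \<in> topspace (gen_top C)"
    using graphsD(3)[OF g2] k2 by (auto simp: PiE_iff)
  have "P (unplug_last C g2)"
    by (rule Suc.hyps(1)[OF _ u(1)]) (simp add: unplug_last_def Let_def k2)
  moreover have H: "g_hcomp (g_ident r) (g_corolla C (deco g2 k)) \<in> graphs C (r + cin C (fst (deco g2 k))) m"
    by (subst m2) (rule g_hcomp_graphs[OF g_ident_graphs g_corolla_graphs[OF dk]])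
  moreover have "P (g_hcomp (g_ident r) (g_corolla C (deco g2 k)))"
    by (rule hcomp[OF g_ident_graphs g_corolla_graphs[OF dk] ident corolla[OF dk]])
  ultimately have "P (g_vcomp (g_hcomp (g_ident r) (g_corolla C (deco g2 k))) (unplug_last C g2))"
    using vcomp u(1) by blast
  then have "P g2"
    using iso[OF g2 g_vcomp_graphs[OF u(1) H] u(2)] by blast
  then have "P (g_lact p g2)"
    using lact[OF g2 p] by blast
  moreover have "graph_iso C g (g_lact p g2)"
    unfolding graph_iso_def
  proof (intro conjI exI[of _ \<pi>] ballI)
    fix t assume "t \<in> targets C g"
    show "wiring (g_lact p g2) (map_target id \<pi> t) = map_source id \<pi> (wiring g t)"
      using permutes_inj[OF \<pi>] permutes_inv_o[OF p]
      by (simp add: g_lact_def g2_def map_target_comp permutes_inv_inv[OF p])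
  qed (use permutes_imp_bij[OF \<pi>] permutes_less[OF \<pi>] permutes_inverses(2)[OF \<pi>] in
      \<open>auto simp: g_lact_def g2_def\<close>)
  ultimately show ?case
    using iso[OF g g_lact_graphs[OF g2 p]] by blast
qed


section \<open>Spaces of graphs\<close>

lemma cw_points_cw_power [simp]: "cw_points (cw_power X n) = {..<n} \<rightarrow>\<^sub>E cw_points X"
  by (simp add: cw_power_def)

lemma topspace_gen_top: "topspace (gen_top C) = (SIGMA c : UNIV. topspace (cube (cdim C c)))"
  by (auto simp: gen_top_def)

lemma cw_points_graph_space [simp]: "cw_points (graph_space C n m) = graphs C n m"
proof -
  have "g \<in> Sigma UNIV (topspace \<circ> (\<lambda>S. product_topology (\<lambda>_. gen_top C) {..<nvert S}))" if "g \<in> graphs C n m" for g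
    using graphsD(3)[OF that] by (cases g) simp
  then show ?thesis
    by (auto simp: graph_space_def)
qed

lemma openin_gen_top_cell: "openin (gen_top C) ({c} \<times> topspace (cube (cdim C c)))"
proof -
  have "{x. (c', x) \<in> {c} \<times> topspace (cube (cdim C c))} = (if c' = c then topspace (cube (cdim C c)) else {})" for c'
    by auto
  then show ?thesis
    unfolding gen_top_def openin_sum_topology by auto
qed

lemma continuous_map_snd_sum_topology:
  assumes "i \<in> I"
  shows "continuous_map (subtopology (sum_topology X I) ({i} \<times> UNIV)) (X i) snd"
  unfolding continuous_map_def
proof (intro conjI allI impI)
  fix U assume U: "openin (X i) U"
  have "{x. (j, x) \<in> {i} \<times> U} = (if j = i then U else {})" for j
    by auto
  then have "openin (sum_topology X I) ({i} \<times> U)"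
    unfolding openin_sum_topology using assms U openin_subset[OF U] by auto
  moreover have "{x \<in> topspace (subtopology (sum_topology X I) ({i} \<times> UNIV)). snd x \<in> U} = ({i} \<times> U) \<inter> ({i} \<times> UNIV)"
    using assms openin_subset[OF U] by auto
  ultimately show "openin (subtopology (sum_topology X I) ({i} \<times> UNIV))
    {x \<in> topspace (subtopology (sum_topology X I) ({i} \<times> UNIV)). snd x \<in> U}"
    using openin_subtopology_Int by metis
qed auto

text \<open>On these open pieces of a space of graphs only the continuous parameters of the decorations vary; the
  combinatorics, and hence the order in which a graph is evaluated, is constant.\<close>
definition cell_piece :: "shape \<Rightarrow> (nat \<Rightarrow> 'c) \<Rightarrow> 'c graph set" where
  "cell_piece S c = {g. fst g = S \<and> (\<forall>v<nvert S. fst (deco g v) = c v)}"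

lemma openin_cell_piece:
  "openin (cw_top (graph_space C n m)) (graphs C n m \<inter> cell_piece S c)"
proof -
  let ?U = "{S} \<times> (\<Pi>\<^sub>E v\<in>{..<nvert S}. {c v} \<times> topspace (cube (cdim C (c v))))"
  have "openin (product_topology (\<lambda>_. gen_top C) {..<nvert S})
      (\<Pi>\<^sub>E v\<in>{..<nvert S}. {c v} \<times> topspace (cube (cdim C (c v))))"
    by (simp add: openin_PiE openin_gen_top_cell)
  then have *: "openin (product_topology (\<lambda>_. gen_top C) {..<nvert S'}) {\<delta>. (S', \<delta>) \<in> ?U}" for S'
    by (cases "S' = S") auto
  have "?U \<subseteq> Sigma UNIV (topspace \<circ> (\<lambda>S. product_topology (\<lambda>_. gen_top C) {..<nvert S}))"
  proof -
    have "(\<Pi>\<^sub>E v\<in>{..<nvert S}. {c v} \<times> topspace (cube (cdim C (c v)))) \<subseteq> {..<nvert S} \<rightarrow>\<^sub>E topspace (gen_top C)"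
      by (intro PiE_mono) (auto simp: topspace_gen_top)
    then show ?thesis
      by (intro Sigma_mono) (simp_all add: o_def)
  qed
  then have "openin (sum_topology (\<lambda>S. product_topology (\<lambda>_. gen_top C) {..<nvert S}) UNIV) ?U"
    unfolding openin_sum_topology using * by blast
  then have "openin (cw_top (graph_space C n m)) (?U \<inter> graphs C n m)"
    by (simp add: graph_space_def openin_subtopology_Int)
  moreover have "?U \<inter> graphs C n m = graphs C n m \<inter> cell_piece S c"
  proof -
    have "(deco g v \<in> {c v} \<times> topspace (cube (cdim C (c v)))) \<longleftrightarrow> fst (deco g v) = c v"
      if "g \<in> graphs C n m" "v < verts g" for g v
    proof -
      have "deco g v \<in> topspace (gen_top C)"
        using PiE_mem[OF graphsD(3)[OF that(1)]] that(2) by simp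
      then show ?thesis
        by (cases "deco g v") (auto simp: topspace_gen_top)
    qed
    moreover have "deco g \<in> extensional {..<verts g}" if "g \<in> graphs C n m" for g
      using graphsD(3)[OF that] by (simp add: PiE_iff)
    ultimately have "g \<in> ?U \<longleftrightarrow> g \<in> cell_piece S c" if "g \<in> graphs C n m" for g
      using that unfolding cell_piece_def by (cases g) (auto simp: PiE_iff)
    then show ?thesis
      by blast
  qed
  ultimately show ?thesis
    by simp
qed

lemma continuous_map_deco:
  assumes "v < nvert S"
  shows "continuous_map (subtopology (cw_top (graph_space C n m)) (cell_piece S c)) (cube (cdim C (c v)))
    (\<lambda>g. snd (deco g v))"
proof -
  let ?P = "\<lambda>S. product_topology (\<lambda>_. gen_top C) {..<nvert S}"
  let ?T = "subtopology (cw_top (graph_space C n m)) (cell_piece S c)"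
  have sub: "?T = subtopology (subtopology (sum_topology ?P UNIV) ({S} \<times> UNIV)) (graphs C n m \<inter> cell_piece S c)"
  proof -
    have "({S} \<times> UNIV) \<inter> (graphs C n m \<inter> cell_piece S c) = graphs C n m \<inter> cell_piece S c"
      by (auto simp: cell_piece_def)
    then show ?thesis
      by (simp add: graph_space_def subtopology_subtopology)
  qed
  have "continuous_map ?T (?P S) snd"
    unfolding sub by (rule continuous_map_from_subtopology) (rule continuous_map_snd_sum_topology[OF UNIV_I])
  then have "continuous_map ?T (gen_top C) ((\<lambda>\<delta>. \<delta> v) \<circ> snd)"
    using assms by (intro continuous_map_compose[OF _ continuous_map_product_projection]) auto
  then have "continuous_map ?T (subtopology (gen_top C) ({c v} \<times> UNIV)) (\<lambda>g. deco g v)"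
    using assms by (intro continuous_map_into_subtopology) (auto simp: o_def cell_piece_def mem_Times_iff)
  then have "continuous_map ?T (cube (cdim C (c v))) (snd \<circ> (\<lambda>g. deco g v))"
    by (rule continuous_map_compose)
       (use continuous_map_snd_sum_topology[of "c v" UNIV "\<lambda>c. cube (cdim C c)"] in \<open>simp add: gen_top_def\<close>)
  then show ?thesis
    by (simp add: o_def)
qed


section \<open>Presented props\<close>

text \<open>The definition of a quotient of a space refers to its open sets through \<open>topology\<close>, so this is what gives
  access to them.\<close>
lemma istopology_quotient:
  "istopology (\<lambda>U. U \<subseteq> A // r \<and> openin T {x \<in> topspace T. r `` {x} \<in> U})"
  unfolding istopology_def
proof (intro conjI allI impI)
  fix U V
  assume "U \<subseteq> A // r \<and> openin T {x \<in> topspace T. r `` {x} \<in> U}"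
    "V \<subseteq> A // r \<and> openin T {x \<in> topspace T. r `` {x} \<in> V}"
  moreover have "{x \<in> topspace T. r `` {x} \<in> U \<inter> V} =
      {x \<in> topspace T. r `` {x} \<in> U} \<inter> {x \<in> topspace T. r `` {x} \<in> V}"
    by auto
  ultimately show "U \<inter> V \<subseteq> A // r" "openin T {x \<in> topspace T. r `` {x} \<in> U \<inter> V}"
    by auto
next
  fix \<K>
  assume \<K>: "\<forall>K\<in>\<K>. K \<subseteq> A // r \<and> openin T {x \<in> topspace T. r `` {x} \<in> K}"
  have "{x \<in> topspace T. r `` {x} \<in> \<Union>\<K>} = (\<Union>K\<in>\<K>. {x \<in> topspace T. r `` {x} \<in> K})"
    by auto
  then show "\<Union>\<K> \<subseteq> A // r" "openin T {x \<in> topspace T. r `` {x} \<in> \<Union>\<K>}"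
    using \<K> by auto
qed

lemma openin_quotient_cw:
  "openin (cw_top (quotient_cw X r)) U \<longleftrightarrow>
    U \<subseteq> cw_points X // r \<and> openin (cw_top X) {x \<in> cw_points X. r `` {x} \<in> U}"
  unfolding quotient_cw_def by (simp add: topology_inverse'[OF istopology_quotient])

lemma cw_points_quotient_cw [simp]: "cw_points (quotient_cw X r) = cw_points X // r"
proof -
  have "{x \<in> cw_points X. r `` {x} \<in> cw_points X // r} = cw_points X"
    by (auto simp: quotientI)
  then have "openin (cw_top (quotient_cw X r)) (cw_points X // r)"
    by (simp add: openin_quotient_cw)
  then show ?thesis
    using openin_subset[of "cw_top (quotient_cw X r)"] openin_topspace[of "cw_top (quotient_cw X r)"]
      openin_quotient_cw by (metis subset_antisym)
qed

lemma quotient_map_quotient_cw: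
  "quotient_map (cw_top X) (cw_top (quotient_cw X r)) (\<lambda>x. r `` {x})"
  unfolding quotient_map_def openin_quotient_cw cw_points_quotient_cw
  by (auto simp: quotient_def)

lemma gclass_Image: "{(g, h). identified C R g h} `` {g} = gclass C R g"
  by auto

lemma gclass_eq_iff:
  assumes "g \<in> graphs C n m"
  shows "gclass C R g = gclass C R h \<longleftrightarrow> identified C R g h"
  using identified_refl[OF assms, of R] identified.sym identified.trans by (metis (lifting) mem_Collect_eq Collect_cong)

lemma gclass_nonempty: "g \<in> graphs C n m \<Longrightarrow> gclass C R g \<noteq> {}"
  using identified_refl[of g C n m R] by blast

lemma UN_eq_const: "\<lbrakk>A \<noteq> {}; \<And>x. x \<in> A \<Longrightarrow> f x = c\<rbrakk> \<Longrightarrow> (\<Union>x\<in>A. f x) = c"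
  by auto

lemma cw_points_Hom: "cw_points (Hom (presented_prop C R) n m) = gclass C R ` graphs C n m"
  by (auto simp: presented_prop_def quotient_def gclass_Image)

lemma cw_skel_Hom:
  "cw_skel (Hom (presented_prop C R) n m) k = gclass C R ` cw_skel (graph_space C n m) k"
  by (simp add: presented_prop_def quotient_cw_def gclass_Image)

lemma quotient_map_gclass:
  "quotient_map (cw_top (graph_space C n m)) (cw_top (Hom (presented_prop C R) n m)) (gclass C R)"
  using quotient_map_quotient_cw[of "graph_space C n m" "{(g, h). identified C R g h}"]
  by (simp add: presented_prop_def gclass_Image)

lemma ident_presented_prop: "ident (presented_prop C R) n = gclass C R (g_ident n)"
  by (simp add: presented_prop_def)

text \<open>The operations of a presented prop are unions over all representatives of the arguments. Since
  identifications are compatible with the operations on graphs, all these representatives contribute the same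
  class.\<close>
lemma hcomp_gclass:
  assumes "g \<in> graphs C n m" "h \<in> graphs C n' m'"
  shows "hcomp (presented_prop C R) (gclass C R g) (gclass C R h) = gclass C R (g_hcomp g h)"
proof -
  have "gclass C R (g_hcomp g' h') = gclass C R (g_hcomp g h)" if "identified C R g g'" "identified C R h h'" for g' h'
    using that gclass_eq_iff[OF g_hcomp_graphs[OF assms]] identified.hcomp by blast
  then show ?thesis
    unfolding presented_prop_def prop_data.simps
    by (intro UN_eq_const gclass_nonempty[OF assms(1)] gclass_nonempty[OF assms(2)]) (simp only: mem_Collect_eq)
qed

lemma vcomp_gclass:
  assumes "g \<in> graphs C n m" "h \<in> graphs C m l"
  shows "vcomp (presented_prop C R) (gclass C R h) (gclass C R g) = gclass C R (g_vcomp h g)"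
proof -
  have "inputs h = outputs g"
    using assms graphsD by metis
  then have "gclass C R (g_vcomp h' g') = gclass C R (g_vcomp h g)" if "identified C R g g'" "identified C R h h'" for g' h'
    using that gclass_eq_iff[OF g_vcomp_graphs[OF assms]] identified.vcomp by blast
  then show ?thesis
    unfolding presented_prop_def prop_data.simps
    by (intro UN_eq_const gclass_nonempty[OF assms(1)] gclass_nonempty[OF assms(2)]) (simp only: mem_Collect_eq)
qed

lemma lact_gclass:
  assumes "g \<in> graphs C n m" "\<sigma> permutes {..<m}"
  shows "lact (presented_prop C R) \<sigma> (gclass C R g) = gclass C R (g_lact \<sigma> g)"
proof -
  have "\<sigma> permutes {..<outputs g}"
    using assms graphsD by metis
  then have "gclass C R (g_lact \<sigma> g') = gclass C R (g_lact \<sigma> g)" if "identified C R g g'" for g'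
    using that gclass_eq_iff[OF g_lact_graphs[OF assms]] identified.lact by blast
  then show ?thesis
    unfolding presented_prop_def prop_data.simps
    by (intro UN_eq_const gclass_nonempty[OF assms(1)]) (simp only: mem_Collect_eq)
qed

lemma ract_gclass:
  assumes "g \<in> graphs C n m" "\<tau> permutes {..<n}"
  shows "ract (presented_prop C R) (gclass C R g) \<tau> = gclass C R (g_ract g \<tau>)"
proof -
  have "\<tau> permutes {..<inputs g}"
    using assms graphsD by metis
  then have "gclass C R (g_ract g' \<tau>) = gclass C R (g_ract g \<tau>)" if "identified C R g g'" for g'
    using that gclass_eq_iff[OF g_ract_graphs[OF assms]] identified.ract by blast
  then show ?thesis
    unfolding presented_prop_def prop_data.simps
    by (intro UN_eq_const gclass_nonempty[OF assms(1)]) (simp only: mem_Collect_eq)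
qed


section \<open>Algebras over generating cells\<close>

text \<open>Counting along edges: sums over sources and over targets agree because the wiring is a bijection. These two
  decompositions turn that into a balance between the inputs and outputs of a graph and those of its vertices.\<close>
lemma sum_sources:
  fixes f :: "source \<Rightarrow> nat"
  shows "sum f (sources C g) =
    (\<Sum>i<inputs g. f (ExtIn i)) + (\<Sum>v<verts g. \<Sum>j<cout C (fst (deco g v)). f (VertOut v j))"
proof -
  have S: "sources C g = ExtIn ` {..<inputs g} \<union>
      (\<lambda>(v, j). VertOut v j) ` (SIGMA v : {..<verts g}. {..<cout C (fst (deco g v))})"
    by (force simp: sources_def)
  have "sum f (ExtIn ` {..<inputs g}) = (\<Sum>i<inputs g. f (ExtIn i))"
    by (subst sum.reindex) (auto simp: inj_on_def)
  moreover have "sum f ((\<lambda>(v, j). VertOut v j) ` (SIGMA v : {..<verts g}. {..<cout C (fst (deco g v))})) =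
      (\<Sum>v<verts g. \<Sum>j<cout C (fst (deco g v)). f (VertOut v j))"
    by (subst sum.reindex) (auto simp: inj_on_def sum.Sigma split_def)
  ultimately show ?thesis
    unfolding S by (subst sum.union_disjoint) auto
qed

lemma sum_targets:
  fixes f :: "target \<Rightarrow> nat"
  shows "sum f (targets C g) =
    (\<Sum>j<outputs g. f (ExtOut j)) + (\<Sum>v<verts g. \<Sum>i<cin C (fst (deco g v)). f (VertIn v i))"
proof -
  have S: "targets C g = ExtOut ` {..<outputs g} \<union>
      (\<lambda>(v, j). VertIn v j) ` (SIGMA v : {..<verts g}. {..<cin C (fst (deco g v))})"
    by (force simp: targets_def)
  have "sum f (ExtOut ` {..<outputs g}) = (\<Sum>i<outputs g. f (ExtOut i))"
    by (subst sum.reindex) (auto simp: inj_on_def)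
  moreover have "sum f ((\<lambda>(v, j). VertIn v j) ` (SIGMA v : {..<verts g}. {..<cin C (fst (deco g v))})) =
      (\<Sum>v<verts g. \<Sum>j<cin C (fst (deco g v)). f (VertIn v j))"
    by (subst sum.reindex) (auto simp: inj_on_def sum.Sigma split_def)
  ultimately show ?thesis
    unfolding S by (subst sum.union_disjoint) auto
qed


text \<open>The data of an algebra on the space \<open>X\<close>, given on generating cells only: every cell acts by a cellular
  map which is continuous in its parameters as well, compatibly with the attaching maps and relations \<open>R\<close>.
  The space is compact Hausdorff so that products with its powers preserve quotient maps.\<close>
locale cell_algebra =
  fixes C :: "'c cells" and R :: "'c graph \<Rightarrow> 'c graph \<Rightarrow> bool"
    and X :: "'x cw_space" and F :: "'c dec \<Rightarrow> (nat \<Rightarrow> 'x) \<Rightarrow> nat \<Rightarrow> 'x"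
  assumes compact_X: "compact_space (cw_top X)"
    and Hausdorff_X: "Hausdorff_space (cw_top X)"
    and continuous_F: "continuous_map (prod_topology (cube (cdim C c)) (cw_top (cw_power X (cin C c))))
      (cw_top (cw_power X (cout C c))) (\<lambda>(s, y). F (c, s) y)"
    and cellular_F: "\<lbrakk>b \<in> topspace (gen_top C); y \<in> cw_skel (cw_power X (cin C (fst b))) k\<rbrakk> \<Longrightarrow>
      F b y \<in> cw_skel (cw_power X (cout C (fst b))) (dec_dim C b + k)"
    and relations_F: "\<lbrakk>g \<in> graphs C n m; h \<in> graphs C n m; R g h; x \<in> cw_points (cw_power X n)\<rbrakk> \<Longrightarrow>
      eval_graph C F g x = eval_graph C F h x"
begin

lemma F_closed:
  assumes "b \<in> topspace (gen_top C)" "y \<in> {..<cin C (fst b)} \<rightarrow>\<^sub>E cw_points X"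
  shows "F b y \<in> {..<cout C (fst b)} \<rightarrow>\<^sub>E cw_points X"
proof -
  obtain c s where b: "b = (c, s)"
    by fastforce
  have "(s, y) \<in> topspace (prod_topology (cube (cdim C c)) (cw_top (cw_power X (cin C c))))"
    using assms by (simp add: b topspace_gen_top)
  then have "F (c, s) y \<in> cw_points (cw_power X (cout C c))"
    using continuous_map_image_subset_topspace[OF continuous_F[of c]] by blast
  then show ?thesis
    by (simp add: b)
qed

lemma eval_graph_closed:
  assumes "g \<in> graphs C n m" "x \<in> {..<n} \<rightarrow>\<^sub>E cw_points X"
  shows "eval_graph C F g x \<in> {..<m} \<rightarrow>\<^sub>E cw_points X"
  using eval_graph_PiE(2)[OF assms(1) F_closed assms(2)] .

lemma eval_identified:
  assumes "identified C R g h" "g \<in> graphs C n m" "x \<in> {..<n} \<rightarrow>\<^sub>E cw_points X"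
  shows "eval_graph C F g x = eval_graph C F h x"
proof (rule eval_graph_identified[OF F_closed _ assms(1)])
  show "x \<in> {..<inputs g} \<rightarrow>\<^sub>E cw_points X"
    using assms(2,3) graphsD(1) by metis
qed (use relations_F in auto)

text \<open>Induction along the edges of one graph of the piece, which is legitimate since all graphs of the piece have
  the same edges. Passing through a vertex composes with the continuous action of its cell.\<close>
lemma continuous_valuation_of:
  assumes g: "g \<in> graphs C n m" "g \<in> cell_piece S c" and s: "s \<in> sources C g"
  shows "continuous_map
    (prod_topology (subtopology (cw_top (graph_space C n m)) (cell_piece S c)) (cw_top (cw_power X n)))
    (cw_top X) (\<lambda>p. valuation_of C F (fst p) (snd p) s)"
    (is "continuous_map ?Z _ _")
  using g(1) s
proof (induction rule: source_induct)
  case (ext i)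
  have "continuous_map ?Z (cw_top X) ((\<lambda>x. x i) \<circ> snd)"
    using ext continuous_map_product_projection[of i "{..<n}" "\<lambda>_. cw_top X"]
    by (intro continuous_map_compose[OF continuous_map_snd]) (simp add: cw_power_def)
  then show ?case
  proof (rule continuous_map_eq)
    fix p assume "p \<in> topspace ?Z"
    then have h: "fst p \<in> graphs C n m"
      by (simp add: mem_Times_iff)
    show "((\<lambda>x. x i) \<circ> snd) p = valuation_of C F (fst p) (snd p) (ExtIn i)"
      using valuationD(1)[OF valuation_valuation_of[OF h, of F "snd p"], of i] graphsD(1)[OF h] ext by simp
  qed
next
  case (vert v j)
  have S: "fst g = S" and c: "fst (deco g v) = c v"
    using g(2) vert(1) by (auto simp: cell_piece_def)
  let ?in = "\<lambda>p. \<lambda>i\<in>{..<cin C (c v)}. valuation_of C F (fst p) (snd p) (wire S (VertIn v i))"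
  have "continuous_map ?Z (cube (cdim C (c v))) ((\<lambda>g. snd (deco g v)) \<circ> fst)"
    using vert(1) S by (intro continuous_map_compose[OF continuous_map_fst] continuous_map_deco) simp
  moreover have "continuous_map ?Z (cw_top (cw_power X (cin C (c v)))) ?in"
    unfolding cw_power_def[of X "cin C (c v)"] cw_space.simps continuous_map_componentwise
  proof (intro conjI ballI)
    fix i assume "i \<in> {..<cin C (c v)}"
    then show "continuous_map ?Z (cw_top X) (\<lambda>p. ?in p i)"
      using vert(3)[of i] S c by simp
  qed auto
  ultimately have "continuous_map ?Z (prod_topology (cube (cdim C (c v))) (cw_top (cw_power X (cin C (c v)))))
      (\<lambda>p. (snd (deco (fst p) v), ?in p))"
    by (intro continuous_map_pairedI) (simp_all add: o_def)
  then have "continuous_map ?Z (cw_top (cw_power X (cout C (c v))))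
      ((\<lambda>(s, y). F (c v, s) y) \<circ> (\<lambda>p. (snd (deco (fst p) v), ?in p)))"
    by (rule continuous_map_compose[OF _ continuous_F])
  then have "continuous_map ?Z (cw_top X)
      ((\<lambda>y. y j) \<circ> ((\<lambda>(s, y). F (c v, s) y) \<circ> (\<lambda>p. (snd (deco (fst p) v), ?in p))))"
    by (rule continuous_map_compose)
       (use vert(2) c continuous_map_product_projection[of j "{..<cout C (c v)}" "\<lambda>_. cw_top X"] in
        \<open>simp add: cw_power_def\<close>)
  then show ?case
  proof (rule continuous_map_eq)
    fix p assume p: "p \<in> topspace ?Z"
    then have h: "fst p \<in> graphs C n m" "fst (fst p) = S" "fst (deco (fst p) v) = c v"
      using vert(1) S by (auto simp: cell_piece_def)
    then have "(c v, snd (deco (fst p) v)) = deco (fst p) v"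
      by (metis prod.collapse)
    then show "((\<lambda>y. y j) \<circ> ((\<lambda>(s, y). F (c v, s) y) \<circ> (\<lambda>p. (snd (deco (fst p) v), ?in p)))) p =
        valuation_of C F (fst p) (snd p) (VertOut v j)"
      using valuationD(2)[OF valuation_valuation_of[OF h(1)], of v j F "snd p"] h vert(1,2) S c by simp
  qed
qed

text \<open>The pieces form an open cover of the space of graphs.\<close>
lemma continuous_eval_graph:
  "continuous_map (prod_topology (cw_top (graph_space C n m)) (cw_top (cw_power X n)))
    (cw_top (cw_power X m)) (\<lambda>p. eval_graph C F (fst p) (snd p))"
proof (rule pasting_lemma[where I = UNIV
      and T = "\<lambda>(S, c). (graphs C n m \<inter> cell_piece S c) \<times> cw_points (cw_power X n)"])
  let ?Y = "cw_top (cw_power X n)" and ?G = "cw_top (graph_space C n m)"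
  let ?T = "\<lambda>(S, c). (graphs C n m \<inter> cell_piece S c) \<times> cw_points (cw_power X n)"
  show "openin (prod_topology ?G ?Y) (?T Sc)" for Sc
    by (cases Sc) (simp only: openin_prod_Times_iff openin_cell_piece openin_topspace split_conv simp_thms)
  show "continuous_map (subtopology (prod_topology ?G ?Y) (?T Sc))
      (cw_top (cw_power X m)) (\<lambda>p. eval_graph C F (fst p) (snd p))" for Sc
  proof -
    obtain S c where Sc: "Sc = (S, c)"
      by fastforce
    let ?Z = "prod_topology (subtopology ?G (cell_piece S c)) ?Y"
    have Z: "subtopology (prod_topology ?G ?Y) (?T Sc) = ?Z"
    proof -
      have "subtopology ?G (graphs C n m \<inter> cell_piece S c) = subtopology ?G (cell_piece S c)"
        using subtopology_restrict[of ?G "cell_piece S c"] by simp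
      then show ?thesis
        unfolding Sc split_conv subtopology_Times subtopology_topspace by simp
    qed
    have "continuous_map ?Z (cw_top (cw_power X m))
        (\<lambda>p. \<lambda>j\<in>{..<m}. valuation_of C F (fst p) (snd p) (wire S (ExtOut j)))"
      unfolding cw_power_def[of X m] cw_space.simps continuous_map_componentwise
    proof (intro conjI ballI)
      fix j assume j: "j \<in> {..<m}"
      show "continuous_map ?Z (cw_top X)
        (\<lambda>p. (\<lambda>j\<in>{..<m}. valuation_of C F (fst p) (snd p) (wire S (ExtOut j))) j)"
      proof (cases "topspace ?Z = {}")
        case True
        then show ?thesis
          by (simp only: null_topspace_iff_trivial continuous_map_on_empty)
      next
        case False
        then obtain g where g: "g \<in> graphs C n m" "g \<in> cell_piece S c"
          by auto
        then have "wire S (ExtOut j) \<in> sources C g"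
          using wiring_mem_sources[OF g(1), of "ExtOut j"] graphsD(2)[OF g(1)] j by (simp add: cell_piece_def)
        then show ?thesis
          using continuous_valuation_of[OF g] j by simp
      qed
    qed auto
    then show ?thesis
      unfolding Z
      by (rule continuous_map_eq) (auto simp: eval_graph_def cell_piece_def dest: graphsD(2))
  qed
  show "\<exists>Sc. Sc \<in> UNIV \<and> p \<in> ?T Sc \<and> eval_graph C F (fst p) (snd p) = eval_graph C F (fst p) (snd p)"
    if "p \<in> topspace (prod_topology ?G ?Y)" for p
    using that by (intro exI[of _ "(fst (fst p), \<lambda>v. fst (deco (fst p) v))"]) (simp add: cell_piece_def mem_Times_iff)
qed simp

text \<open>Attach to every edge a dimension of a skeleton containing its value. Cellularity of the cells allows these
  dimensions to be chosen such that at every vertex the outgoing ones sum to at most the incoming ones plus the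
  dimension of the decoration. Summing over all vertices, the contributions of inner edges cancel.

  The choice is made by evaluating the graph in pairs of a point and a dimension.\<close>
lemma cellular_eval_graph:
  assumes g: "g \<in> cw_skel (graph_space C n m) k" and x: "x \<in> cw_skel (cw_power X n) l"
  shows "eval_graph C F g x \<in> cw_skel (cw_power X m) (k + l)"
proof -
  have gg: "g \<in> graphs C n m" and k: "(\<Sum>v<verts g. dec_dim C (deco g v)) \<le> k"
    using g by (auto simp: graph_space_def)
  note gs = graphsD[OF gg]
  obtain e where xX: "x \<in> {..<n} \<rightarrow>\<^sub>E cw_points X" and e: "\<And>i. i < n \<Longrightarrow> x i \<in> cw_skel X (e i)" "(\<Sum>i<n. e i) \<le> l"
    using x by (auto simp: cw_power_def)
  define good where "good b z e' \<longleftrightarrow>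
      (\<forall>j<cout C (fst b). F b (\<lambda>i\<in>{..<cin C (fst b)}. fst (z i)) j \<in> cw_skel X (e' j)) \<and>
      (\<Sum>j<cout C (fst b). e' j) \<le> dec_dim C b + (\<Sum>i<cin C (fst b). snd (z i))" for b and z :: "nat \<Rightarrow> 'x \<times> nat" and e'
  define G where "G b z j = (F b (\<lambda>i\<in>{..<cin C (fst b)}. fst (z i)) j, (SOME e'. good b z e') j)" for b z j
  have good: "good b z (SOME e'. good b z e')"
    if "b \<in> topspace (gen_top C)" "\<And>i. i < cin C (fst b) \<Longrightarrow> fst (z i) \<in> cw_points X \<and> fst (z i) \<in> cw_skel X (snd (z i))" for b z
  proof -
    have "(\<lambda>i\<in>{..<cin C (fst b)}. fst (z i)) \<in> cw_skel (cw_power X (cin C (fst b))) (\<Sum>i<cin C (fst b). snd (z i))"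
      using that(2) by (auto simp: cw_power_def intro!: exI[of _ "\<lambda>i. snd (z i)"])
    from cellular_F[OF that(1) this] have "\<exists>e'. good b z e'"
      by (auto simp: cw_power_def good_def)
    then show ?thesis
      by (rule someI_ex)
  qed
  define W where "W = valuation_of C G g (\<lambda>i. (x i, e i))"
  have W: "valuation C G g (\<lambda>i. (x i, e i)) W"
    unfolding W_def by (rule valuation_valuation_of[OF gg])
  have val: "valuation C F g x (\<lambda>s. fst (W s))"
  proof (rule valuationI)
    fix v j assume v: "v < verts g" and j: "j < cout C (fst (deco g v))"
    have "(\<lambda>i\<in>{..<cin C (fst (deco g v))}. fst ((\<lambda>i\<in>{..<cin C (fst (deco g v))}. W (wiring g (VertIn v i))) i)) =
        (\<lambda>i\<in>{..<cin C (fst (deco g v))}. fst (W (wiring g (VertIn v i))))"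
      by (intro restrict_ext) simp
    then show "fst (W (VertOut v j)) = F (deco g v) (\<lambda>i\<in>{..<cin C (fst (deco g v))}. fst (W (wiring g (VertIn v i)))) j"
      using valuationD(2)[OF W v j] by (simp add: G_def)
  qed (use valuationD(1)[OF W] in simp)
  have pts: "fst (W s) \<in> cw_points X" if "s \<in> sources C g" for s
    using eval_graph_PiE(1)[OF gg F_closed xX that] valuation_unique[OF gg val valuation_valuation_of[OF gg] that]
    by simp
  have dv: "deco g v \<in> topspace (gen_top C)" if "v < verts g" for v
    using gs(3) that by (auto simp: PiE_iff)
  have skel: "fst (W s) \<in> cw_skel X (snd (W s))" if "s \<in> sources C g" for s
    using gg that
  proof (induction rule: source_induct)
    case (ext i)
    then show ?case
      using valuationD(1)[OF W, of i] gs(1) e(1) by simp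
  next
    case (vert v j)
    let ?z = "\<lambda>i\<in>{..<cin C (fst (deco g v))}. W (wiring g (VertIn v i))"
    have "good (deco g v) ?z (SOME e'. good (deco g v) ?z e')"
      using vert pts wiring_mem_sources[OF gg, of "VertIn v _"] by (intro good dv) auto
    then show ?case
      using valuationD(2)[OF W vert(1,2)] vert(2) by (simp add: G_def good_def)
  qed
  have vertex: "(\<Sum>j<cout C (fst (deco g v)). snd (W (VertOut v j))) \<le>
      dec_dim C (deco g v) + (\<Sum>i<cin C (fst (deco g v)). snd (W (wiring g (VertIn v i))))" if v: "v < verts g" for v
  proof -
    let ?z = "\<lambda>i\<in>{..<cin C (fst (deco g v))}. W (wiring g (VertIn v i))"
    have "good (deco g v) ?z (SOME e'. good (deco g v) ?z e')"
      using v pts skel wiring_mem_sources[OF gg, of "VertIn v _"] by (intro good dv) auto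
    then show ?thesis
      using valuationD(2)[OF W v] by (simp add: G_def good_def)
  qed
  \<comment> \<open>every edge has one source and one target, so the contributions of inner edges to the two sums cancel\<close>
  have "(\<Sum>t\<in>targets C g. snd (W (wiring g t))) = (\<Sum>s\<in>sources C g. snd (W s))"
    by (rule sum.reindex_bij_betw[OF gs(4)])
  moreover have "(\<Sum>v<verts g. \<Sum>j<cout C (fst (deco g v)). snd (W (VertOut v j))) \<le>
      (\<Sum>v<verts g. dec_dim C (deco g v)) + (\<Sum>v<verts g. \<Sum>i<cin C (fst (deco g v)). snd (W (wiring g (VertIn v i))))"
    unfolding sum.distrib[symmetric] by (intro sum_mono vertex) simp
  moreover have "(\<Sum>i<n. snd (W (ExtIn i))) = (\<Sum>i<n. e i)"
    using valuationD(1)[OF W] gs(1) by simp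
  ultimately have "(\<Sum>j<m. snd (W (wiring g (ExtOut j)))) \<le> k + l"
    using k e(2) by (simp add: sum_sources sum_targets gs(1,2))
  moreover have "fst (W (wiring g (ExtOut j))) \<in> cw_skel X (snd (W (wiring g (ExtOut j))))" if "j < m" for j
    using skel wiring_mem_sources[OF gg, of "ExtOut j"] gs(2) that by simp
  moreover have "eval_graph C F g x \<in> {..<m} \<rightarrow>\<^sub>E cw_points X"
    by (rule eval_graph_closed[OF gg xX])
  ultimately show ?thesis
    unfolding eval_graph_eq[OF gg val]
    by (auto simp: cw_power_def intro!: exI[of _ "\<lambda>j. snd (W (wiring g (ExtOut j)))"])
qed

definition action :: "nat \<Rightarrow> nat \<Rightarrow> 'c graph set \<times> (nat \<Rightarrow> 'x) \<Rightarrow> nat \<Rightarrow> 'x" where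
  "action n m = (\<lambda>p\<in>cw_points (Hom (presented_prop C R) n m) \<times> cw_points (cw_power X n).
     eval_graph C F (SOME g. g \<in> fst p) (snd p))"

lemma action_gclass:
  assumes g: "g \<in> graphs C n m" and x: "x \<in> {..<n} \<rightarrow>\<^sub>E cw_points X"
  shows "action n m (gclass C R g, x) = eval_graph C F g x"
proof -
  have "identified C R g (SOME h. h \<in> gclass C R g)"
    using identified_refl[OF g] by (metis mem_Collect_eq someI_ex)
  then show ?thesis
    using eval_identified[OF _ g x] g x by (simp add: action_def cw_points_Hom)
qed

text \<open>The map on graphs descends to classes. Its continuity descends too because the quotient map stays a quotient
  map after taking the product with the compact Hausdorff space \<open>X\<^sup>n\<close>.\<close>
lemma cw_map_action:
  "cw_map (cw_prod (Hom (presented_prop C R) n m) (cw_power X n)) (cw_power X m) (action n m)"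
  unfolding cw_map_def
proof (intro conjI allI)
  let ?P = "Hom (presented_prop C R) n m" and ?Y = "cw_top (cw_power X n)"
  have "compact_space ?Y" "Hausdorff_space ?Y"
    using compact_X Hausdorff_X
    by (simp_all add: cw_power_def compact_space_product_topology Hausdorff_space_product_topology)
  then have q: "quotient_map (prod_topology (cw_top (graph_space C n m)) ?Y) (prod_topology (cw_top ?P) ?Y)
      (\<lambda>(g, x). (gclass C R g, x))"
    by (intro quotient_map_prod_left compact_imp_locally_compact_space quotient_map_gclass) auto
  have "continuous_map (prod_topology (cw_top (graph_space C n m)) ?Y) (cw_top (cw_power X m))
      (action n m \<circ> (\<lambda>(g, x). (gclass C R g, x)))"
  proof (rule continuous_map_eq[OF continuous_eval_graph])
    fix p assume "p \<in> topspace (prod_topology (cw_top (graph_space C n m)) ?Y)"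
    then show "eval_graph C F (fst p) (snd p) = (action n m \<circ> (\<lambda>(g, x). (gclass C R g, x))) p"
      by (cases p) (simp add: action_gclass)
  qed
  from continuous_compose_quotient_map[OF q this]
  show "continuous_map (cw_top (cw_prod ?P (cw_power X n))) (cw_top (cw_power X m)) (action n m)"
    by (simp add: cw_prod_def)
  show "action n m ` cw_skel (cw_prod ?P (cw_power X n)) k \<subseteq> cw_skel (cw_power X m) k" for k
  proof (rule image_subsetI)
    fix p assume "p \<in> cw_skel (cw_prod ?P (cw_power X n)) k"
    then obtain i g x where p: "p = (gclass C R g, x)" "i \<le> k" "g \<in> cw_skel (graph_space C n m) i"
      "x \<in> cw_skel (cw_power X n) (k - i)"
      by (auto simp: cw_prod_def cw_skel_Hom)
    moreover have "g \<in> graphs C n m" "x \<in> {..<n} \<rightarrow>\<^sub>E cw_points X"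
      using p(3,4) by (auto simp: graph_space_def cw_power_def)
    ultimately show "action n m p \<in> cw_skel (cw_power X m) k"
      using cellular_eval_graph[OF p(3,4)] by (simp add: action_gclass)
  qed
qed

text \<open>Every axiom is the compatibility of evaluation with one operation on graphs.\<close>
lemma is_bialgebra_action: "is_bialgebra (presented_prop C R) X action"
  unfolding is_bialgebra_def cw_points_Hom cw_points_cw_power
proof (intro conjI allI ballI impI)
  show "action n m \<in> extensional (gclass C R ` graphs C n m \<times> ({..<n} \<rightarrow>\<^sub>E cw_points X))" for n m
    by (simp add: action_def cw_points_Hom)
  show "cw_map (cw_prod (Hom (presented_prop C R) n m) (cw_power X n)) (cw_power X m) (action n m)" for n m
    by (rule cw_map_action)
  show "action n n (ident (presented_prop C R) n, x) = x" if "x \<in> {..<n} \<rightarrow>\<^sub>E cw_points X" for n x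
    using that by (simp add: ident_presented_prop action_gclass[OF g_ident_graphs] eval_g_ident PiE_iff)
next
  fix n m l p q x
  assume "p \<in> gclass C R ` graphs C n m" "q \<in> gclass C R ` graphs C m l" and x: "x \<in> {..<n} \<rightarrow>\<^sub>E cw_points X"
  then obtain g h where gh: "p = gclass C R g" "q = gclass C R h" "g \<in> graphs C n m" "h \<in> graphs C m l"
    by auto
  show "action n l (vcomp (presented_prop C R) q p, x) = action m l (q, action n m (p, x))"
    using gh x by (simp add: vcomp_gclass action_gclass[OF g_vcomp_graphs[OF gh(3,4)]] action_gclass
        eval_graph_closed eval_g_vcomp[OF gh(3,4)])
next
  fix n m n' m' p q x y
  assume "p \<in> gclass C R ` graphs C n m" "q \<in> gclass C R ` graphs C n' m'"
    and x: "x \<in> {..<n} \<rightarrow>\<^sub>E cw_points X" and y: "y \<in> {..<n'} \<rightarrow>\<^sub>E cw_points X"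
  then obtain g h where gh: "p = gclass C R g" "q = gclass C R h" "g \<in> graphs C n m" "h \<in> graphs C n' m'"
    by auto
  show "action (n + n') (m + m') (hcomp (presented_prop C R) p q, tuple_append n n' x y) =
      tuple_append m m' (action n m (p, x)) (action n' m' (q, y))"
    using gh x y by (simp add: hcomp_gclass action_gclass[OF g_hcomp_graphs[OF gh(3,4)]] action_gclass
        tuple_append_PiE eval_g_hcomp[OF gh(3,4)])
next
  fix n m \<sigma> p x
  assume "p \<in> gclass C R ` graphs C n m" and x: "x \<in> {..<n} \<rightarrow>\<^sub>E cw_points X" and \<sigma>: "\<sigma> permutes {..<m}"
  then obtain g where g: "p = gclass C R g" "g \<in> graphs C n m"
    by auto
  show "action n m (lact (presented_prop C R) \<sigma> p, x) = tuple_perm m \<sigma> (action n m (p, x))"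
    using g x \<sigma> by (simp add: lact_gclass action_gclass[OF g_lact_graphs[OF g(2) \<sigma>]] action_gclass
        eval_g_lact[OF g(2) \<sigma>])
next
  fix n m \<tau> p x
  assume "p \<in> gclass C R ` graphs C n m" and x: "x \<in> {..<n} \<rightarrow>\<^sub>E cw_points X" and \<tau>: "\<tau> permutes {..<n}"
  then obtain g where g: "p = gclass C R g" "g \<in> graphs C n m"
    by auto
  have "tuple_perm n \<tau> x \<in> {..<n} \<rightarrow>\<^sub>E cw_points X"
    using x permutes_inv_less[OF \<tau>] by (auto simp: tuple_perm_def PiE_iff)
  then show "action n m (ract (presented_prop C R) p \<tau>, x) = action n m (p, tuple_perm n \<tau> x)"
    using g x \<tau> by (simp add: ract_gclass action_gclass[OF g_ract_graphs[OF g(2) \<tau>]] action_gclass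
        eval_g_ract[OF g(2) \<tau>])
qed

lemma action_corolla:
  assumes b: "b \<in> topspace (gen_top C)" and y: "y \<in> {..<cin C (fst b)} \<rightarrow>\<^sub>E cw_points X"
  shows "action (cin C (fst b)) (cout C (fst b)) (gclass C R (g_corolla C b), y) = F b y"
  using F_closed[OF b y] y eval_g_corolla[OF b, of y F] action_gclass[OF g_corolla_graphs[OF b] y]
  by (simp add: PiE_iff)

end


section \<open>Uniqueness of bialgebra structures\<close>

lemma is_bialgebraD:
  assumes "is_bialgebra P X \<Phi>"
  shows "\<Phi> n m \<in> extensional (cw_points (Hom P n m) \<times> cw_points (cw_power X n))"
    and "cw_map (cw_prod (Hom P n m) (cw_power X n)) (cw_power X m) (\<Phi> n m)"
    and "x \<in> cw_points (cw_power X n) \<Longrightarrow> \<Phi> n n (ident P n, x) = x"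
    and "\<lbrakk>p \<in> cw_points (Hom P n m); q \<in> cw_points (Hom P m l); x \<in> cw_points (cw_power X n)\<rbrakk> \<Longrightarrow>
      \<Phi> n l (vcomp P q p, x) = \<Phi> m l (q, \<Phi> n m (p, x))"
    and "\<lbrakk>p \<in> cw_points (Hom P n m); q' \<in> cw_points (Hom P n' m');
      x \<in> cw_points (cw_power X n); y \<in> cw_points (cw_power X n')\<rbrakk> \<Longrightarrow>
      \<Phi> (n + n') (m + m') (hcomp P p q', tuple_append n n' x y) =
      tuple_append m m' (\<Phi> n m (p, x)) (\<Phi> n' m' (q', y))"
    and "\<lbrakk>p \<in> cw_points (Hom P n m); x \<in> cw_points (cw_power X n); \<sigma> permutes {..<m}\<rbrakk> \<Longrightarrow>
      \<Phi> n m (lact P \<sigma> p, x) = tuple_perm m \<sigma> (\<Phi> n m (p, x))"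
proof -
  note a = assms[unfolded is_bialgebra_def]
  note a1 = conjunct1[OF a] and b1 = conjunct2[OF a]
  note a2 = conjunct1[OF b1] and b2 = conjunct2[OF b1]
  note a3 = conjunct1[OF b2] and b3 = conjunct2[OF b2]
  note a4 = conjunct1[OF b3] and b4 = conjunct2[OF b3]
  note a5 = conjunct1[OF b4]
  show "\<Phi> n m \<in> extensional (cw_points (Hom P n m) \<times> cw_points (cw_power X n))"
    and "cw_map (cw_prod (Hom P n m) (cw_power X n)) (cw_power X m) (\<Phi> n m)"
    using a1 by simp_all
  show "x \<in> cw_points (cw_power X n) \<Longrightarrow> \<Phi> n n (ident P n, x) = x"
    using a2 by simp
  show "\<lbrakk>p \<in> cw_points (Hom P n m); q \<in> cw_points (Hom P m l); x \<in> cw_points (cw_power X n)\<rbrakk> \<Longrightarrow>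
      \<Phi> n l (vcomp P q p, x) = \<Phi> m l (q, \<Phi> n m (p, x))"
    using a3 by blast
  show "\<lbrakk>p \<in> cw_points (Hom P n m); q' \<in> cw_points (Hom P n' m');
      x \<in> cw_points (cw_power X n); y \<in> cw_points (cw_power X n')\<rbrakk> \<Longrightarrow>
      \<Phi> (n + n') (m + m') (hcomp P p q', tuple_append n n' x y) =
      tuple_append m m' (\<Phi> n m (p, x)) (\<Phi> n' m' (q', y))"
    using a4 by blast
  show "\<lbrakk>p \<in> cw_points (Hom P n m); x \<in> cw_points (cw_power X n); \<sigma> permutes {..<m}\<rbrakk> \<Longrightarrow>
      \<Phi> n m (lact P \<sigma> p, x) = tuple_perm m \<sigma> (\<Phi> n m (p, x))"
    using a5 by blast
qed

text \<open>A bialgebra structure is determined by the generating cells, since these generate the prop.\<close>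
lemma bialgebra_eqI:
  assumes \<Phi>: "is_bialgebra (presented_prop C R) X \<Phi>" and \<Psi>: "is_bialgebra (presented_prop C R) X \<Psi>"
    and corolla: "\<And>b y. \<lbrakk>b \<in> topspace (gen_top C); y \<in> {..<cin C (fst b)} \<rightarrow>\<^sub>E cw_points X\<rbrakk> \<Longrightarrow>
      \<Phi> (cin C (fst b)) (cout C (fst b)) (gclass C R (g_corolla C b), y) =
      \<Psi> (cin C (fst b)) (cout C (fst b)) (gclass C R (g_corolla C b), y)"
  shows "\<Phi> = \<Psi>"
proof -
  let ?agree = "\<lambda>g. \<forall>x \<in> {..<inputs g} \<rightarrow>\<^sub>E cw_points X.
    \<Phi> (inputs g) (outputs g) (gclass C R g, x) = \<Psi> (inputs g) (outputs g) (gclass C R g, x)"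
  have id: "\<Theta> n n (gclass C R (g_ident n), x) = x"
    if "is_bialgebra (presented_prop C R) X \<Theta>" "x \<in> {..<n} \<rightarrow>\<^sub>E cw_points X" for \<Theta> n x
    using is_bialgebraD(3)[OF that(1), of x n] that(2) by (simp add: ident_presented_prop)
  have closed: "\<Theta> n m (gclass C R g, x) \<in> {..<m} \<rightarrow>\<^sub>E cw_points X"
    if "is_bialgebra (presented_prop C R) X \<Theta>" "g \<in> graphs C n m" "x \<in> {..<n} \<rightarrow>\<^sub>E cw_points X" for \<Theta> n m g x
  proof -
    have "continuous_map (cw_top (cw_prod (Hom (presented_prop C R) n m) (cw_power X n))) (cw_top (cw_power X m)) (\<Theta> n m)"
      using is_bialgebraD(2)[OF that(1), of n m] by (simp add: cw_map_def)
    from continuous_map_image_subset_topspace[OF this]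
    have "\<Theta> n m ` (gclass C R ` graphs C n m \<times> ({..<n} \<rightarrow>\<^sub>E cw_points X)) \<subseteq> {..<m} \<rightarrow>\<^sub>E cw_points X"
      by (simp add: cw_prod_def cw_points_Hom)
    then show ?thesis
      using that(2,3) by blast
  qed
  have vc: "\<Theta> n l (gclass C R (g_vcomp h g), x) = \<Theta> m l (gclass C R h, \<Theta> n m (gclass C R g, x))"
    if "is_bialgebra (presented_prop C R) X \<Theta>" "g \<in> graphs C n m" "h \<in> graphs C m l" "x \<in> {..<n} \<rightarrow>\<^sub>E cw_points X"
    for \<Theta> n m l g h x
    using is_bialgebraD(4)[OF that(1), of "gclass C R g" n m "gclass C R h" l x] that(2-)
    by (simp add: cw_points_Hom vcomp_gclass)
  have hc: "\<Theta> (n + n') (m + m') (gclass C R (g_hcomp g h), tuple_append n n' x y) =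
      tuple_append m m' (\<Theta> n m (gclass C R g, x)) (\<Theta> n' m' (gclass C R h, y))"
    if "is_bialgebra (presented_prop C R) X \<Theta>" "g \<in> graphs C n m" "h \<in> graphs C n' m'"
      "x \<in> {..<n} \<rightarrow>\<^sub>E cw_points X" "y \<in> {..<n'} \<rightarrow>\<^sub>E cw_points X" for \<Theta> n m n' m' g h x y
    using is_bialgebraD(5)[OF that(1), of "gclass C R g" n m "gclass C R h" n' m' x y] that(2-)
    by (simp add: cw_points_Hom hcomp_gclass)
  have la: "\<Theta> n m (gclass C R (g_lact \<sigma> g), x) = tuple_perm m \<sigma> (\<Theta> n m (gclass C R g, x))"
    if "is_bialgebra (presented_prop C R) X \<Theta>" "g \<in> graphs C n m" "\<sigma> permutes {..<m}" "x \<in> {..<n} \<rightarrow>\<^sub>E cw_points X"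
    for \<Theta> n m \<sigma> g x
    using is_bialgebraD(6)[OF that(1), of "gclass C R g" n m x \<sigma>] that(2-)
    by (simp add: cw_points_Hom lact_gclass)
  have agree: "?agree g" if "g \<in> graphs C n m" for g n m
    using that
  proof (induction rule: graph_generation)
    case (iso g h n m)
    then have "gclass C R g = gclass C R h" "inputs h = inputs g" "outputs h = outputs g"
      using gclass_eq_iff[OF iso(1), of R h] identified.iso[OF iso(1-3)] graphsD by metis+
    then show ?case
      using iso(4) by simp
  next
    case (ident n)
    show ?case
      using id[OF \<Phi>] id[OF \<Psi>] by (simp add: g_ident_def)
  next
    case (corolla b)
    then show ?case
      using assms(3) graphsD(1,2)[OF g_corolla_graphs[OF corolla]] by simp
  next
    case (hcomp g h n m n' m')
    show ?case
    proof
      fix x assume "x \<in> {..<inputs (g_hcomp g h)} \<rightarrow>\<^sub>E cw_points X"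
      then have x: "x \<in> {..<n + n'} \<rightarrow>\<^sub>E cw_points X"
        using graphsD(1)[OF hcomp(1)] graphsD(1)[OF hcomp(2)] by simp
      define y where "y = (\<lambda>i\<in>{..<n}. x i)"
      define y' where "y' = (\<lambda>i\<in>{..<n'}. x (n + i))"
      have y: "y \<in> {..<n} \<rightarrow>\<^sub>E cw_points X" "y' \<in> {..<n'} \<rightarrow>\<^sub>E cw_points X"
        using x by (auto simp: y_def y'_def PiE_iff)
      have "x = tuple_append n n' y y'"
        using x by (auto simp: tuple_append_def y_def y'_def PiE_iff extensional_def fun_eq_iff)
      then show "\<Phi> (inputs (g_hcomp g h)) (outputs (g_hcomp g h)) (gclass C R (g_hcomp g h), x) =
          \<Psi> (inputs (g_hcomp g h)) (outputs (g_hcomp g h)) (gclass C R (g_hcomp g h), x)"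
        using hc[OF \<Phi> hcomp(1,2) y] hc[OF \<Psi> hcomp(1,2) y] hcomp(3,4) y
          graphsD(1,2)[OF hcomp(1)] graphsD(1,2)[OF hcomp(2)] by simp
    qed
  next
    case (vcomp g h n m l)
    then show ?case
      using vc[OF \<Phi> vcomp(1,2)] vc[OF \<Psi> vcomp(1,2)] closed[OF \<Phi> vcomp(1)]
        graphsD(1,2)[OF vcomp(1)] graphsD(1,2)[OF vcomp(2)] by simp
  next
    case (lact g n m \<sigma>)
    then show ?case
      using la[OF \<Phi> lact(1,2)] la[OF \<Psi> lact(1,2)] graphsD(1,2)[OF lact(1)]
        graphsD(1,2)[OF g_lact_graphs[OF lact(1,2)]] by simp
  qed
  have "\<Phi> n m = \<Psi> n m" for n m
  proof (rule extensionalityI)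
    let ?D = "gclass C R ` graphs C n m \<times> ({..<n} \<rightarrow>\<^sub>E cw_points X)"
    show "\<Phi> n m \<in> extensional ?D" "\<Psi> n m \<in> extensional ?D"
      using is_bialgebraD(1)[OF \<Phi>, of n m] is_bialgebraD(1)[OF \<Psi>, of n m] by (simp_all add: cw_points_Hom)
    fix p assume "p \<in> ?D"
    then show "\<Phi> n m p = \<Psi> n m p"
      using agree graphsD(1,2) by fastforce
  qed
  then show ?thesis
    by (intro ext) simp
qed


section \<open>The cells of the prop acting on simplices\<close>

text \<open>Written with minima and maxima, the maps on the interval are visibly monotone and continuous.\<close>
lemma fst_Delta_I: "fst (Delta_I x) = max 0 (2 * x - 1)"
  and snd_Delta_I: "snd (Delta_I x) = min 1 (2 * x)"
  by (auto simp: Delta_I_def)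

lemma phi_I_eq_min:
  assumes "s \<in> {0..1}"
  shows "phi_I s x = min 1 (2 * x / (2 - s))"
proof -
  have le: "2 * x / (2 - s) \<le> 1 \<longleftrightarrow> x \<le> (2 - s) / 2"
    using assms by (simp add: field_simps)
  show ?thesis
  proof (cases "x \<le> (2 - s) / 2")
    case True
    with le have "2 * x / (2 - s) \<le> 1"
      by blast
    then show ?thesis
      using True by (simp only: phi_I_def if_True min.absorb2)
  next
    case False
    with le have "1 \<le> 2 * x / (2 - s)"
      by linarith
    then show ?thesis
      using False by (simp only: phi_I_def if_False min.absorb1)
  qed
qed

text \<open>The operations of the four cells on one coordinate: \<open>t\<close> is the parameter of the cell, \<open>u\<close> the tuple of
  inputs and \<open>j\<close> the number of the output. The value for \<open>\<epsilon>\<close> is a dummy, as this cell has no outputs.\<close>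
definition interval_op :: "st_cell \<Rightarrow> real \<Rightarrow> nat \<Rightarrow> (nat \<Rightarrow> real) \<Rightarrow> real" where
  "interval_op c t j u = (case c of
      Eps_cell \<Rightarrow> 0
    | Delta_cell \<Rightarrow> if j = 0 then fst (Delta_I (u 0)) else snd (Delta_I (u 0))
    | Mu_cell \<Rightarrow> psi_I t (u 0) (u 1)
    | H_cell \<Rightarrow> phi_I t (u 0))"

definition simplex_op :: "nat \<Rightarrow> st_cell dec \<Rightarrow> (nat \<Rightarrow> nat \<Rightarrow> real) \<Rightarrow> nat \<Rightarrow> nat \<Rightarrow> real" where
  "simplex_op d b y =
     (\<lambda>j\<in>{..<cout st_cells (fst b)}. \<lambda>i\<in>{1..d}. interval_op (fst b) (snd b 0) j (\<lambda>k. y k i))"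

lemma topspace_cube [simp]: "topspace (cube d) = {..<d} \<rightarrow>\<^sub>E {0..1}"
  by (auto simp: cube_def PiE_iff)

lemma st_cells_simps [simp]:
  "cdim st_cells Eps_cell = 0" "cdim st_cells Delta_cell = 0" "cdim st_cells Mu_cell = 1" "cdim st_cells H_cell = 1"
  "cin st_cells Eps_cell = 1" "cin st_cells Delta_cell = 1" "cin st_cells Mu_cell = 2" "cin st_cells H_cell = 1"
  "cout st_cells Eps_cell = 0" "cout st_cells Delta_cell = 2" "cout st_cells Mu_cell = 1" "cout st_cells H_cell = 1"
  by (simp_all add: st_cells_def)

lemma interval_op_mono:
  assumes "cdim st_cells c = 1 \<Longrightarrow> t \<in> {0..1}" "\<And>k. k < cin st_cells c \<Longrightarrow> u k \<le> u' k"
  shows "interval_op c t j u \<le> interval_op c t j u'"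
proof (cases c)
  case Delta_cell
  then show ?thesis
    using assms(2)[of 0] by (simp add: interval_op_def fst_Delta_I snd_Delta_I min_def max_def)
next
  case Mu_cell
  then have "(1 - t) * u 0 \<le> (1 - t) * u' 0" "t * u 1 \<le> t * u' 1"
    using assms by (auto intro!: mult_left_mono)
  then show ?thesis
    using Mu_cell by (simp add: interval_op_def psi_I_def)
next
  case H_cell
  then have "2 * u 0 / (2 - t) \<le> 2 * u' 0 / (2 - t)"
    using assms by (auto intro!: divide_right_mono)
  then have "min 1 (2 * u 0 / (2 - t)) \<le> min 1 (2 * u' 0 / (2 - t))"
    by (rule min.mono[OF order_refl])
  then show ?thesis
    using H_cell assms(1) by (simp only: interval_op_def phi_I_eq_min st_cells_simps st_cell.case)
qed (simp add: interval_op_def)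

lemma interval_op_const:
  assumes "cdim st_cells c = 1 \<Longrightarrow> t \<in> {0..1}" "j < cout st_cells c"
  shows "interval_op c t j (\<lambda>_. 0) = 0" "interval_op c t j (\<lambda>_. 1) = 1"
  using assms by (cases c; auto simp: interval_op_def fst_Delta_I snd_Delta_I psi_I_def phi_I_eq_min min_def field_simps)+

lemma interval_op_unit:
  assumes "cdim st_cells c = 1 \<Longrightarrow> t \<in> {0..1}" "\<And>k. k < cin st_cells c \<Longrightarrow> u k \<in> {0..1}" "j < cout st_cells c"
  shows "interval_op c t j u \<in> {0..1}"
  using interval_op_mono[of c t "\<lambda>_. 0" u j] interval_op_mono[of c t u "\<lambda>_. 1" j]
    interval_op_const[OF assms(1,3)] assms(1,2) by simp

lemma simplex_pointsD:
  assumes "x \<in> simplex_points d"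
  shows "x \<in> {1..d} \<rightarrow>\<^sub>E {0..1}" "\<lbrakk>i \<in> {1..d}; j \<in> {1..d}; i \<le> j\<rbrakk> \<Longrightarrow> x i \<le> x j"
  using assms by (auto simp: simplex_points_def)

lemma cw_points_std_simplex [simp]: "cw_points (std_simplex d) = simplex_points d"
proof -
  have "simplex_points d \<subseteq> topspace (powertop_real {1..d})"
    using simplex_pointsD(1) by (fastforce simp: PiE_iff)
  then show ?thesis
    by (simp add: std_simplex_def Int_absorb1)
qed

text \<open>Monotone maps of the interval, applied to every coordinate, preserve the order of the coordinates.\<close>
lemma simplex_op_closed:
  assumes s: "s \<in> {..<cdim st_cells c} \<rightarrow>\<^sub>E {0..1}" and y: "y \<in> {..<cin st_cells c} \<rightarrow>\<^sub>E simplex_points d"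
  shows "simplex_op d (c, s) y \<in> {..<cout st_cells c} \<rightarrow>\<^sub>E simplex_points d"
proof -
  have t: "cdim st_cells c = 1 \<Longrightarrow> s 0 \<in> {0..1}"
    using PiE_mem[OF s, of 0] by simp
  have yk: "y k i \<in> {0..1}" "\<lbrakk>i' \<in> {1..d}; i \<le> i'\<rbrakk> \<Longrightarrow> y k i \<le> y k i'"
    if "k < cin st_cells c" "i \<in> {1..d}" for k i i'
  proof -
    have "y k \<in> simplex_points d"
      using PiE_mem[OF y] that(1) by simp
    from simplex_pointsD[OF this] show "y k i \<in> {0..1}" "\<lbrakk>i' \<in> {1..d}; i \<le> i'\<rbrakk> \<Longrightarrow> y k i \<le> y k i'"
      using that(2) by auto
  qed
  have "(\<lambda>i\<in>{1..d}. interval_op c (s 0) j (\<lambda>k. y k i)) \<in> simplex_points d" if j: "j < cout st_cells c" for j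
    unfolding simplex_points_def
  proof (intro CollectI conjI ballI impI)
    show "(\<lambda>i\<in>{1..d}. interval_op c (s 0) j (\<lambda>k. y k i)) \<in> {1..d} \<rightarrow>\<^sub>E {0..1}"
    proof -
      have "interval_op c (s 0) j (\<lambda>k. y k i) \<in> {0..1}" if i: "i \<in> {1..d}" for i
        using interval_op_unit[OF t _ j, where u = "\<lambda>k. y k i"] yk(1)[OF _ i] by blast
      then show ?thesis
        unfolding restrict_PiE_iff by blast
    qed
    fix i i' assume "i \<in> {1..d}" "i' \<in> {1..d}" "i \<le> i'"
    then show "(\<lambda>i\<in>{1..d}. interval_op c (s 0) j (\<lambda>k. y k i)) i \<le> (\<lambda>i\<in>{1..d}. interval_op c (s 0) j (\<lambda>k. y k i)) i'"
      using interval_op_mono[OF t, where u = "\<lambda>k. y k i" and u' = "\<lambda>k. y k i'"] yk(2) by simp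
  qed
  then show ?thesis
    by (simp add: simplex_op_def)
qed

lemma continuous_interval_op:
  assumes "cdim st_cells c = 1 \<Longrightarrow> continuous_map Z euclideanreal t"
    and "\<And>z. \<lbrakk>cdim st_cells c = 1; z \<in> topspace Z\<rbrakk> \<Longrightarrow> t z \<in> {0..1}"
    and "\<And>k. k < cin st_cells c \<Longrightarrow> continuous_map Z euclideanreal (\<lambda>z. u z k)"
  shows "continuous_map Z euclideanreal (\<lambda>z. interval_op c (t z) j (u z))"
proof (cases c)
  case Eps_cell
  then show ?thesis by (simp add: interval_op_def)
next
  case Delta_cell
  then show ?thesis
    using assms(3)[of 0]
    by (cases "j = 0") (auto simp: interval_op_def fst_Delta_I snd_Delta_I intro!: continuous_intros)
next
  case Mu_cell
  then show ?thesis
    using assms(1) assms(3)[of 0] assms(3)[of 1]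
    by (auto simp: interval_op_def psi_I_def intro!: continuous_intros)
next
  case H_cell
  have "continuous_map Z euclideanreal (\<lambda>z. min 1 (2 * u z 0 / (2 - t z)))"
    using H_cell assms(1) assms(2) assms(3)[of 0] by (intro continuous_intros) fastforce+
  then show ?thesis
    by (rule continuous_map_eq) (use H_cell assms(2) in \<open>simp add: interval_op_def phi_I_eq_min\<close>)
qed

lemma continuous_simplex_op:
  "continuous_map (prod_topology (cube (cdim st_cells c)) (cw_top (cw_power (std_simplex d) (cin st_cells c))))
    (cw_top (cw_power (std_simplex d) (cout st_cells c))) (\<lambda>(s, y). simplex_op d (c, s) y)"
    (is "continuous_map ?Z _ _")
proof -
  have Z: "topspace ?Z = ({..<cdim st_cells c} \<rightarrow>\<^sub>E {0..1}) \<times> ({..<cin st_cells c} \<rightarrow>\<^sub>E simplex_points d)"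
    by simp
  have s: "continuous_map ?Z euclideanreal (\<lambda>p. fst p 0)" if "cdim st_cells c = 1"
  proof -
    have "continuous_map (cube (cdim st_cells c)) euclideanreal (\<lambda>s. s 0)"
      unfolding cube_def using that
      by (intro continuous_map_from_subtopology continuous_map_product_projection) simp
    from continuous_map_compose[OF continuous_map_fst this] show ?thesis
      by (simp add: o_def)
  qed
  have y: "continuous_map ?Z euclideanreal (\<lambda>p. snd p k i)" if "k < cin st_cells c" "i \<in> {1..d}" for k i
  proof -
    have "continuous_map (cw_top (cw_power (std_simplex d) (cin st_cells c))) (cw_top (std_simplex d)) (\<lambda>y. y k)"
      unfolding cw_power_def cw_space.simps using that(1) by (intro continuous_map_product_projection) simp
    moreover have "continuous_map (cw_top (std_simplex d)) euclideanreal (\<lambda>x. x i)"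
      unfolding std_simplex_def cw_space.simps using that(2)
      by (intro continuous_map_from_subtopology continuous_map_product_projection)
    ultimately have "continuous_map (cw_top (cw_power (std_simplex d) (cin st_cells c))) euclideanreal ((\<lambda>x. x i) \<circ> (\<lambda>y. y k))"
      by (rule continuous_map_compose)
    from continuous_map_compose[OF continuous_map_snd this] show ?thesis
      by (simp add: o_def)
  qed
  have op: "continuous_map ?Z euclideanreal (\<lambda>p. interval_op c (fst p 0) j (\<lambda>k. snd p k i))" if "i \<in> {1..d}" for i j
  proof (rule continuous_interval_op)
    show "fst p 0 \<in> {0..1}" if "cdim st_cells c = 1" "p \<in> topspace ?Z" for p
      using that PiE_mem[of "fst p" "{..<cdim st_cells c}" "\<lambda>_. {0..1}" 0] unfolding Z mem_Times_iff by simp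
  qed (use s y that in auto)
  have closed: "simplex_op d (c, fst p) (snd p) \<in> {..<cout st_cells c} \<rightarrow>\<^sub>E simplex_points d" if "p \<in> topspace ?Z" for p
    using that unfolding Z by (intro simplex_op_closed) auto
  have "continuous_map ?Z (cw_top (cw_power (std_simplex d) (cout st_cells c))) (\<lambda>p. simplex_op d (c, fst p) (snd p))"
    unfolding cw_power_def[of _ "cout st_cells c"] cw_space.simps continuous_map_componentwise
  proof (intro conjI ballI)
    show "(\<lambda>p. simplex_op d (c, fst p) (snd p)) ` topspace ?Z \<subseteq> extensional {..<cout st_cells c}"
      by (auto simp: simplex_op_def)
    fix j assume j: "j \<in> {..<cout st_cells c}"
    have "continuous_map ?Z (powertop_real {1..d}) (\<lambda>p. simplex_op d (c, fst p) (snd p) j)"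
      unfolding continuous_map_componentwise using op j by (auto simp: simplex_op_def)
    then show "continuous_map ?Z (cw_top (std_simplex d)) (\<lambda>p. simplex_op d (c, fst p) (snd p) j)"
      unfolding std_simplex_def cw_space.simps
      by (rule continuous_map_into_subtopology) (use closed j in \<open>auto simp: std_simplex_def[symmetric]\<close>)
  qed
  then show ?thesis
    by (simp add: split_def)
qed


section \<open>Cellularity on simplices\<close>

abbreviation interior_values :: "nat \<Rightarrow> (nat \<Rightarrow> real) \<Rightarrow> real set" where
  "interior_values d x \<equiv> x ` {1..d} - {0, 1}"

lemma card_image_le_if_factors:
  assumes "finite J" "\<And>i j. \<lbrakk>i \<in> J; j \<in> J; r i = r j\<rbrakk> \<Longrightarrow> f i = f j"
  shows "card (f ` J) \<le> card (r ` J)"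
proof -
  have "f i = f (inv_into J r (r i))" if "i \<in> J" for i
    using assms(2)[of i "inv_into J r (r i)"] that by (simp add: inv_into_into f_inv_into_f)
  then have "f ` J \<subseteq> (\<lambda>t. f (inv_into J r t)) ` r ` J"
    by (auto simp: image_image)
  then show ?thesis
    using assms(1) by (meson card_image_le card_mono finite_imageI le_trans)
qed

text \<open>The one cell whose cellularity is not obvious. The pairs \<open>(x i, y i)\<close> form a chain in a grid whose sides have
  \<open>card (interior_values d x) + 2\<close> and \<open>card (interior_values d y) + 2\<close> points, the values \<open>0\<close> and \<open>1\<close>
  included. Along a chain the sum of the two grid coordinates, each counted from \<open>0\<close>, is injective, and its two
  extreme values belong to the corners \<open>(0, 0)\<close> and \<open>(1, 1)\<close>, where \<open>psi_I\<close> takes the values \<open>0\<close> and \<open>1\<close>.\<close>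
lemma card_interior_values_psi:
  assumes x: "x \<in> simplex_points d" and y: "y \<in> simplex_points d" and t: "0 < t" "t < 1"
  shows "card (interior_values d (\<lambda>i. psi_I t (x i) (y i))) \<le>
    1 + card (interior_values d x) + card (interior_values d y)"
proof -
  \<comment> \<open>the grid coordinate of \<open>z i\<close> is the number of positive grid values up to \<open>z i\<close>\<close>
  define grid :: "(nat \<Rightarrow> real) \<Rightarrow> real set" where "grid z = insert 1 (interior_values d z)" for z
  define rank :: "(nat \<Rightarrow> real) \<Rightarrow> nat \<Rightarrow> nat" where
    "rank z i = card {a \<in> grid z. a \<le> z i}" for z i
  have fin: "finite (grid z)" for z
    by (simp add: grid_def)
  have card1: "card (grid z) = Suc (card (interior_values d z))" for z
    by (simp add: grid_def)
  have rank_le: "rank z i \<le> Suc (card (interior_values d z))" for z i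
    unfolding rank_def card1[symmetric] by (intro card_mono fin) auto
  have mono: "rank z i \<le> rank z j" if "z \<in> simplex_points d" "i \<in> {1..d}" "j \<in> {1..d}" "i \<le> j" for z i j
    unfolding rank_def using simplex_pointsD(2)[OF that] fin by (intro card_mono) auto
  have unit: "z i \<in> {0..1}" if "z \<in> simplex_points d" "i \<in> {1..d}" for z i
    using simplex_pointsD(1)[OF that(1)] that(2) by auto
  have inj: "z i = z j" if "z \<in> simplex_points d" "i \<in> {1..d}" "j \<in> {1..d}" "i \<le> j" "rank z i = rank z j" for z i j
  proof (rule ccontr)
    assume "z i \<noteq> z j"
    then have less: "z i < z j"
      using simplex_pointsD(2)[OF that(1-4)] by simp
    have "z j \<noteq> 0"
      using less unit[OF that(1,2)] by simp
    then have "z j \<in> grid z"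
      using that(3) unfolding grid_def by blast
    then have "z j \<in> {a \<in> grid z. a \<le> z j}" "z j \<notin> {a \<in> grid z. a \<le> z i}"
      using less by simp_all
    moreover have "{a \<in> grid z. a \<le> z i} \<subseteq> {a \<in> grid z. a \<le> z j}"
      using less by auto
    ultimately have "{a \<in> grid z. a \<le> z i} \<subset> {a \<in> grid z. a \<le> z j}"
      by blast
    then have "rank z i < rank z j"
      unfolding rank_def using fin by (intro psubset_card_mono) auto
    then show False
      using that(5) by simp
  qed
  have zero: "z i = 0" if "z \<in> simplex_points d" "i \<in> {1..d}" "rank z i = 0" for z i
  proof (rule ccontr)
    assume "z i \<noteq> 0"
    then have "z i \<in> {a \<in> grid z. a \<le> z i}"
      using that(2) unit[OF that(1,2)] by (auto simp: grid_def)
    moreover have "finite {a \<in> grid z. a \<le> z i}"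
      using fin by simp
    ultimately have "0 < rank z i"
      unfolding rank_def card_gt_0_iff by blast
    then show False
      using that(3) by simp
  qed
  have one: "z i = 1" if "z \<in> simplex_points d" "i \<in> {1..d}" "rank z i = Suc (card (interior_values d z))" for z i
  proof -
    have "{a \<in> grid z. a \<le> z i} = grid z"
      using that(3) card1[of z] unfolding rank_def by (intro card_subset_eq fin) auto
    then have "1 \<le> z i"
      by (auto simp: grid_def)
    then show ?thesis
      using unit[OF that(1,2)] by simp
  qed
  let ?f = "\<lambda>i. psi_I t (x i) (y i)" and ?r = "\<lambda>i. rank x i + rank y i"
  let ?J = "{i \<in> {1..d}. ?f i \<notin> {0, 1}}"
  have "?f i = ?f j" if "i \<in> ?J" "j \<in> ?J" "?r i = ?r j" for i j
  proof -
    have *: "?f i = ?f j" if "i \<in> {1..d}" "j \<in> {1..d}" "i \<le> j" "?r i = ?r j" for i j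
    proof -
      have "rank x i = rank x j" "rank y i = rank y j"
        using mono[OF x that(1-3)] mono[OF y that(1-3)] that(4) by auto
      then show ?thesis
        using inj[OF x that(1-3)] inj[OF y that(1-3)] by simp
    qed
    show ?thesis
    proof (cases "i \<le> j")
      case True
      then show ?thesis
        using * that by blast
    next
      case False
      then have "j \<le> i"
        by simp
      then show ?thesis
        using *[of j i] that by (metis (no_types, lifting) mem_Collect_eq)
    qed
  qed
  then have "card (?f ` ?J) \<le> card (?r ` ?J)"
    by (intro card_image_le_if_factors) auto
  moreover have "?r ` ?J \<subseteq> {1..1 + card (interior_values d x) + card (interior_values d y)}"
  proof (rule image_subsetI)
    fix i assume "i \<in> ?J"
    then have i: "i \<in> {1..d}" "?f i \<noteq> 0" "?f i \<noteq> 1"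
      by auto
    have "?r i \<noteq> 0"
    proof
      assume "?r i = 0"
      then have "rank x i = 0" "rank y i = 0"
        by simp_all
      then show False
        using zero[OF x i(1)] zero[OF y i(1)] i(2) by (simp add: psi_I_def)
    qed
    moreover have "?r i \<noteq> Suc (card (interior_values d x)) + Suc (card (interior_values d y))"
    proof
      assume "?r i = Suc (card (interior_values d x)) + Suc (card (interior_values d y))"
      then have "rank x i = Suc (card (interior_values d x))" "rank y i = Suc (card (interior_values d y))"
        using rank_le[of x i] rank_le[of y i] by linarith+
      then show False
        using one[OF x i(1)] one[OF y i(1)] i(3) by (simp add: psi_I_def)
    qed
    ultimately show "?r i \<in> {1..1 + card (interior_values d x) + card (interior_values d y)}"
      using rank_le[of x i] rank_le[of y i] unfolding atLeastAtMost_iff by arith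
  qed
  then have "card (?r ` ?J) \<le> 1 + card (interior_values d x) + card (interior_values d y)"
  proof -
    assume "?r ` ?J \<subseteq> {1..1 + card (interior_values d x) + card (interior_values d y)}"
    from card_mono[OF finite_atLeastAtMost this] show ?thesis
      by (simp only: card_atLeastAtMost add_diff_cancel_left' Suc_eq_plus1 add_diff_cancel_right')
  qed
  moreover have "interior_values d ?f = ?f ` ?J"
    by auto
  ultimately show ?thesis
    by simp
qed

text \<open>The first component of \<open>Delta_I\<close> has interior values only on \<open>(1/2, 1)\<close>, the second only on \<open>(0, 1/2)\<close>.\<close>
lemma card_interior_values_Delta:
  "card (interior_values d (\<lambda>i. fst (Delta_I (x i)))) + card (interior_values d (\<lambda>i. snd (Delta_I (x i)))) \<le>
    card (interior_values d x)"
proof -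
  let ?A = "interior_values d x"
  have "interior_values d (\<lambda>i. fst (Delta_I (x i))) \<subseteq> (\<lambda>a. 2 * a - 1) ` {a \<in> ?A. 1 / 2 < a}"
    by (auto simp: fst_Delta_I max_def)
  then have "card (interior_values d (\<lambda>i. fst (Delta_I (x i)))) \<le> card {a \<in> ?A. 1 / 2 < a}"
    by (rule surj_card_le[rotated]) simp
  moreover have "interior_values d (\<lambda>i. snd (Delta_I (x i))) \<subseteq> (\<lambda>a. 2 * a) ` {a \<in> ?A. a < 1 / 2}"
    by (auto simp: snd_Delta_I min_def)
  then have "card (interior_values d (\<lambda>i. snd (Delta_I (x i)))) \<le> card {a \<in> ?A. a < 1 / 2}"
    by (rule surj_card_le[rotated]) simp
  moreover have "card ({a \<in> ?A. 1 / 2 < a} \<union> {a \<in> ?A. a < 1 / 2}) = card {a \<in> ?A. 1 / 2 < a} + card {a \<in> ?A. a < 1 / 2}"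
    by (intro card_Un_disjoint) auto
  moreover have "card ({a \<in> ?A. 1 / 2 < a} \<union> {a \<in> ?A. a < 1 / 2}) \<le> card ?A"
    by (intro card_mono) auto
  ultimately show ?thesis
    by linarith
qed

lemma card_interior_values_phi:
  assumes "s \<in> {0..1}"
  shows "card (interior_values d (\<lambda>i. phi_I s (x i))) \<le> card (interior_values d x)"
proof -
  have "phi_I s 0 = 0" "phi_I s 1 = 1"
    using assms by (auto simp: phi_I_eq_min min_def field_simps)
  then have "interior_values d (\<lambda>i. phi_I s (x i)) \<subseteq> phi_I s ` interior_values d x"
    by auto
  then show ?thesis
    by (rule surj_card_le[rotated]) simp
qed

lemma interior_values_restrict [simp]: "interior_values d (\<lambda>i\<in>{1..d}. f i) = interior_values d f"
  by auto

lemma cw_skel_std_simplex: "cw_skel (std_simplex d) k = {x \<in> simplex_points d. card (interior_values d x) \<le> k}"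
  by (simp add: std_simplex_def)

lemma lessThan_2: "{..<2::nat} = {0, 1}"
  by auto

lemma mem_gen_top_st_cells:
  "(c, s) \<in> topspace (gen_top st_cells) \<longleftrightarrow> s \<in> {..<cdim st_cells c} \<rightarrow>\<^sub>E {0..1}"
  by (simp add: topspace_gen_top)

text \<open>For \<open>\<mu>\<close> the parameter contributes a dimension exactly when it is interior; at its end points \<open>\<mu>\<close> is a
  projection and the additional dimension is not available.\<close>
lemma cellular_simplex_op:
  assumes b: "b \<in> topspace (gen_top st_cells)"
    and y: "y \<in> cw_skel (cw_power (std_simplex d) (cin st_cells (fst b))) k"
  shows "simplex_op d b y \<in> cw_skel (cw_power (std_simplex d) (cout st_cells (fst b))) (dec_dim st_cells b + k)"
proof -
  obtain c s where bc: "b = (c, s)"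
    by fastforce
  have s: "s \<in> {..<cdim st_cells c} \<rightarrow>\<^sub>E {0..1}"
    using b by (simp add: bc mem_gen_top_st_cells)
  obtain e where yP: "y \<in> {..<cin st_cells c} \<rightarrow>\<^sub>E simplex_points d"
    and e: "\<And>i. i < cin st_cells c \<Longrightarrow> card (interior_values d (y i)) \<le> e i" "(\<Sum>i<cin st_cells c. e i) \<le> k"
    using y by (auto simp: bc cw_power_def cw_skel_std_simplex)
  have closed: "simplex_op d (c, s) y \<in> {..<cout st_cells c} \<rightarrow>\<^sub>E simplex_points d"
    by (rule simplex_op_closed[OF s yP])
  have "(\<Sum>j<cout st_cells c. card (interior_values d (simplex_op d (c, s) y j))) \<le> dec_dim st_cells (c, s) + k"
  proof (cases c)
    case Eps_cell
    then show ?thesis by simp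
  next
    case Delta_cell
    then show ?thesis
      using card_interior_values_Delta[where d = d and x = "y 0"] e
      by (simp add: simplex_op_def interval_op_def lessThan_2)
  next
    case Mu_cell
    have yy: "y 0 \<in> simplex_points d" "y 1 \<in> simplex_points d"
      using PiE_mem[OF yP] Mu_cell by simp_all
    have k: "card (interior_values d (y 0)) + card (interior_values d (y 1)) \<le> k"
      using e(1)[of 0] e(1)[of 1] e(2) Mu_cell by (simp add: lessThan_2)
    have "s 0 \<in> {0..1}"
      using PiE_mem[OF s, of 0] Mu_cell by simp
    then consider "s 0 = 0" | "s 0 = 1" | "0 < s 0" "s 0 < 1"
      by fastforce
    then show ?thesis
    proof cases
      case 3
      then have "{i. i < cdim st_cells c \<and> 0 < s i \<and> s i < 1} = {0}"
        using Mu_cell by auto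
      then have "dec_dim st_cells (c, s) = 1"
        by (simp add: dec_dim_def)
      then show ?thesis
        using card_interior_values_psi[OF yy 3] k Mu_cell by (simp add: simplex_op_def interval_op_def)
    qed (use k Mu_cell in \<open>simp_all add: simplex_op_def interval_op_def psi_I_def\<close>)
  next
    case H_cell
    then have "s 0 \<in> {0..1}"
      using PiE_mem[OF s, of 0] by simp
    then show ?thesis
      using card_interior_values_phi[where d = d and s = "s 0" and x = "y 0"] e H_cell by (simp add: simplex_op_def interval_op_def)
  qed
  moreover have "simplex_op d (c, s) y j \<in> simplex_points d" if "j < cout st_cells c" for j
    using PiE_mem[OF closed] that by simp
  ultimately have "\<exists>e. (\<forall>j<cout st_cells c. simplex_op d (c, s) y j \<in> cw_skel (std_simplex d) (e j)) \<and>
      (\<Sum>j<cout st_cells c. e j) \<le> dec_dim st_cells (c, s) + k"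
    unfolding cw_skel_std_simplex
    by (intro exI[of _ "\<lambda>j. card (interior_values d (simplex_op d (c, s) y j))"]) simp
  then show ?thesis
    using closed by (simp add: bc cw_power_def)
qed


section \<open>The bialgebra structure on simplices\<close>

text \<open>The simplex is cut out of a cube by the closed conditions \<open>x i \<le> x j\<close>.\<close>
lemma compact_std_simplex: "compact_space (cw_top (std_simplex d))"
proof -
  let ?X = "powertop_real {1..d}"
  let ?le = "\<lambda>(i, j). {x \<in> topspace ?X. x j - x i \<in> {0..}}"
  let ?P = "{(i, j). i \<in> {1..d} \<and> j \<in> {1..d} \<and> i \<le> j}"
  have "closedin ?X (?le p)" if "p \<in> ?P" for p
  proof -
    obtain i j where p: "p = (i, j)"
      by fastforce
    then have ij: "i \<in> {1..d}" "j \<in> {1..d}"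
      using that by simp_all
    have "continuous_map ?X euclideanreal (\<lambda>x. x j - x i)"
      using ij by (intro continuous_intros continuous_map_product_projection)
    from closedin_continuous_map_preimage[OF this, of "{0..}"] show ?thesis
      by (simp add: p)
  qed
  then have "closedin ?X (\<Inter> (insert (topspace ?X) (?le ` ?P)))"
    by (intro closedin_Inter) blast+
  moreover have "compactin ?X ({1..d} \<rightarrow>\<^sub>E {0..1})"
    by (simp add: compactin_PiE)
  ultimately have "compactin ?X (\<Inter> (insert (topspace ?X) (?le ` ?P)) \<inter> ({1..d} \<rightarrow>\<^sub>E {0..1}))"
    by (rule closed_Int_compactin)
  moreover have "\<Inter> (insert (topspace ?X) (?le ` ?P)) \<inter> ({1..d} \<rightarrow>\<^sub>E {0..1}) = simplex_points d"
  proof (intro set_eqI iffI)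
    fix x assume x: "x \<in> \<Inter> (insert (topspace ?X) (?le ` ?P)) \<inter> ({1..d} \<rightarrow>\<^sub>E {0..1})"
    have "x i \<le> x j" if "i \<in> {1..d}" "j \<in> {1..d}" "i \<le> j" for i j
    proof -
      have "x \<in> ?le (i, j)"
        using x that by blast
      then show ?thesis
        by simp
    qed
    then show "x \<in> simplex_points d"
      using IntD2[OF x] by (simp only: simplex_points_def mem_Collect_eq) blast
  next
    fix x assume x: "x \<in> simplex_points d"
    then have "x \<in> topspace ?X"
      using simplex_pointsD(1)[OF x] by (simp add: PiE_iff)
    moreover from this have "x \<in> ?le p" if "p \<in> ?P" for p
      using that simplex_pointsD(2)[OF x] by (cases p) simp
    ultimately show "x \<in> \<Inter> (insert (topspace ?X) (?le ` ?P)) \<inter> ({1..d} \<rightarrow>\<^sub>E {0..1})"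
      using simplex_pointsD(1)[OF x] by blast
  qed
  ultimately show ?thesis
    by (simp add: std_simplex_def compact_space_subtopology)
qed

lemma Hausdorff_std_simplex: "Hausdorff_space (cw_top (std_simplex d))"
  by (simp add: std_simplex_def Hausdorff_space_subtopology Hausdorff_space_product_topology)

lemma tuple_append_tuple:
  "tuple_append (length xs) (length ys) (tuple xs) (tuple ys) = tuple (xs @ ys)"
  by (auto simp: tuple_append_def tuple_def nth_append fun_eq_iff)

lemma tuple_PiE: "set xs \<subseteq> A \<Longrightarrow> tuple xs \<in> {..<length xs} \<rightarrow>\<^sub>E A"
  by (auto simp: tuple_def)

lemma eq_tuple0: "x \<in> {..<0} \<rightarrow>\<^sub>E A \<Longrightarrow> x = tuple []"
  by (auto simp: tuple_def fun_eq_iff)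

lemma eq_tuple1: "x \<in> {..<1} \<rightarrow>\<^sub>E A \<Longrightarrow> x = tuple [x 0]"
  by (auto simp: tuple_def PiE_iff extensional_def fun_eq_iff)

lemma eq_tuple2: "x \<in> {..<2} \<rightarrow>\<^sub>E A \<Longrightarrow> x = tuple [x 0, x 1]"
proof (rule ext)
  fix k assume x: "x \<in> {..<2} \<rightarrow>\<^sub>E A"
  have "x k = undefined" if "\<not> k < 2"
    by (rule PiE_arb[OF x]) (use that in simp)
  then show "x k = tuple [x 0, x 1] k"
    by (cases "k < 2") (auto simp: tuple_def less_2_cases_iff)
qed

lemma tuple1_PiE [simp]: "tuple [a] \<in> {..<1} \<rightarrow>\<^sub>E A \<longleftrightarrow> a \<in> A"
  by (auto simp: tuple_def PiE_iff)

lemma tuple2_PiE [simp]: "tuple [a, a'] \<in> {..<2} \<rightarrow>\<^sub>E A \<longleftrightarrow> a \<in> A \<and> a' \<in> A"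
  by (auto simp: tuple_def PiE_iff lessThan_2)

lemma simplex_op_tuple:
  "simplex_op d (Eps_cell, s) y = tuple []"
  "simplex_op d (Delta_cell, s) (tuple [x]) =
    tuple [\<lambda>i\<in>{1..d}. fst (Delta_I (x i)), \<lambda>i\<in>{1..d}. snd (Delta_I (x i))]"
  "simplex_op d (Mu_cell, tuple [t]) (tuple [x, x']) = tuple [\<lambda>i\<in>{1..d}. psi_I t (x i) (x' i)]"
  "simplex_op d (H_cell, tuple [t]) (tuple [x]) = tuple [\<lambda>i\<in>{1..d}. phi_I t (x i)]"
  by (auto simp: simplex_op_def interval_op_def tuple_def fun_eq_iff lessThan_2)

lemma generator_points:
  "(Eps_cell, tuple []) \<in> topspace (gen_top st_cells)"
  "(Delta_cell, tuple []) \<in> topspace (gen_top st_cells)"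
  "t \<in> {0..1} \<Longrightarrow> (Mu_cell, tuple [t]) \<in> topspace (gen_top st_cells)"
  "t \<in> {0..1} \<Longrightarrow> (H_cell, tuple [t]) \<in> topspace (gen_top st_cells)"
  using tuple_PiE[of "[]" "{0..1::real}"] by (simp_all only: mem_gen_top_st_cells st_cells_simps tuple1_PiE) simp_all

lemma generator_graphs:
  "g_eps \<in> graphs st_cells 1 0"
  "g_Delta \<in> graphs st_cells 1 2"
  "t \<in> {0..1} \<Longrightarrow> g_mu t \<in> graphs st_cells 2 1"
  "t \<in> {0..1} \<Longrightarrow> g_h t \<in> graphs st_cells 1 1"
  using g_corolla_graphs[OF generator_points(1)] g_corolla_graphs[OF generator_points(2)]
    g_corolla_graphs[OF generator_points(3)] g_corolla_graphs[OF generator_points(4)]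
  by (simp_all add: g_eps_def g_Delta_def g_mu_def g_h_def)

lemma eval_generators:
  shows "eval_graph st_cells (simplex_op d) g_eps (tuple [x]) = tuple []"
    and "eval_graph st_cells (simplex_op d) g_Delta (tuple [x]) =
      tuple [\<lambda>i\<in>{1..d}. fst (Delta_I (x i)), \<lambda>i\<in>{1..d}. snd (Delta_I (x i))]"
    and "t \<in> {0..1} \<Longrightarrow> eval_graph st_cells (simplex_op d) (g_mu t) (tuple [x, x']) =
      tuple [\<lambda>i\<in>{1..d}. psi_I t (x i) (x' i)]"
    and "t \<in> {0..1} \<Longrightarrow> eval_graph st_cells (simplex_op d) (g_h t) (tuple [x]) =
      tuple [\<lambda>i\<in>{1..d}. phi_I t (x i)]"
proof -
  have ext: "tuple xs \<in> extensional {..<length xs}" for xs :: "(nat \<Rightarrow> real) list"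
    by (simp add: tuple_def)
  have ext1: "tuple [x] \<in> extensional {..<1}" and ext2: "tuple [x, x'] \<in> extensional {..<2}"
    using ext[of "[x]"] ext[of "[x, x']"] by (simp_all add: numeral_2_eq_2)
  have op: "simplex_op d b y \<in> extensional {..<cout st_cells (fst b)}" for b y
    by (simp add: simplex_op_def)
  show "eval_graph st_cells (simplex_op d) g_eps (tuple [x]) = tuple []"
    using eval_g_corolla[where F = "simplex_op d" and x = "tuple [x]", OF generator_points(1) _ op] ext1
    by (simp add: g_eps_def simplex_op_tuple)
  show "eval_graph st_cells (simplex_op d) g_Delta (tuple [x]) =
      tuple [\<lambda>i\<in>{1..d}. fst (Delta_I (x i)), \<lambda>i\<in>{1..d}. snd (Delta_I (x i))]"
    using eval_g_corolla[where F = "simplex_op d" and x = "tuple [x]", OF generator_points(2) _ op] ext1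
    by (simp add: g_Delta_def simplex_op_tuple)
  show "t \<in> {0..1} \<Longrightarrow> eval_graph st_cells (simplex_op d) (g_mu t) (tuple [x, x']) =
      tuple [\<lambda>i\<in>{1..d}. psi_I t (x i) (x' i)]"
    using eval_g_corolla[where F = "simplex_op d" and x = "tuple [x, x']", OF generator_points(3) _ op] ext2
    by (simp add: g_mu_def simplex_op_tuple)
  show "t \<in> {0..1} \<Longrightarrow> eval_graph st_cells (simplex_op d) (g_h t) (tuple [x]) =
      tuple [\<lambda>i\<in>{1..d}. phi_I t (x i)]"
    using eval_g_corolla[where F = "simplex_op d" and x = "tuple [x]", OF generator_points(4) _ op] ext1
    by (simp add: g_h_def simplex_op_tuple)
qed

lemma eval_no_outputs:
  assumes "g \<in> graphs C n 0" "h \<in> graphs C n 0"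
  shows "eval_graph C F g x = eval_graph C F h x"
  using graphsD(2)[OF assms(1)] graphsD(2)[OF assms(2)] by (simp add: eval_graph_def restrict_def)

lemma eval_g_ident_tuple1: "eval_graph C F (g_ident 1) (tuple [x]) = tuple [x]"
  by (rule eval_g_ident) (simp add: tuple_def)

text \<open>The attaching maps amount to \<open>psi_I 0 x y = x\<close>, \<open>psi_I 1 x y = y\<close>, \<open>phi_I 0 x = x\<close> and
  \<open>phi_I 1 x = snd (Delta_I x)\<close> on the unit interval.\<close>
lemma attach_simplex_op:
  assumes R: "st_attach g h" and g: "g \<in> graphs st_cells n m"
    and x: "x \<in> {..<n} \<rightarrow>\<^sub>E simplex_points d"
  shows "eval_graph st_cells (simplex_op d) g x = eval_graph st_cells (simplex_op d) h x"
  using R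
proof cases
  case 1
  have "n = 2"
    using graphsD(1)[OF g] graphsD(1)[OF generator_graphs(3), of 0] 1(1) by simp
  then obtain a b where ab: "x = tuple [a, b]" "a \<in> simplex_points d"
    using eq_tuple2[of x "simplex_points d"] x tuple2_PiE by metis
  have "eval_graph st_cells (simplex_op d) h x = tuple [a]"
    using eval_g_hcomp[OF g_ident_graphs[of 1] generator_graphs(1), where F = "simplex_op d" and x = "tuple [a]" and y = "tuple [b]"]
      tuple_append_tuple[of "[a]" "[b]"] tuple_append_tuple[of "[a]" "[]"]
    by (simp add: 1 ab(1) eval_generators eval_g_ident_tuple1[simplified])
  moreover have "(\<lambda>i\<in>{1..d}. psi_I 0 (a i) (b i)) = a"
    using simplex_pointsD(1)[OF ab(2)] by (auto simp: psi_I_def PiE_iff extensional_def fun_eq_iff)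
  ultimately show ?thesis
    by (simp add: 1 ab(1) eval_generators)
next
  case 2
  have "n = 2"
    using graphsD(1)[OF g] graphsD(1)[OF generator_graphs(3), of 1] 2(1) by simp
  then obtain a b where ab: "x = tuple [a, b]" "b \<in> simplex_points d"
    using eq_tuple2[of x "simplex_points d"] x tuple2_PiE by metis
  have "eval_graph st_cells (simplex_op d) h x = tuple [b]"
    using eval_g_hcomp[OF generator_graphs(1) g_ident_graphs[of 1], where F = "simplex_op d" and x = "tuple [a]" and y = "tuple [b]"]
      tuple_append_tuple[of "[a]" "[b]"] tuple_append_tuple[of "[]" "[b]"]
    by (simp add: 2 ab(1) eval_generators eval_g_ident_tuple1[simplified])
  moreover have "(\<lambda>i\<in>{1..d}. psi_I 1 (a i) (b i)) = b"
    using simplex_pointsD(1)[OF ab(2)] by (auto simp: psi_I_def PiE_iff extensional_def fun_eq_iff)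
  ultimately show ?thesis
    by (simp add: 2 ab(1) eval_generators)
next
  case 3
  have "n = 1"
    using graphsD(1)[OF g] graphsD(1)[OF generator_graphs(4), of 0] 3(1) by simp
  then obtain a where a: "x = tuple [a]" "a \<in> simplex_points d"
    using eq_tuple1[of x "simplex_points d"] x tuple1_PiE by metis
  have "phi_I 0 (a i) = a i" if "i \<in> {1..d}" for i
    using simplex_pointsD(1)[OF a(2)] that by (fastforce simp: phi_I_def)
  then have "(\<lambda>i\<in>{1..d}. phi_I 0 (a i)) = a"
    using simplex_pointsD(1)[OF a(2)] by (auto simp: PiE_iff extensional_def fun_eq_iff)
  then show ?thesis
    by (simp add: 3 a(1) eval_generators eval_g_ident_tuple1[simplified])
next
  case 4
  have "n = 1"
    using graphsD(1)[OF g] graphsD(1)[OF generator_graphs(4), of 1] 4(1) by simp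
  then obtain a where a: "x = tuple [a]"
    using eq_tuple1[of x "simplex_points d"] x by metis
  let ?k = "g_hcomp g_eps (g_ident 1)" and ?l = "\<lambda>i\<in>{1..d}. fst (Delta_I (a i))" and ?r = "\<lambda>i\<in>{1..d}. snd (Delta_I (a i))"
  have k: "?k \<in> graphs st_cells 2 1"
    using g_hcomp_graphs[OF generator_graphs(1) g_ident_graphs, of 1] by (simp add: numeral_2_eq_2)
  have "eval_graph st_cells (simplex_op d) ?k (tuple [?l, ?r]) = tuple [?r]"
    using eval_g_hcomp[OF generator_graphs(1) g_ident_graphs[of 1], where F = "simplex_op d" and x = "tuple [?l]" and y = "tuple [?r]"]
      tuple_append_tuple[of "[?l]" "[?r]"] tuple_append_tuple[of "[]" "[?r]"]
    by (simp add: eval_generators eval_g_ident_tuple1[simplified])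
  then have "eval_graph st_cells (simplex_op d) h x = tuple [?r]"
    by (simp add: 4 a eval_g_vcomp[OF generator_graphs(2) k] eval_generators del: One_nat_def)
  moreover have "phi_I 1 u = snd (Delta_I u)" for u
    by (simp add: phi_I_def Delta_I_def)
  ultimately show ?thesis
    by (simp add: 4 a eval_generators)
qed

text \<open>The relations only involve operations into the one-point space \<open>X\<^sup>0\<close>, so they hold for trivial reasons.\<close>
lemma st_rel_no_outputs:
  assumes "st_rel g h" "g \<in> graphs st_cells n m"
  shows "m = 0"
  using assms(1)
proof cases
  case 1
  then show ?thesis
    using graphsD(2)[OF assms(2)] graphsD(2)[OF generator_graphs(1)] by simp
qed (use graphsD(2)[OF assms(2)] graphsD(2)[OF generator_graphs(1)] in simp_all)

interpretation simplex: cell_algebra st_cells "sup st_attach st_rel" "std_simplex d" "simplex_op d" for d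
proof
  fix g h :: "st_cell graph" and n m x
  assume g: "g \<in> graphs st_cells n m" and h: "h \<in> graphs st_cells n m"
    and R: "sup st_attach st_rel g h" and x: "x \<in> cw_points (cw_power (std_simplex d) n)"
  from R consider "st_attach g h" | "st_rel g h"
    by auto
  then show "eval_graph st_cells (simplex_op d) g x = eval_graph st_cells (simplex_op d) h x"
  proof cases
    case 1
    then show ?thesis
      using attach_simplex_op g x by simp
  next
    case 2
    then show ?thesis
      using eval_no_outputs st_rel_no_outputs g h by metis
  qed
qed (fact compact_std_simplex Hausdorff_std_simplex continuous_simplex_op cellular_simplex_op)+

lemma generator_cases:
  assumes "b \<in> topspace (gen_top st_cells)"
  obtains "b = (Eps_cell, tuple [])" | "b = (Delta_cell, tuple [])"
    | t where "b = (Mu_cell, tuple [t])" "t \<in> {0..1}" | t where "b = (H_cell, tuple [t])" "t \<in> {0..1}"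
proof -
  obtain c s where b: "b = (c, s)"
    by fastforce
  have s: "s \<in> {..<cdim st_cells c} \<rightarrow>\<^sub>E {0..1}"
    using assms by (simp add: b mem_gen_top_st_cells)
  show thesis
  proof (cases c)
    case Eps_cell
    then show thesis using that(1) b eq_tuple0[of s] s by simp
  next
    case Delta_cell
    then show thesis using that(2) b eq_tuple0[of s] s by simp
  next
    case Mu_cell
    then have s1: "s \<in> {..<1} \<rightarrow>\<^sub>E {0..1}" using s by simp
    show thesis
      using that(3)[of "s 0"] b eq_tuple1[OF s1] tuple1_PiE[of "s 0" "{0..1}"] s1 Mu_cell by simp
  next
    case H_cell
    then have s1: "s \<in> {..<1} \<rightarrow>\<^sub>E {0..1}" using s by simp
    show thesis
      using that(4)[of "s 0"] b eq_tuple1[OF s1] tuple1_PiE[of "s 0" "{0..1}"] s1 H_cell by simp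
  qed
qed

text \<open>Every point of a generating cell is one of those in the definition of \<open>generator_values\<close>, and every tuple of
  one or two points is given by a list; hence prescribing the values on generators prescribes the action of all
  corollas.\<close>
lemma generator_values_iff:
  "generator_values d \<Phi> \<longleftrightarrow>
    (\<forall>b \<in> topspace (gen_top st_cells). \<forall>y \<in> {..<cin st_cells (fst b)} \<rightarrow>\<^sub>E simplex_points d.
      \<Phi> (cin st_cells (fst b)) (cout st_cells (fst b)) (S_gen (g_corolla st_cells b), y) = simplex_op d b y)"
  (is "_ \<longleftrightarrow> ?R")
proof
  assume G: "generator_values d \<Phi>"
  show ?R
  proof (intro ballI)
    fix b y assume b: "b \<in> topspace (gen_top st_cells)" and y: "y \<in> {..<cin st_cells (fst b)} \<rightarrow>\<^sub>E simplex_points d"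
    from b show "\<Phi> (cin st_cells (fst b)) (cout st_cells (fst b)) (S_gen (g_corolla st_cells b), y) = simplex_op d b y"
    proof (cases rule: generator_cases)
      case 1
      then have "y \<in> {..<1} \<rightarrow>\<^sub>E simplex_points d" using y by simp
      then obtain a where "y = tuple [a]" "a \<in> simplex_points d"
        using eq_tuple1 tuple1_PiE by metis
      then show ?thesis
        using G 1 by (simp add: generator_values_def g_eps_def simplex_op_tuple)
    next
      case 2
      then have "y \<in> {..<1} \<rightarrow>\<^sub>E simplex_points d" using y by simp
      then obtain a where "y = tuple [a]" "a \<in> simplex_points d"
        using eq_tuple1 tuple1_PiE by metis
      then show ?thesis
        using G 2 by (simp add: generator_values_def g_Delta_def simplex_op_tuple)
    next
      case (3 t)
      then have "y \<in> {..<2} \<rightarrow>\<^sub>E simplex_points d" using y by simp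
      then obtain a a' where "y = tuple [a, a']" "a \<in> simplex_points d" "a' \<in> simplex_points d"
        using eq_tuple2 tuple2_PiE by metis
      then show ?thesis
        using G 3 by (simp add: generator_values_def g_mu_def simplex_op_tuple)
    next
      case (4 t)
      then have "y \<in> {..<1} \<rightarrow>\<^sub>E simplex_points d" using y by simp
      then obtain a where "y = tuple [a]" "a \<in> simplex_points d"
        using eq_tuple1 tuple1_PiE by metis
      then show ?thesis
        using G 4 by (simp add: generator_values_def g_h_def simplex_op_tuple)
    qed
  qed
next
  assume ?R
  then have R: "\<Phi> (cin st_cells c) (cout st_cells c) (S_gen (g_corolla st_cells (c, s)), y) = simplex_op d (c, s) y"
    if "(c, s) \<in> topspace (gen_top st_cells)" "y \<in> {..<cin st_cells c} \<rightarrow>\<^sub>E simplex_points d" for c s y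
    using that by fastforce
  show "generator_values d \<Phi>"
    unfolding generator_values_def
  proof (intro conjI ballI)
    fix x assume x: "x \<in> simplex_points d"
    show "\<Phi> 1 2 (S_gen g_Delta, tuple [x]) = tuple [\<lambda>i\<in>{1..d}. fst (Delta_I (x i)), \<lambda>i\<in>{1..d}. snd (Delta_I (x i))]"
      using R[OF generator_points(2), of "tuple [x]"] x
      by (simp only: g_Delta_def simplex_op_tuple st_cells_simps tuple1_PiE simp_thms)
    show "\<Phi> 1 0 (S_gen g_eps, tuple [x]) = tuple []"
      using R[OF generator_points(1), of "tuple [x]"] x
      by (simp only: g_eps_def simplex_op_tuple st_cells_simps tuple1_PiE simp_thms)
    fix s :: real assume s: "s \<in> {0..1}"
    show "\<Phi> 2 1 (S_gen (g_mu s), tuple [x, y]) = tuple [\<lambda>i\<in>{1..d}. psi_I s (x i) (y i)]" if "y \<in> simplex_points d" for y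
      using R[OF generator_points(3)[OF s], of "tuple [x, y]"] x that
      by (simp only: g_mu_def simplex_op_tuple st_cells_simps tuple2_PiE simp_thms)
    show "\<Phi> 1 1 (S_gen (g_h s), tuple [x]) = tuple [\<lambda>i\<in>{1..d}. phi_I s (x i)]"
      using R[OF generator_points(4)[OF s], of "tuple [x]"] x
      by (simp only: g_h_def simplex_op_tuple st_cells_simps tuple1_PiE simp_thms)
  qed
qed

theorem lemma7:
  fixes d :: nat
  shows "\<exists>!\<Phi>. is_bialgebra S_tilde (std_simplex d) \<Phi> \<and> generator_values d \<Phi>"
proof (rule ex1I)
  show "is_bialgebra S_tilde (std_simplex d) (simplex.action d) \<and> generator_values d (simplex.action d)"
    using simplex.is_bialgebra_action[of d] simplex.action_corolla[where d = d]
    by (simp add: S_tilde_def S_gen_def generator_values_iff)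
next
  fix \<Phi> assume \<Phi>: "is_bialgebra S_tilde (std_simplex d) \<Phi> \<and> generator_values d \<Phi>"
  show "\<Phi> = simplex.action d"
  proof (rule bialgebra_eqI[OF _ simplex.is_bialgebra_action])
    show "is_bialgebra (presented_prop st_cells (sup st_attach st_rel)) (std_simplex d) \<Phi>"
      using \<Phi> by (simp add: S_tilde_def)
  qed (use \<Phi> simplex.action_corolla[where d = d] in \<open>simp add: generator_values_iff S_gen_def\<close>)
qed

end
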